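(* Let $1\leq p<\infty$ and $0<\alpha<d$. Then there is a constant $C_{d,\alpha,p}$ depending only on $d,\alpha,p$ such that for all $f\in W^{1,p}(\mathbb{R}^d)$, \[ \Biggl(\sum_{Q\in\mathcal{Q}_\alpha}\bigl(\ell(Q)^{\frac dp-1}f_Q\bigr)^p\Biggr)^{\frac1p}\leq C_{d,\alpha,p}\|\nabla f\|_{L^p(\mathbb{R}^d)}. \] For $p=1$, the same holds for all $f\in\mathrm{BV}(\mathbb{R}^d)$ with $\|\nabla f\|_1$ replaced by $\operatorname{var} f$. The endpoint $p=\infty$ also holds: $\sup_{Q\in\mathcal{Q}_\alpha}\ell(Q)^{-1}f_Q\le C_{d,\alpha}\|\nabla f\|_{L^\infty}$.
   Context: Dyadic cubes are the cubes $[x_1,x_1+2^n)\times\dots\times[x_d,x_d+2^n)$ with $n\in\mathbb{Z}$ and $x_i\in2^n\mathbb{Z}$; $\ell(Q)$ denotes the sidelength of $Q$. For a cube $Q$, $f_Q=\frac1{|Q|}\int_Q|f|$. $\mathcal{Q}_\alpha$ is the set of all dyadic cubes $Q$ such that for every dyadic cube $P\supsetneq Q$ we have $\ell(P)^\alpha f_P<\ell(Q)^\alpha f_Q$. $\operatorname{var} f$ is the total variation of $f\in\mathrm{BV}(\mathbb{R}^d)$. *)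

theory Defs
  imports "HOL-Analysis.Analysis" "HOL-Probability.Essential_Supremum"
begin

text \<open>The dyadic cube with sidelength 2^n and lower corner 2^n * k, k in Z^d.
  Dyadic cubes are indexed by pairs (n, k); distinct pairs give distinct cubes.\<close>
definition dcube :: "int \<Rightarrow> int^'n \<Rightarrow> (real^'n) set" where
  "dcube n k = {y. \<forall>i. (2 powr n) * of_int (k$i) \<le> y$i \<and> y$i < (2 powr n) * (of_int (k$i) + 1)}"

definition side :: "int \<Rightarrow> real" where
  "side n = 2 powr n"

definition avg :: "(real^'n \<Rightarrow> real) \<Rightarrow> (real^'n) set \<Rightarrow> real" where
  "avg f Q = (LINT x:Q|lebesgue. \<bar>f x\<bar>) / measure lebesgue Q"

definition Qalpha :: "real \<Rightarrow> (real^'n \<Rightarrow> real) \<Rightarrow> (int \<times> (int^'n)) set" where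
  "Qalpha \<alpha> f = {(n, k). \<forall>m l. dcube n k \<subset> dcube m l \<longrightarrow>
       (side m) powr \<alpha> * avg f (dcube m l) < (side n) powr \<alpha> * avg f (dcube n k)}"

definition partial :: "'n \<Rightarrow> (real^'n \<Rightarrow> real) \<Rightarrow> real^'n \<Rightarrow> real" where
  "partial i \<phi> x = frechet_derivative \<phi> (at x) (axis i 1)"

fun iter_partial :: "'n list \<Rightarrow> (real^'n \<Rightarrow> real) \<Rightarrow> real^'n \<Rightarrow> real" where
  "iter_partial [] \<phi> = \<phi>"
| "iter_partial (i # is) \<phi> = partial i (iter_partial is \<phi>)"

definition smooth :: "(real^'n \<Rightarrow> real) \<Rightarrow> bool" where
  "smooth \<phi> \<longleftrightarrow> (\<forall>is x. iter_partial is \<phi> differentiable (at x))"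

definition test_fun :: "(real^'n \<Rightarrow> real) \<Rightarrow> bool" where
  "test_fun \<phi> \<longleftrightarrow> smooth \<phi> \<and> compact (closure {x. \<phi> x \<noteq> 0})"

definition loc_integrable :: "(real^'n \<Rightarrow> real) \<Rightarrow> bool" where
  "loc_integrable f \<longleftrightarrow> (\<forall>K. compact K \<longrightarrow> set_integrable lebesgue K f)"

definition weak_gradient :: "(real^'n \<Rightarrow> real) \<Rightarrow> (real^'n \<Rightarrow> real^'n) \<Rightarrow> bool" where
  "weak_gradient f g \<longleftrightarrow> loc_integrable f \<and> (\<forall>i. loc_integrable (\<lambda>x. g x $ i)) \<and>
     (\<forall>\<phi> i. test_fun \<phi> \<longrightarrow>
        (LINT x|lebesgue. f x * partial i \<phi> x) = - (LINT x|lebesgue. g x $ i * \<phi> x))"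

definition Lp :: "real \<Rightarrow> ('a::euclidean_space \<Rightarrow> 'b::real_normed_vector) \<Rightarrow> bool" where
  "Lp p f \<longleftrightarrow> f \<in> borel_measurable lebesgue \<and> integrable lebesgue (\<lambda>x. norm (f x) powr p)"

definition Lp_norm :: "real \<Rightarrow> ('a::euclidean_space \<Rightarrow> 'b::real_normed_vector) \<Rightarrow> real" where
  "Lp_norm p f = (LINT x|lebesgue. norm (f x) powr p) powr (1 / p)"

definition sobolev :: "real \<Rightarrow> (real^'n \<Rightarrow> real) \<Rightarrow> (real^'n \<Rightarrow> real^'n) \<Rightarrow> bool" where
  "sobolev p f g \<longleftrightarrow> Lp p f \<and> Lp p g \<and> weak_gradient f g"

definition Linf_norm :: "('a::euclidean_space \<Rightarrow> 'b::real_normed_vector) \<Rightarrow> ereal" where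
  "Linf_norm f = esssup lebesgue (\<lambda>x. ereal (norm (f x)))"

definition Linf :: "('a::euclidean_space \<Rightarrow> 'b::real_normed_vector) \<Rightarrow> bool" where
  "Linf f \<longleftrightarrow> f \<in> borel_measurable lebesgue \<and> Linf_norm f < \<infinity>"

definition sobolev_inf :: "(real^'n \<Rightarrow> real) \<Rightarrow> (real^'n \<Rightarrow> real^'n) \<Rightarrow> bool" where
  "sobolev_inf f g \<longleftrightarrow> Linf f \<and> Linf g \<and> weak_gradient f g"

definition divg :: "(real^'n \<Rightarrow> real^'n) \<Rightarrow> real^'n \<Rightarrow> real" where
  "divg \<phi> x = (\<Sum>i\<in>UNIV. partial i (\<lambda>y. \<phi> y $ i) x)"

definition var_set :: "(real^'n \<Rightarrow> real) \<Rightarrow> real set" where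
  "var_set f = {LINT x|lebesgue. f x * divg \<phi> x | \<phi>.
      (\<forall>i. test_fun (\<lambda>x. \<phi> x $ i)) \<and> (\<forall>x. norm (\<phi> x) \<le> 1)}"

definition var :: "(real^'n \<Rightarrow> real) \<Rightarrow> real" where
  "var f = Sup (var_set f)"

definition BV :: "(real^'n \<Rightarrow> real) \<Rightarrow> bool" where
  "BV f \<longleftrightarrow> Lp 1 f \<and> bdd_above (var_set f)"

end

theory Submission
  imports Defs
begin

text \<open>
  Let \<open>u = |f|\<close> with \<open>f\<close> continuously differentiable. Fix \<open>\<delta> = 2\<^sup>-\<^sup>d\<^sup>-\<^sup>1\<close> and let \<open>B(S)\<close> be the largest
  \<open>\<delta>\<close>-quantile of \<open>u\<close> among \<open>S\<close> and its dyadic ancestors. If \<open>B(S)\<close> exceeds its value \<open>a\<close> on the parent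
  of \<open>S\<close>, then \<open>u \<ge> B(S)\<close> on a fixed portion of \<open>S\<close> while \<open>u \<le> a\<close> on at least half of \<open>S\<close>, so the Poincare
  inequality for the truncation of \<open>u\<close> to \<open>[a, B(S)]\<close> bounds \<open>(B(S) - a)|S|\<close> by \<open>\<ell>(S)\<close> times the integral
  of \<open>|\<nabla>f|\<close> over the points of \<open>S\<close> with \<open>a < u < B(S)\<close>. These value intervals are disjoint along a chain
  of cubes.

  For \<open>Q\<close> in \<open>Q\<^sub>\<alpha>\<close>, Chebyshev's inequality and the definition of \<open>Q\<^sub>\<alpha>\<close> give \<open>B(P) \<le> f\<^sub>Q/4\<close> for a fixed-order
  ancestor \<open>P\<close>, so telescoping from \<open>P\<close> downwards bounds \<open>f\<^sub>Q\<close> by the average over \<open>P\<close> of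
  \<open>|\<nabla>f(x)| \<ell>(x)\<close>, where \<open>\<ell>(x) < \<ell>(P)\<close> is the one scale to which \<open>x\<close> is charged. By Jensen's inequality
  the sum over \<open>Q\<close> is at most a multiple of the integral of \<open>|\<nabla>f(x)|\<^sup>p\<close> times the geometric series of
  \<open>(\<ell>(x)/\<ell>(P))\<^sup>p\<close> over \<open>P \<ni> x\<close>.

  For finitely many cubes only finitely many ancestors matter, hence the general case follows
  by mollification.
\<close>

section \<open>Poincare inequality for truncations, and quantiles\<close>

text \<open>Up to constants, the plain Poincare inequality on P would bound the average over Q by
  the average of \<ell>(P)|\<nabla>f| over P. The gradient at x would then be charged with equal
  strength by cubes of every scale around x, and the sum over Q would have no decay. The work goes
  into replacing \<ell>(P) by one scale attached to x. A difference of averages sees the gradient on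
  the whole cube; quantiles speak of the sets where |f| is above or below a level, so only the
  gradient between two levels enters.

  The value of \<delta> comes from doubling: a parent has 2^d times the measure of S, so a
  \<delta>-fraction of the parent covers at most half of S. Chebyshev's inequality for a
  \<delta>-quantile loses 2^(d+1). The order \<kappa> of the ancestor satisfies \<alpha>\<kappa>
  \<ge> d + 3, which leaves the factor 1/4. Another quarter is lost where the descent stops at a
  fine level, and the remaining half is enough to absorb both.\<close>

lemma crossing_interval:
  fixes \<psi> :: "real \<Rightarrow> real"
  assumes cont: "continuous_on {0..1} \<psi>" and "\<psi> 0 \<le> a" "b \<le> \<psi> 1" "a < b"
  obtains s t where "0 \<le> s" "s < t" "t \<le> 1" "\<psi> s \<le> a" "b \<le> \<psi> t"
    "\<And>r. s < r \<Longrightarrow> r < t \<Longrightarrow> a < \<psi> r \<and> \<psi> r < b"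
proof -
  \<comment> \<open>\<open>t\<close> will be the first time at level \<open>b\<close>, and
    \<open>s\<close> the last time before \<open>t\<close> at a level not exceeding
    \<open>a\<close>; these extremal choices exclude both kinds of values in between.\<close>
  define T where "T = {0..1} \<inter> \<psi> -` {b..}"
  have "1 \<in> T" using assms by (simp add: T_def)
  moreover have "compact T"
    unfolding T_def
    by (auto intro!: continuous_closed_preimage[OF cont] simp: compact_eq_bounded_closed bounded_Int)
  ultimately have T: "compact T" "T \<noteq> {}" by auto
  then obtain t where t: "t \<in> T" "\<And>r. r \<in> T \<Longrightarrow> t \<le> r"
    using compact_attains_inf by metis
  have t01: "0 \<le> t" "t \<le> 1" "b \<le> \<psi> t"
    using t(1) by (auto simp: T_def)
  have cont': "continuous_on {0..t} \<psi>"
    using cont by (rule continuous_on_subset) (use t01 in auto)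
  define S where "S = {0..t} \<inter> \<psi> -` {..a}"
  have "0 \<in> S" using assms t01 by (simp add: S_def)
  moreover have "compact S"
    unfolding S_def
    by (auto intro!: continuous_closed_preimage[OF cont'] simp: compact_eq_bounded_closed bounded_Int)
  ultimately have S: "compact S" "S \<noteq> {}" by auto
  then obtain s where s: "s \<in> S" "\<And>r. r \<in> S \<Longrightarrow> r \<le> s"
    using compact_attains_sup by metis
  have s01: "0 \<le> s" "s \<le> t" "\<psi> s \<le> a"
    using s(1) by (auto simp: S_def)
  have "s \<noteq> t" using s01 t01 \<open>a < b\<close> by auto
  moreover have "a < \<psi> r \<and> \<psi> r < b" if "s < r" "r < t" for r
    using s(2)[of r] t(2)[of r] that s01 t01 by (force simp: S_def T_def)
  ultimately show ?thesis
    using that[of s t] s01 t01 by auto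
qed

text \<open>The crossing interval is found for |\<phi>|, but the fundamental theorem of calculus is
  applied to \<phi> itself, so the kink of the absolute value does no harm: |\<phi> t| - |\<phi> s|
  \<le> |\<phi> t - \<phi> s|.\<close>

lemma truncated_variation_segment:
  fixes \<phi> :: "real \<Rightarrow> real"
  assumes der: "\<And>t. (\<phi> has_real_derivative \<phi>' t) (at t)" and cont: "continuous_on UNIV \<phi>'"
    and "\<bar>\<phi> 0\<bar> \<le> a" "b \<le> \<bar>\<phi> 1\<bar>"
  shows "ennreal (b - a) \<le> (\<integral>\<^sup>+t. ennreal \<bar>\<phi>' t\<bar> * indicator {t. a < \<bar>\<phi> t\<bar> \<and> \<bar>\<phi> t\<bar> < b} t
                              * indicator {0..1} t \<partial>lborel)"
proof (cases "a < b")
  case True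
  have c\<phi>: "continuous_on UNIV \<phi>"
    using der by (auto intro!: continuous_at_imp_continuous_on DERIV_isCont)
  obtain s t where st: "0 \<le> s" "s < t" "t \<le> 1" "\<bar>\<phi> s\<bar> \<le> a" "b \<le> \<bar>\<phi> t\<bar>"
    "\<And>r. s < r \<Longrightarrow> r < t \<Longrightarrow> a < \<bar>\<phi> r\<bar> \<and> \<bar>\<phi> r\<bar> < b"
    using crossing_interval[of "\<lambda>t. \<bar>\<phi> t\<bar>" a b] True assms
      continuous_on_rabs[OF continuous_on_subset[OF c\<phi>, of "{0..1}"]] by auto
  have I: "set_integrable lborel {s..t} \<phi>'"
    by (rule borel_integrable_atLeastAtMost') (use cont in \<open>auto intro: continuous_on_subset\<close>)
  have F: "(LINT x:{s..t}|lborel. \<phi>' x) = \<phi> t - \<phi> s"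
    unfolding set_lebesgue_integral_def
    using integral_FTC_Icc[of s t \<phi> \<phi>'] st der cont
    by (auto simp: has_real_derivative_iff_has_vector_derivative[symmetric]
       intro: has_field_derivative_at_within continuous_on_subset)
  have "b - a \<le> \<bar>\<phi> t - \<phi> s\<bar>" using st by linarith
  also have "\<dots> = norm (LINT x:{s..t}|lborel. \<phi>' x)" by (simp add: F)
  finally have "ennreal (b - a) \<le> ennreal (norm (LINT x:{s..t}|lborel. \<phi>' x))"
    by (rule ennreal_leI)
  also have "\<dots> \<le> (\<integral>\<^sup>+x. ennreal (norm (indicator {s..t} x *\<^sub>R \<phi>' x)) \<partial>lborel)"
    unfolding set_lebesgue_integral_def
    by (rule integral_norm_bound_ennreal) (use I in \<open>simp add: set_integrable_def\<close>)
  also have "\<dots> \<le> (\<integral>\<^sup>+t. ennreal \<bar>\<phi>' t\<bar> * indicator {t. a < \<bar>\<phi> t\<bar> \<and> \<bar>\<phi> t\<bar> < b} t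
                              * indicator {0..1} t \<partial>lborel)"
  proof (rule nn_integral_mono_AE)
    \<comment> \<open>At \<open>s\<close> and \<open>t\<close> the value may equal \<open>a\<close>
      or \<open>b\<close>; these two points form a null set.\<close>
    show "AE x in lborel. ennreal (norm (indicator {s..t} x *\<^sub>R \<phi>' x))
         \<le> ennreal \<bar>\<phi>' x\<bar> * indicator {t. a < \<bar>\<phi> t\<bar> \<and> \<bar>\<phi> t\<bar> < b} x * indicator {0..1} x"
      using AE_lborel_singleton[of s] AE_lborel_singleton[of t]
    proof eventually_elim
      case (elim x)
      then show ?case using st(6)[of x] st by (auto split: split_indicator)
    qed
  qed
  finally show ?thesis .
qed (simp add: ennreal_neg)

lemma nn_integral_lborel_affine:
  fixes G :: "'a::euclidean_space \<Rightarrow> ennreal"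
  assumes [measurable]: "G \<in> borel_measurable borel" and c: "c > 0"
  shows "ennreal (c ^ DIM('a)) * (\<integral>\<^sup>+x. G (t + c *\<^sub>R x) \<partial>lborel) = (\<integral>\<^sup>+x. G x \<partial>lborel)"
proof -
  have "(\<integral>\<^sup>+x. G x \<partial>lborel) = (\<integral>\<^sup>+x. G x \<partial>density (distr lborel borel (\<lambda>x. t + c *\<^sub>R x)) (\<lambda>_. \<bar>c\<bar>^DIM('a)))"
    using lborel_affine[of c t] c by simp
  also have "\<dots> = ennreal (c ^ DIM('a)) * (\<integral>\<^sup>+x. G (t + c *\<^sub>R x) \<partial>lborel)"
    using c by (simp add: nn_integral_density nn_integral_distr nn_integral_cmult)
  finally show ?thesis by simp
qed

text \<open>Integrate the segment estimate over x \<in> A and y \<in> B. For a fixed time t the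
  point x + t(y - x) is affine in y with factor t and in x with factor 1 - t. One of the two is at
  least 1/2, so a change of variables in that variable costs at most 2^d, and the other variable
  contributes the measure of S. Working on segments avoids the truncated function itself, which need
  not be differentiable.\<close>

lemma poincare_truncated:
  fixes f :: "'a::euclidean_space \<Rightarrow> real" and D :: "'a \<Rightarrow> 'a"
  assumes der: "\<And>x. (f has_derivative (\<lambda>h. D x \<bullet> h)) (at x)" and cont: "continuous_on UNIV D"
    and S: "convex S" "S \<in> sets borel" and L: "\<And>x y. x \<in> S \<Longrightarrow> y \<in> S \<Longrightarrow> norm (y - x) \<le> L"
    and A: "A \<subseteq> S" "A \<in> sets borel" "\<And>x. x \<in> A \<Longrightarrow> \<bar>f x\<bar> \<le> a"
    and B: "B \<subseteq> S" "B \<in> sets borel" "\<And>x. x \<in> B \<Longrightarrow> b \<le> \<bar>f x\<bar>"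
  shows "ennreal (b - a) * (emeasure lborel A * emeasure lborel B)
     \<le> ennreal (L * 2 ^ DIM('a)) * emeasure lborel S *
        (\<integral>\<^sup>+x. ennreal (norm (D x)) * indicator {x\<in>S. a < \<bar>f x\<bar> \<and> \<bar>f x\<bar> < b} x \<partial>lborel)"
proof (cases "S = {}")
  case False
  then have L0: "L \<ge> 0" using L by (metis all_not_in_conv norm_ge_zero order_trans)
  note [measurable] = S(2) A(2) B(2)
  have cf: "continuous_on UNIV f"
    using der by (auto intro!: continuous_at_imp_continuous_on has_derivative_continuous)
  have [measurable]: "f \<in> borel_measurable borel" "D \<in> borel_measurable borel"
    using cf cont by (auto intro: borel_measurable_continuous_onI)
  define G where "G x = ennreal (norm (D x)) * indicator {x\<in>S. a < \<bar>f x\<bar> \<and> \<bar>f x\<bar> < b} x" for x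
  have Gm [measurable]: "G \<in> borel_measurable borel" unfolding G_def by measurable
  have seg: "ennreal (b - a) \<le> (\<integral>\<^sup>+t. ennreal L * G (x + t *\<^sub>R (y - x)) * indicator {0..1} t \<partial>lborel)"
    if xy: "x \<in> A" "y \<in> B" for x y
  proof -
    let ?p = "\<lambda>t. x + t *\<^sub>R (y - x)"
    have xyS: "x \<in> S" "y \<in> S" using xy A B by auto
    have inS: "?p t \<in> S" if "t \<in> {0..1}" for t
    proof -
      have "?p t = (1 - t) *\<^sub>R x + t *\<^sub>R y" by (simp add: algebra_simps)
      then show ?thesis using convexD_alt[OF S(1) xyS, of t] that by simp
    qed
    have d: "((\<lambda>t. f (?p t)) has_real_derivative (D (?p t) \<bullet> (y - x))) (at t)" for t
    proof -
      have "((\<lambda>t. ?p t) has_derivative (\<lambda>h. h *\<^sub>R (y - x))) (at t)"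
        by (auto intro!: derivative_eq_intros)
      note has_derivative_compose[OF this der[of "?p t"]]
      moreover have "(\<lambda>h. D (?p t) \<bullet> (h *\<^sub>R (y - x))) = (*) (D (?p t) \<bullet> (y - x))"
        by (auto simp: mult.commute)
      ultimately show ?thesis by (simp only: has_field_derivative_def)
    qed
    have c: "continuous_on UNIV (\<lambda>t. D (?p t) \<bullet> (y - x))"
      by (intro continuous_intros continuous_on_compose2[OF cont]) auto
    have "ennreal (b - a) \<le> (\<integral>\<^sup>+t. ennreal \<bar>D (?p t) \<bullet> (y - x)\<bar> *
        indicator {t. a < \<bar>f (?p t)\<bar> \<and> \<bar>f (?p t)\<bar> < b} t * indicator {0..1} t \<partial>lborel)"
      by (rule truncated_variation_segment[OF d c]) (use xy A B in auto)
    also have "\<dots> \<le> (\<integral>\<^sup>+t. ennreal L * G (?p t) * indicator {0..1} t \<partial>lborel)"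
    proof (rule nn_integral_mono)
      fix t :: real
      have "\<bar>D (?p t) \<bullet> (y - x)\<bar> \<le> norm (D (?p t)) * norm (y - x)" by (rule Cauchy_Schwarz_ineq2)
      also have "\<dots> \<le> norm (D (?p t)) * L" using L[OF xyS] by (intro mult_left_mono) auto
      finally have "ennreal \<bar>D (?p t) \<bullet> (y - x)\<bar> \<le> ennreal L * ennreal (norm (D (?p t)))"
        using L0 by (simp add: ennreal_mult[symmetric] mult.commute ennreal_leI)
      then show "ennreal \<bar>D (?p t) \<bullet> (y - x)\<bar> * indicator {t. a < \<bar>f (?p t)\<bar> \<and> \<bar>f (?p t)\<bar> < b} t * indicator {0..1} t
        \<le> ennreal L * G (?p t) * indicator {0..1} t"
        using inS[of t] by (auto simp: G_def split: split_indicator)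
    qed
    finally show ?thesis .
  qed
  let ?I = "\<integral>\<^sup>+x. G x \<partial>lborel"
  \<comment> \<open>The Jacobian c^d is at least 2^(-d).\<close>
  have half: "(\<integral>\<^sup>+x. G (v + c *\<^sub>R x) \<partial>lborel) \<le> ennreal (2 ^ DIM('a)) * ?I" if "1/2 \<le> c" for v c
  proof -
    have "(1/2) ^ DIM('a) \<le> c ^ DIM('a)" using that by (intro power_mono) auto
    then have *: "1 \<le> 2 ^ DIM('a) * c ^ DIM('a)"
      by (simp add: power_one_over field_simps)
    have "(\<integral>\<^sup>+x. G (v + c *\<^sub>R x) \<partial>lborel) = 1 * (\<integral>\<^sup>+x. G (v + c *\<^sub>R x) \<partial>lborel)" by simp
    also have "\<dots> \<le> ennreal (2 ^ DIM('a) * c ^ DIM('a)) * (\<integral>\<^sup>+x. G (v + c *\<^sub>R x) \<partial>lborel)"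
      using ennreal_leI[OF *] by (intro mult_right_mono) auto
    also have "\<dots> = ennreal (2 ^ DIM('a)) * ?I"
      using nn_integral_lborel_affine[OF Gm, of c v] that by (simp add: ennreal_mult mult.assoc)
    finally show ?thesis .
  qed
  have inner: "(\<integral>\<^sup>+x. \<integral>\<^sup>+y. G (x + t *\<^sub>R (y - x)) * indicator S x * indicator S y \<partial>lborel \<partial>lborel)
       \<le> emeasure lborel S * (ennreal (2 ^ DIM('a)) * ?I)" for t :: real
  proof (cases "t \<ge> 1/2")
    case True
    have "(\<integral>\<^sup>+x. \<integral>\<^sup>+y. G (x + t *\<^sub>R (y - x)) * indicator S x * indicator S y \<partial>lborel \<partial>lborel)
      \<le> (\<integral>\<^sup>+x. \<integral>\<^sup>+y. G ((x - t *\<^sub>R x) + t *\<^sub>R y) * indicator S x \<partial>lborel \<partial>lborel)"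
      by (intro nn_integral_mono) (auto simp: algebra_simps split: split_indicator)
    also have "\<dots> = (\<integral>\<^sup>+x. (\<integral>\<^sup>+y. G ((x - t *\<^sub>R x) + t *\<^sub>R y) \<partial>lborel) * indicator S x \<partial>lborel)"
      by (intro nn_integral_cong nn_integral_multc) measurable
    also have "\<dots> \<le> (\<integral>\<^sup>+x. (ennreal (2 ^ DIM('a)) * ?I) * indicator S x \<partial>lborel)"
      by (intro nn_integral_mono mult_right_mono half True) auto
    also have "\<dots> = emeasure lborel S * (ennreal (2 ^ DIM('a)) * ?I)"
      by (subst nn_integral_cmult_indicator) (auto simp: mult.commute)
    finally show ?thesis .
  next
    \<comment> \<open>Now 1 - t is at least 1/2, so the roles are exchanged and the inner integral
      runs over x.\<close>
    case False
    have "(\<integral>\<^sup>+x. \<integral>\<^sup>+y. G (x + t *\<^sub>R (y - x)) * indicator S x * indicator S y \<partial>lborel \<partial>lborel)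
      = (\<integral>\<^sup>+y. \<integral>\<^sup>+x. G (x + t *\<^sub>R (y - x)) * indicator S x * indicator S y \<partial>lborel \<partial>lborel)"
      by (intro lborel_pair.Fubini') measurable
    also have "\<dots> \<le> (\<integral>\<^sup>+y. \<integral>\<^sup>+x. G (t *\<^sub>R y + (1 - t) *\<^sub>R x) * indicator S y \<partial>lborel \<partial>lborel)"
      by (intro nn_integral_mono) (auto simp: algebra_simps split: split_indicator)
    also have "\<dots> = (\<integral>\<^sup>+y. (\<integral>\<^sup>+x. G (t *\<^sub>R y + (1 - t) *\<^sub>R x) \<partial>lborel) * indicator S y \<partial>lborel)"
      by (intro nn_integral_cong nn_integral_multc) measurable
    also have "\<dots> \<le> (\<integral>\<^sup>+x. (ennreal (2 ^ DIM('a)) * ?I) * indicator S x \<partial>lborel)"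
      using False by (intro nn_integral_mono mult_right_mono half) auto
    also have "\<dots> = emeasure lborel S * (ennreal (2 ^ DIM('a)) * ?I)"
      by (subst nn_integral_cmult_indicator) (auto simp: mult.commute)
    finally show ?thesis .
  qed
  have "ennreal (b - a) * (emeasure lborel A * emeasure lborel B)
     = (\<integral>\<^sup>+x. \<integral>\<^sup>+y. ennreal (b - a) * indicator A x * indicator B y \<partial>lborel \<partial>lborel)"
    by (simp add: nn_integral_cmult nn_integral_multc mult_ac)
  also have "\<dots> \<le> (\<integral>\<^sup>+x. \<integral>\<^sup>+y. \<integral>\<^sup>+t. ennreal L * indicator {0..1::real} t *
       (G (x + t *\<^sub>R (y - x)) * indicator S x * indicator S y) \<partial>lborel \<partial>lborel \<partial>lborel)"
  proof (intro nn_integral_mono)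
    fix x y
    show "ennreal (b - a) * indicator A x * indicator B y \<le> (\<integral>\<^sup>+t. ennreal L * indicator {0..1::real} t *
       (G (x + t *\<^sub>R (y - x)) * indicator S x * indicator S y) \<partial>lborel)"
      using seg[of x y] A(1) B(1) by (auto split: split_indicator simp: mult_ac)
  qed
  also have "\<dots> = (\<integral>\<^sup>+x. \<integral>\<^sup>+t. \<integral>\<^sup>+y. ennreal L * indicator {0..1::real} t *
       (G (x + t *\<^sub>R (y - x)) * indicator S x * indicator S y) \<partial>lborel \<partial>lborel \<partial>lborel)"
    by (intro nn_integral_cong lborel_pair.Fubini') measurable
  also have "\<dots> = (\<integral>\<^sup>+t. \<integral>\<^sup>+x. \<integral>\<^sup>+y. ennreal L * indicator {0..1::real} t *
       (G (x + t *\<^sub>R (y - x)) * indicator S x * indicator S y) \<partial>lborel \<partial>lborel \<partial>lborel)"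
    by (intro lborel_pair.Fubini') measurable
  also have "\<dots> = (\<integral>\<^sup>+t. ennreal L * indicator {0..1::real} t * (\<integral>\<^sup>+x. \<integral>\<^sup>+y.
       G (x + t *\<^sub>R (y - x)) * indicator S x * indicator S y \<partial>lborel \<partial>lborel) \<partial>lborel)"
    by (simp add: nn_integral_cmult)
  also have "\<dots> \<le> (\<integral>\<^sup>+t. ennreal L * indicator {0..1::real} t * (emeasure lborel S * (ennreal (2 ^ DIM('a)) * ?I)) \<partial>lborel)"
    by (intro nn_integral_mono mult_left_mono inner) auto
  also have "\<dots> = ennreal L * (emeasure lborel S * (ennreal (2 ^ DIM('a)) * ?I))"
    by (simp add: nn_integral_multc nn_integral_cmult)
  also have "\<dots> = ennreal (L * 2 ^ DIM('a)) * emeasure lborel S * ?I"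
    using L0 by (simp add: ennreal_mult mult_ac)
  finally show ?thesis by (simp add: G_def)
qed (use A in simp)

text \<open>\<open>b\<close> is the supremum of the levels whose superlevel set fills at least the
  fraction \<delta> of S. Levels just below \<open>b\<close> still do so, levels above
  \<open>b\<close> do not, and continuity of measure along monotone sequences carries both facts to
  the limit. The closed condition keeps the lower bound and the open one the upper bound; they
  differ because u may equal b on a set of positive measure.\<close>

lemma ex_quantile:
  fixes u :: "'a::euclidean_space \<Rightarrow> real"
  assumes u: "u \<in> borel_measurable borel" "\<And>x. 0 \<le> u x" and S: "S \<in> sets borel" "emeasure lborel S < \<infinity>"
    and bdd: "\<And>x. x \<in> S \<Longrightarrow> u x \<le> M" and \<delta>: "0 < \<delta>" "\<delta> < 1" and pos: "0 < measure lborel S"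
  shows "\<exists>b\<ge>0. \<delta> * measure lborel S \<le> measure lborel {x\<in>S. b \<le> u x} \<and>
              measure lborel {x\<in>S. b < u x} \<le> \<delta> * measure lborel S"
proof -
  note [measurable] = u(1) S(1)
  have fin: "emeasure lborel {x\<in>S. P x} \<noteq> \<infinity>" if "{x\<in>S. P x} \<in> sets borel" for P
    using emeasure_mono[of "{x\<in>S. P x}" S lborel] S that by (auto simp: top_unique)
  define \<Lambda> where "\<Lambda> = {l. 0 \<le> l \<and> \<delta> * measure lborel S \<le> measure lborel {x\<in>S. l \<le> u x}}"
  have "{x\<in>S. 0 \<le> u x} = S" using u by auto
  then have 0: "0 \<in> \<Lambda>" using \<delta> pos by (auto simp: \<Lambda>_def)
  have up: "l \<le> max M 0" if "l \<in> \<Lambda>" for l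
  proof (rule ccontr)
    assume "\<not> l \<le> max M 0"
    then have "{x\<in>S. l \<le> u x} = {}" using bdd by force
    then have "measure lborel {x\<in>S. l \<le> u x} = 0" by (simp only: measure_empty)
    moreover have "0 < \<delta> * measure lborel S" using \<delta> pos by simp
    ultimately show False using that by (simp add: \<Lambda>_def)
  qed
  define b where "b = Sup \<Lambda>"
  have bdd\<Lambda>: "bdd_above \<Lambda>" using up by (auto simp: bdd_above_def)
  have b0: "0 \<le> b" unfolding b_def by (rule cSup_upper[OF 0 bdd\<Lambda>])
  have low: "\<delta> * measure lborel S \<le> measure lborel {x\<in>S. b - 1 / Suc n \<le> u x}" for n
  proof -
    have "b - 1 / Suc n < b" by simp
    then obtain l where l: "l \<in> \<Lambda>" "b - 1 / Suc n < l"
      unfolding b_def using less_cSup_iff[OF _ bdd\<Lambda>] 0 by (metis empty_iff)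
    have "measure lborel {x\<in>S. l \<le> u x} \<le> measure lborel {x\<in>S. b - 1 / Suc n \<le> u x}"
      using l fin by (intro measure_mono_fmeasurable) (auto simp: fmeasurable_def less_top)
    then show ?thesis using l by (auto simp: \<Lambda>_def)
  qed
  have "(\<lambda>n. measure lborel {x\<in>S. b - 1 / Suc n \<le> u x}) \<longlonglongrightarrow> measure lborel (\<Inter>n. {x\<in>S. b - 1 / Suc n \<le> u x})"
  proof (rule Lim_measure_decseq)
    show "decseq (\<lambda>n. {x\<in>S. b - 1 / Suc n \<le> u x})"
      by (intro decseq_SucI) (auto elim!: order_trans[rotated] intro!: divide_left_mono)
  qed (use fin in auto)
  also have "(\<Inter>n. {x\<in>S. b - 1 / Suc n \<le> u x}) = {x\<in>S. b \<le> u x}"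
  proof (safe, goal_cases)
    case (2 x)
    have "(\<lambda>n. b - 1 / Suc n) \<longlonglongrightarrow> b - 0"
      by (intro tendsto_intros LIMSEQ_Suc[OF lim_1_over_n])
    then show ?case using 2 by (intro LIMSEQ_le_const2[of "\<lambda>n. b - 1 / Suc n"]) auto
  next
    case (3 x)
    have "b - 1 / real (Suc xa) \<le> b" for xa by simp
    then show ?case using 3 by (meson order_trans)
  qed auto
  finally have 1: "\<delta> * measure lborel S \<le> measure lborel {x\<in>S. b \<le> u x}"
    using low by (intro LIMSEQ_le_const) auto
  have high: "measure lborel {x\<in>S. b + 1 / Suc n \<le> u x} \<le> \<delta> * measure lborel S" for n
  proof (rule ccontr)
    assume "\<not> ?thesis"
    then have "b + 1 / Suc n \<in> \<Lambda>" using b0 by (auto simp: \<Lambda>_def intro: add_nonneg_nonneg)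
    from cSup_upper[OF this bdd\<Lambda>] show False by (simp add: b_def[symmetric])
  qed
  have "(\<lambda>n. measure lborel {x\<in>S. b + 1 / Suc n \<le> u x}) \<longlonglongrightarrow> measure lborel (\<Union>n. {x\<in>S. b + 1 / Suc n \<le> u x})"
  proof (rule Lim_measure_incseq)
    show "incseq (\<lambda>n. {x\<in>S. b + 1 / Suc n \<le> u x})"
      by (intro incseq_SucI) (auto elim!: order_trans[rotated] intro!: divide_left_mono)
    have "(\<Union>n. {x\<in>S. b + 1 / real (Suc n) \<le> u x}) \<subseteq> S" by auto
    then have "emeasure lborel (\<Union>n. {x\<in>S. b + 1 / real (Suc n) \<le> u x}) \<le> emeasure lborel S"
      by (intro emeasure_mono) auto
    then show "emeasure lborel (\<Union>n. {x \<in> S. b + 1 / real (Suc n) \<le> u x}) \<noteq> \<infinity>"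
      using S by (auto simp: top_unique)
  qed auto
  also have "(\<Union>n. {x\<in>S. b + 1 / Suc n \<le> u x}) = {x\<in>S. b < u x}"
  proof safe
    fix x n assume "b + 1 / real (Suc n) \<le> u x"
    moreover have "0 < 1 / real (Suc n)" by simp
    ultimately show "b < u x" by linarith
  next
    fix x assume x: "x \<in> S" "b < u x"
    then obtain n where "inverse (of_nat (Suc n)) < u x - b"
      using reals_Archimedean[of "u x - b"] by auto
    then have "b + 1 / Suc n \<le> u x" by (simp add: inverse_eq_divide)
    then show "x \<in> (\<Union>n. {x\<in>S. b + 1 / Suc n \<le> u x})" using x by auto
  qed
  finally have 2: "measure lborel {x\<in>S. b < u x} \<le> \<delta> * measure lborel S"
    using high by (intro LIMSEQ_le_const2) auto
  show ?thesis using b0 1 2 by blast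
qed

section \<open>Dyadic cubes\<close>

text \<open>Membership in a cube becomes an equation for \<open>cidx\<close>, and the ancestor of a
  cube at level m is \<open>cidx m\<close> of any of its points, so nestedness turns into
  arithmetic.\<close>

definition cidx :: "int \<Rightarrow> real^'n \<Rightarrow> int^'n" where
  "cidx n x = (\<chi> i. \<lfloor>x$i / 2 powr n\<rfloor>)"

text \<open>A distinguished point of each cube, at which functions that are constant on the cube can
  be evaluated.\<close>

definition corner :: "int \<Rightarrow> int^'n \<Rightarrow> real^'n" where
  "corner n k = (\<chi> i. 2 powr n * of_int (k$i))"

lemma mem_dcube: "y \<in> dcube n k \<longleftrightarrow> cidx n y = k"
proof -
  have "2 powr n * of_int (k$i) \<le> y$i \<and> y$i < 2 powr n * (of_int (k$i) + 1) \<longleftrightarrow> \<lfloor>y$i / 2 powr n\<rfloor> = k$i" for i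
    by (simp add: floor_eq_iff field_simps)
  then show ?thesis by (simp add: dcube_def cidx_def vec_eq_iff)
qed

lemma cidx_corner [simp]: "cidx n (corner n k) = k"
  by (simp add: cidx_def corner_def vec_eq_iff)

text \<open>The nesting of the dyadic grids: rounding down at the coarse scale is rounding down at
  the fine scale followed by integer division.\<close>

lemma cidx_coarsen:
  assumes "n \<le> m"
  shows "cidx m x = (\<chi> i. cidx n x $ i div 2 ^ nat (m - n))"
proof -
  have "2 powr real_of_int m = 2 powr n * real_of_int (2 ^ nat (m - n))"
    using assms by (simp add: powr_realpow[symmetric] powr_add[symmetric])
  then have "\<lfloor>x$i / 2 powr m\<rfloor> = \<lfloor>x$i / 2 powr n\<rfloor> div 2 ^ nat (m - n)" for i
    using floor_divide_real_eq_div[of "2 ^ nat (m - n)" "x$i / 2 powr n"] by simp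
  then show ?thesis by (simp add: cidx_def vec_eq_iff)
qed

lemma cidx_eq_mono: "n \<le> m \<Longrightarrow> cidx n x = cidx n y \<Longrightarrow> cidx m x = cidx m y"
  by (simp add: cidx_coarsen)

lemma dcube_mono: "n \<le> m \<Longrightarrow> dcube n (cidx n x) \<subseteq> dcube m (cidx m x)"
  using cidx_eq_mono by (auto simp: mem_dcube)

lemma dcube_bounds:
  "box (corner n k) (corner n k + (\<chi> i. 2 powr n)) \<subseteq> dcube n k"
  "dcube n k \<subseteq> cbox (corner n k) (corner n k + (\<chi> i. 2 powr n))"
  by (auto simp: dcube_def mem_box_cart corner_def algebra_simps less_imp_le)

lemma borel_dcube [measurable]: "dcube n k \<in> sets borel"
proof -
  have "dcube n k = (\<Inter>i. {y. (2 powr n) * of_int (k$i) \<le> y$i} \<inter> {y. y$i < (2 powr n) * (of_int (k$i) + 1)})"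
    by (auto simp: dcube_def)
  also have "\<dots> \<in> sets borel"
    by (intro sets.countable_INT sets.Int borel_closed borel_open closed_Collect_le open_Collect_less
        continuous_intros) auto
  finally show ?thesis .
qed

lemma emeasure_dcube: "emeasure lborel (dcube n k :: (real^'n) set) = ennreal (2 powr (real_of_int n * CARD('n)))"
proof (rule antisym)
  have "(\<Prod>b\<in>(Basis :: (real^'n) set). (\<chi> i. 2 powr real_of_int n) \<bullet> b) = (\<Prod>b\<in>(Basis :: (real^'n) set). 2 powr real_of_int n)"
    by (intro prod.cong) (auto simp: Basis_vec_def inner_axis)
  then have e: "(\<Prod>b\<in>Basis. (corner n k + (\<chi> i. 2 powr n) - corner n k :: real^'n) \<bullet> b) = 2 powr (real_of_int n * CARD('n))"
    by (simp add: powr_powr[symmetric] powr_realpow)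
  have b: "corner n k \<bullet> b \<le> (corner n k + (\<chi> i. 2 powr n)) \<bullet> b" if "b \<in> (Basis :: (real^'n) set)" for b
    using that by (auto simp: Basis_vec_def inner_axis)
  show "emeasure lborel (dcube n k :: (real^'n) set) \<le> ennreal (2 powr (real_of_int n * CARD('n)))"
    using emeasure_mono[OF dcube_bounds(2)[of n k], of lborel] e b by (simp add: emeasure_lborel_cbox)
  show "ennreal (2 powr (real_of_int n * CARD('n))) \<le> emeasure lborel (dcube n k :: (real^'n) set)"
    using emeasure_mono[OF dcube_bounds(1)[of n k], of lborel] e b by (simp add: emeasure_lborel_box)
qed

lemma measure_dcube: "measure lborel (dcube n k :: (real^'n) set) = 2 powr (real_of_int n * CARD('n))"
  by (simp add: measure_def emeasure_dcube)

lemma bounded_dcube: "bounded (dcube n k)"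
  using bounded_cbox bounded_subset dcube_bounds(2) by blast

lemma convex_dcube: "convex (dcube n k)"
proof -
  have "dcube n k = (\<Inter>i. {y. (2 powr n) * of_int (k$i) \<le> y$i} \<inter> {y. y$i < (2 powr n) * (of_int (k$i) + 1)})"
    by (auto simp: dcube_def)
  also have "\<dots> = (\<Inter>i. {y. axis i 1 \<bullet> y \<ge> (2 powr n) * of_int (k$i)} \<inter> {y. axis i 1 \<bullet> y < (2 powr n) * (of_int (k$i) + 1)})"
    by (simp add: inner_axis')
  also have "convex \<dots>"
    by (intro convex_INT convex_Int convex_halfspace_ge convex_halfspace_lt)
  finally show ?thesis .
qed

text \<open>The l1 bound on the norm is crude but sufficient; its factor d reappears in
  \<open>poincare_const\<close>.\<close>

lemma norm_diff_dcube:
  assumes "x \<in> dcube n k" "y \<in> dcube n (k :: int^'n)"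
  shows "norm (y - x) \<le> CARD('n) * 2 powr n"
proof -
  have "\<bar>(y - x) $ i\<bar> \<le> 2 powr n" for i
    using assms by (auto simp: dcube_def abs_le_iff algebra_simps dest!: spec[of _ i])
  then have "norm (y - x) \<le> (\<Sum>i\<in>(UNIV::'n set). 2 powr n)"
    by (intro order_trans[OF norm_le_l1_cart] sum_mono) 
  then show ?thesis by simp
qed

lemma measurable_cidx [measurable]: "(cidx n :: real^'n \<Rightarrow> int^'n) \<in> borel \<rightarrow>\<^sub>M count_space UNIV"
proof -
  have "cidx n -` {k} = dcube n k" for k :: "int^'n" by (auto simp: mem_dcube)
  then show ?thesis
    by (subst measurable_count_space_eq2_countable) auto
qed

text \<open>Such a function factors through the countable set of cube indices.\<close>

lemma borel_measurable_cidx: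
  fixes h :: "real^'n \<Rightarrow> real"
  assumes "\<And>x y. cidx n x = cidx n y \<Longrightarrow> h x = h y"
  shows "h \<in> borel_measurable borel"
proof -
  have "h = (\<lambda>x. h (corner n (cidx n x)))"
    by (rule ext, rule assms) simp
  moreover have "(\<lambda>x. h (corner n (cidx n x))) \<in> borel_measurable borel"
    by measurable
  ultimately show ?thesis by simp
qed

lemma nn_integral_dcubes:
  fixes h :: "real^'n \<Rightarrow> ennreal"
  assumes [measurable]: "h \<in> borel_measurable borel"
  shows "(\<integral>\<^sup>+x. h x \<partial>lborel) = (\<integral>\<^sup>+k. \<integral>\<^sup>+x. h x * indicator (dcube n k) x \<partial>lborel \<partial>count_space UNIV)"
proof -
  have "h x = (\<integral>\<^sup>+k. h x * indicator (dcube n k) x \<partial>count_space UNIV)" for x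
  proof -
    have "h x * indicator (dcube n k) x = h x * indicator {cidx n x} k" for k
      by (auto simp: mem_dcube split: split_indicator)
    then show ?thesis by (simp add: nn_integral_cmult)
  qed
  then have "(\<integral>\<^sup>+x. h x \<partial>lborel) = (\<integral>\<^sup>+x. \<integral>\<^sup>+k. h x * indicator (dcube n k) x \<partial>count_space UNIV \<partial>lborel)"
    by (intro nn_integral_cong)
  also have "\<dots> = (\<integral>\<^sup>+k. \<integral>\<^sup>+x. h x * indicator (dcube n k) x \<partial>lborel \<partial>count_space UNIV)"
    by (rule nn_integral_count_space_nn_integral) auto
  finally show ?thesis .
qed

lemma avg_nonneg: "0 \<le> avg f Q"
  unfolding avg_def set_lebesgue_integral_def
  by (intro divide_nonneg_nonneg integral_nonneg_AE AE_I2) auto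

lemma avg_lborel:
  assumes [measurable]: "f \<in> borel_measurable borel"
  shows "avg f (dcube n (k :: int^'n)) = (LINT x:dcube n k|lborel. \<bar>f x\<bar>) / 2 powr (real_of_int n * CARD('n))"
proof -
  have "(LINT x:dcube n k|lebesgue. \<bar>f x\<bar>) = (LINT x:dcube n k|lborel. \<bar>f x\<bar>)"
    unfolding set_lebesgue_integral_def by (rule integral_completion) measurable
  moreover have "measure lebesgue (dcube n k) = 2 powr (real_of_int n * CARD('n))"
    using measure_dcube[of n k] measure_completion[of "dcube n k" lborel] by simp
  ultimately show ?thesis by (simp add: avg_def)
qed

lemma borel_cball [measurable]: "cball (a::'a::euclidean_space) r \<in> sets borel"
  by (rule borel_closed) simp

section \<open>Estimates for continuously differentiable functions\<close>

text \<open>The gradient is given through the inner product and is continuous; this is all that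
  mollifications have to supply. \<open>N\<close> caps the levels of the ancestors under
  consideration, which keeps the maxima over ancestors finite.\<close>

locale smooth_dyadic =
  fixes f :: "real^'n \<Rightarrow> real" and D :: "real^'n \<Rightarrow> real^'n" and N :: int
  assumes der: "\<And>x. (f has_derivative (\<lambda>h. D x \<bullet> h)) (at x)" and cont_D: "continuous_on UNIV D"
begin

lemma cont_f: "continuous_on UNIV f"
  using der by (auto intro!: continuous_at_imp_continuous_on has_derivative_continuous)

lemma borel_f [measurable]: "f \<in> borel_measurable borel"
  and borel_D [measurable]: "D \<in> borel_measurable borel"
  using cont_f cont_D by (auto intro: borel_measurable_continuous_onI)

definition \<delta> :: real where "\<delta> = 1 / 2 ^ (CARD('n) + 1)"

text \<open>In the Poincare argument the two inequalities are used on different cubes: the first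
  makes |f| large on a portion of the cube itself, the second, taken on the parent, makes |f| small
  on at least half of the child.\<close>

definition is_quantile :: "int \<Rightarrow> int^'n \<Rightarrow> real \<Rightarrow> bool" where
  "is_quantile n k b \<longleftrightarrow> b \<ge> 0 \<and>
     \<delta> * measure lborel (dcube n k) \<le> measure lborel {x\<in>dcube n k. b \<le> \<bar>f x\<bar>} \<and>
     measure lborel {x\<in>dcube n k. b < \<bar>f x\<bar>} \<le> \<delta> * measure lborel (dcube n k)"

definition quant :: "int \<Rightarrow> int^'n \<Rightarrow> real" where
  "quant n k = (SOME b. is_quantile n k b)"

text \<open>Maximising over the ancestors makes the differences of consecutive levels telescope, and
  makes the value intervals between consecutive levels disjoint. Hence
  the gradient at a point is charged to at most one scale.\<close>

definition max_quant :: "int \<Rightarrow> real^'n \<Rightarrow> real" where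
  "max_quant n x = Max ((\<lambda>j. quant j (cidx j x)) ` {n..N})"

definition charge :: "int \<Rightarrow> real^'n \<Rightarrow> real" where
  "charge j x = indicator {x. max_quant (j + 1) x < \<bar>f x\<bar> \<and> \<bar>f x\<bar> < max_quant j x} x"

text \<open>The product of the diameter bound d, the factor 2^d of the Poincare inequality, and the
  factors 2 and 2^(d+1) for the portions 1/2 and \<delta> of the cube that carry the small and the
  large values.\<close>

definition poincare_const :: real where "poincare_const = real CARD('n) * 2 ^ (2 * CARD('n) + 2)"

lemma delta: "0 < \<delta>" "\<delta> < 1" "\<delta> * 2 ^ CARD('n) = 1/2"
proof -
  have "1 < (2::real) * 2 ^ CARD('n)"
    using one_less_power[of "2::real" "Suc (CARD('n))"] by simp
  then show "0 < \<delta>" "\<delta> < 1" "\<delta> * 2 ^ CARD('n) = 1/2"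
    by (auto simp: \<delta>_def field_simps)
qed

lemma poincare_const_pos: "0 < poincare_const"
  by (simp add: poincare_const_def)

lemma f_bounded: obtains M where "\<And>x. x \<in> dcube n k \<Longrightarrow> \<bar>f x\<bar> \<le> M"
proof -
  have "compact (closure (dcube n k))" using bounded_dcube by (simp add: compact_closure)
  then have "compact (f ` closure (dcube n k))"
    by (intro compact_continuous_image continuous_on_subset[OF cont_f]) auto
  then obtain M where "\<forall>y\<in>f ` closure (dcube n k). norm y \<le> M"
    using compact_imp_bounded bounded_iff by metis
  then show ?thesis using that[of M] closure_subset by (auto simp: subset_iff)
qed

lemma quant: "is_quantile n k (quant n k)"
proof -
  obtain M where "\<And>x. x \<in> dcube n k \<Longrightarrow> \<bar>f x\<bar> \<le> M" using f_bounded by metis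
  then have "\<exists>b\<ge>0. \<delta> * measure lborel (dcube n k) \<le> measure lborel {x\<in>dcube n k. b \<le> \<bar>f x\<bar>} \<and>
     measure lborel {x\<in>dcube n k. b < \<bar>f x\<bar>} \<le> \<delta> * measure lborel (dcube n k)"
    by (intro ex_quantile[where M = M]) (auto simp: emeasure_dcube measure_dcube delta)
  then have "\<exists>b. is_quantile n k b" by (auto simp: is_quantile_def)
  then show ?thesis unfolding quant_def by (rule someI_ex)
qed

lemma fin_sub: "{x\<in>dcube n k. P x} \<in> sets borel \<Longrightarrow> emeasure lborel {x\<in>dcube n k. P x} < \<infinity>"
  using emeasure_mono[of "{x\<in>dcube n k. P x}" "dcube n k" lborel]
  by (auto simp: emeasure_dcube intro: le_less_trans)

text \<open>If the quantile were below \<open>c\<close>, its strict superlevel set would be the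
  entire cube, against \<delta> < 1.\<close>

lemma quant_ge:
  assumes "\<And>x. x \<in> dcube n k \<Longrightarrow> c \<le> \<bar>f x\<bar>"
  shows "c \<le> quant n k"
proof (rule ccontr)
  assume "\<not> ?thesis"
  then have "{x\<in>dcube n k. quant n k < \<bar>f x\<bar>} = dcube n k" using assms by force
  then have "measure lborel (dcube n k) \<le> \<delta> * measure lborel (dcube n k)"
    using quant[of n k] by (simp add: is_quantile_def)
  then show False using delta by (simp add: measure_dcube)
qed

lemma set_integrable_dcube: "set_integrable lborel (dcube n k) (\<lambda>x. \<bar>f x\<bar>)"
proof -
  obtain M where M: "\<And>x. x \<in> dcube n k \<Longrightarrow> \<bar>f x\<bar> \<le> M" using f_bounded by metis
  have "integrable lborel (\<lambda>x. indicator (dcube n k) x *\<^sub>R \<bar>f x\<bar>)"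
  proof (rule Bochner_Integration.integrable_bound)
    show "integrable lborel (\<lambda>x. indicator (dcube n k) x *\<^sub>R M)"
      by (intro integrable_scaleR_left integrable_real_indicator) (auto simp: emeasure_dcube)
    show "AE x in lborel. norm (indicator (dcube n k) x *\<^sub>R \<bar>f x\<bar>) \<le> norm (indicator (dcube n k) x *\<^sub>R M)"
      using M by (intro AE_I2) (fastforce split: split_indicator)
  qed measurable
  then show ?thesis by (simp add: set_integrable_def)
qed

text \<open>Chebyshev's inequality on the set where |f| reaches the quantile; the loss 1/\<delta> is
  what the choice of \<kappa> has to beat.\<close>

lemma quant_le_avg: "quant n k * \<delta> \<le> avg f (dcube n k)"
proof -
  let ?S = "{x\<in>dcube n k. quant n k \<le> \<bar>f x\<bar>}"
  have q0: "quant n k \<ge> 0" using quant by (auto simp: is_quantile_def)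
  have [measurable]: "?S \<in> sets borel" by measurable
  have fin: "emeasure lborel ?S < \<infinity>" by (rule fin_sub) measurable
  have "quant n k * (\<delta> * measure lborel (dcube n k)) \<le> quant n k * measure lborel ?S"
    using quant q0 by (intro mult_left_mono) (auto simp: is_quantile_def)
  also have "\<dots> = (LINT x:?S|lborel. quant n k)"
    using fin by (simp add: set_lebesgue_integral_def)
  also have "\<dots> \<le> (LINT x:dcube n k|lborel. \<bar>f x\<bar>)"
    unfolding set_lebesgue_integral_def
    using set_integrable_dcube[of n k, unfolded set_integrable_def] fin
    by (intro integral_mono) (auto split: split_indicator)
  finally show ?thesis
    by (simp add: avg_lborel[OF borel_f] measure_dcube field_simps)
qed

lemma max_quant_rec: "n < N \<Longrightarrow> max_quant n x = max (quant n (cidx n x)) (max_quant (n + 1) x)"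
proof -
  assume "n < N"
  then have "{n..N} = insert n {n+1..N}" "{n+1..N} \<noteq> {}" by auto
  then show ?thesis by (simp add: max_quant_def)
qed

lemma max_quant_ge: "n \<le> j \<Longrightarrow> j \<le> N \<Longrightarrow> quant j (cidx j x) \<le> max_quant n x"
  unfolding max_quant_def by (rule Max_ge) auto

lemma max_quant_le: "n \<le> N \<Longrightarrow> (\<And>j. n \<le> j \<Longrightarrow> j \<le> N \<Longrightarrow> quant j (cidx j x) \<le> c) \<Longrightarrow> max_quant n x \<le> c"
  unfolding max_quant_def by (subst Max_le_iff) auto

lemma max_quant_cong: "cidx n x = cidx n y \<Longrightarrow> max_quant n x = max_quant n y"
  unfolding max_quant_def by (rule arg_cong[where f = Max], rule image_cong) (auto dest: cidx_eq_mono)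

lemma borel_max_quant [measurable]: "max_quant n \<in> borel_measurable borel"
  by (rule borel_measurable_cidx[of n]) (rule max_quant_cong)

lemma borel_charge [measurable]: "charge n \<in> borel_measurable borel"
  unfolding charge_def[abs_def] by measurable

lemma max_quant_antimono: "n \<le> m \<Longrightarrow> m \<le> N \<Longrightarrow> max_quant m x \<le> max_quant n x"
  by (rule max_quant_le) (auto intro: max_quant_ge)

text \<open>A strict increase of the maximum means that it is attained by the quantile of the cube
  itself, which supplies the large values. The previous maximum dominates the quantile of the
  parent, which supplies the small values. Without an increase the left side vanishes. Both maxima
  are constant on the cube, hence the evaluation at the corner.\<close>

lemma level_estimate:
  assumes j: "j < N"
  shows "ennreal (max_quant j (corner j k) - max_quant (j + 1) (corner j k)) * emeasure lborel (dcube j k)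
    \<le> ennreal (poincare_const * 2 powr j) * (\<integral>\<^sup>+x. ennreal (norm (D x) * charge j x) * indicator (dcube j k) x \<partial>lborel)"
proof (cases "max_quant (j + 1) (corner j k) < max_quant j (corner j k)")
  case True
  define a where "a = max_quant (j + 1) (corner j k)"
  define b where "b = max_quant j (corner j k)"
  let ?S = "dcube j k" 
  define p where "p = 2 powr (real_of_int j * CARD('n))"
  have p: "p > 0" "measure lborel ?S = p" "emeasure lborel ?S = ennreal p"
    by (auto simp: p_def measure_dcube emeasure_dcube)
  have b: "b = quant j k" using True max_quant_rec[OF j, of "corner j k"] by (auto simp: b_def)
  have ab: "a < b" using True by (simp add: a_def b_def)
  let ?k' = "cidx (j + 1) (corner j k)"
  have a_ge: "quant (j + 1) ?k' \<le> a" unfolding a_def using j by (intro max_quant_ge) auto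
  have sub: "?S \<subseteq> dcube (j + 1) ?k'" using dcube_mono[of j "j + 1" "corner j k"] by simp
  let ?A = "{x\<in>?S. \<bar>f x\<bar> \<le> a}" and ?B = "{x\<in>?S. b \<le> \<bar>f x\<bar>}"
  have mB: "\<delta> * p \<le> measure lborel ?B"
    using quant[of j k] by (simp add: is_quantile_def b p)
  \<comment> \<open>The part of S above \<open>a\<close> lies in the strict superlevel set of the
    parent, of measure at most \<delta> 2^d |S| = |S|/2.\<close>
  have "measure lborel {x\<in>?S. a < \<bar>f x\<bar>} \<le> measure lborel {x\<in>dcube (j + 1) ?k'. quant (j + 1) ?k' < \<bar>f x\<bar>}"
    using sub a_ge by (intro measure_mono_fmeasurable fmeasurableI fin_sub) auto
  also have "\<dots> \<le> \<delta> * measure lborel (dcube (j + 1) ?k')"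
    using quant[of "j + 1" ?k'] by (simp add: is_quantile_def)
  also have "\<dots> = \<delta> * 2 ^ CARD('n) * p"
    by (simp add: measure_dcube p_def distrib_right powr_add powr_realpow)
  also have "\<dots> = p / 2" using delta by simp
  finally have "measure lborel {x\<in>?S. a < \<bar>f x\<bar>} \<le> p / 2" .
  moreover have "measure lborel ?S = measure lborel {x\<in>?S. a < \<bar>f x\<bar>} + measure lborel ?A"
    using fin_sub[of j k "\<lambda>x. a < \<bar>f x\<bar>"] fin_sub[of j k "\<lambda>x. \<bar>f x\<bar> \<le> a"]
    by (subst measure_Union[symmetric]) (auto intro!: arg_cong[where f = "measure lborel"])
  ultimately have mA: "p / 2 \<le> measure lborel ?A" using p by simp
  let ?I = "\<integral>\<^sup>+x. ennreal (norm (D x) * charge j x) * indicator (dcube j k) x \<partial>lborel"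
  have I_eq: "?I = (\<integral>\<^sup>+x. ennreal (norm (D x)) * indicator {x\<in>?S. a < \<bar>f x\<bar> \<and> \<bar>f x\<bar> < b} x \<partial>lborel)"
  proof (rule nn_integral_cong)
    fix x
    have "x \<in> ?S \<Longrightarrow> max_quant j x = b \<and> max_quant (j + 1) x = a"
      unfolding a_def b_def by (auto simp: mem_dcube intro!: max_quant_cong cidx_eq_mono[of j "j + 1"])
    then show "ennreal (norm (D x) * charge j x) * indicator ?S x = 
      ennreal (norm (D x)) * indicator {x\<in>?S. a < \<bar>f x\<bar> \<and> \<bar>f x\<bar> < b} x"
      by (auto simp: charge_def split: split_indicator)
  qed
  have "ennreal (b - a) * (ennreal (p / 2) * ennreal (\<delta> * p)) \<le> ennreal (b - a) * (emeasure lborel ?A * emeasure lborel ?B)"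
  proof (intro mult_mono)
    have "emeasure lborel ?A < \<infinity>" by (intro fin_sub) measurable
    then show "ennreal (p / 2) \<le> emeasure lborel ?A"
      using mA by (simp add: emeasure_eq_ennreal_measure ennreal_leI)
    have "emeasure lborel ?B < \<infinity>" by (intro fin_sub) measurable
    then show "ennreal (\<delta> * p) \<le> emeasure lborel ?B"
      using mB by (simp add: emeasure_eq_ennreal_measure ennreal_leI)
  qed auto
  also have "\<dots> \<le> ennreal ((CARD('n) * 2 powr j) * 2 ^ CARD('n)) * emeasure lborel ?S * ?I"
  proof -
    have m: "?A \<in> sets borel" "?B \<in> sets borel" by measurable
    have "ennreal (b - a) * (emeasure lborel ?A * emeasure lborel ?B) \<le>
        ennreal ((CARD('n) * 2 powr j) * 2 ^ DIM(real^'n)) * emeasure lborel ?S * ?I"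
      unfolding I_eq
    proof (rule poincare_truncated[OF der cont_D convex_dcube borel_dcube])
      show "norm (y - x) \<le> CARD('n) * 2 powr j" if "x \<in> ?S" "y \<in> ?S" for x y
        using norm_diff_dcube[OF that] .
    qed (use m in auto)
    then show ?thesis by simp
  qed
  finally have main: "ennreal (b - a) * (ennreal (p / 2) * ennreal (\<delta> * p)) \<le>
     ennreal ((CARD('n) * 2 powr j) * 2 ^ CARD('n)) * ennreal p * ?I" by (simp add: p)
  show ?thesis
  proof (cases ?I)
    case (real r)
    have pow: "(2::real) ^ (2 * d + 2) = 2 * 2 ^ d * 2 ^ (d + 1)" for d
      by (induct d) auto
    have "(b - a) * (p / 2 * (\<delta> * p)) \<le> (CARD('n) * 2 powr j) * 2 ^ CARD('n) * p * r"
      using main real p ab delta by (simp add: ennreal_mult[symmetric])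
    then have "p * ((b - a) * p * \<delta>) \<le> p * (2 * (CARD('n) * 2 powr j) * 2 ^ CARD('n) * r)"
      by (simp add: mult_ac)
    then have "(b - a) * p * \<delta> \<le> 2 * (CARD('n) * 2 powr j) * 2 ^ CARD('n) * r"
      using p by (simp only: mult_le_cancel_left_pos)
    then have "(b - a) * p * \<delta> * 2 ^ (CARD('n) + 1) \<le> 2 * (CARD('n) * 2 powr j) * 2 ^ CARD('n) * r * 2 ^ (CARD('n) + 1)"
      by (rule mult_right_mono) simp
    moreover have "(b - a) * p * \<delta> * 2 ^ (CARD('n) + 1) = (b - a) * p" by (simp add: \<delta>_def)
    moreover have "2 * (CARD('n) * 2 powr j) * 2 ^ CARD('n) * r * 2 ^ (CARD('n) + 1) = poincare_const * 2 powr j * r"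
      unfolding poincare_const_def pow by (simp only: mult_ac)
    ultimately have "(b - a) * p \<le> (poincare_const * 2 powr j) * r"
      by (simp only:)
    then show ?thesis
      using real p ab poincare_const_pos by (simp add: ennreal_mult[symmetric] a_def[symmetric] b_def[symmetric] ennreal_leI)
  next
    case top
    then show ?thesis using poincare_const_pos by (simp add: ennreal_mult_top)
  qed
qed (simp add: ennreal_neg)

end

section \<open>Telescoping over the scales below an ancestor\<close>

context smooth_dyadic
begin

lemma charge_nonneg: "0 \<le> charge j x"
  by (simp add: charge_def)

text \<open>Obtained by summing over the cubes of level j inside the ancestor. With both sides
  written as integrals over the ancestor, the differences of consecutive levels can be added
  pointwise before integrating.\<close>

lemma level_estimate_ancestor:
  assumes j: "j < N" "j \<le> m"
  shows "(\<integral>\<^sup>+x. ennreal (max_quant j x - max_quant (j + 1) x) * indicator (dcube m l) x \<partial>lborel)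
    \<le> ennreal (poincare_const * 2 powr j) * (\<integral>\<^sup>+x. ennreal (norm (D x) * charge j x) * indicator (dcube m l) x \<partial>lborel)"
proof -
  have step: "(\<integral>\<^sup>+x. ennreal (max_quant j x - max_quant (j + 1) x) * indicator (dcube m l) x * indicator (dcube j k) x \<partial>lborel)
    \<le> ennreal (poincare_const * 2 powr j) * (\<integral>\<^sup>+x. ennreal (norm (D x) * charge j x) * indicator (dcube m l) x * indicator (dcube j k) x \<partial>lborel)"
    for k
  proof (cases "cidx m (corner j k) = l")
    case True
    then have sub: "x \<in> dcube j k \<Longrightarrow> x \<in> dcube m l" for x
      using dcube_mono[OF j(2), of "corner j k"] by auto
    have eq: "x \<in> dcube j k \<Longrightarrow> max_quant j x = max_quant j (corner j k) \<and> max_quant (j + 1) x = max_quant (j + 1) (corner j k)" for x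
      by (auto simp: mem_dcube intro!: max_quant_cong cidx_eq_mono[of j "j + 1"])
    have "(\<integral>\<^sup>+x. ennreal (max_quant j x - max_quant (j + 1) x) * indicator (dcube m l) x * indicator (dcube j k) x \<partial>lborel)
      = (\<integral>\<^sup>+x. ennreal (max_quant j (corner j k) - max_quant (j + 1) (corner j k)) * indicator (dcube j k) x \<partial>lborel)"
      using sub eq by (intro nn_integral_cong) (auto split: split_indicator)
    also have "\<dots> = ennreal (max_quant j (corner j k) - max_quant (j + 1) (corner j k)) * emeasure lborel (dcube j k)"
      by (subst nn_integral_cmult_indicator) auto
    also have "\<dots> \<le> ennreal (poincare_const * 2 powr j) * (\<integral>\<^sup>+x. ennreal (norm (D x) * charge j x) * indicator (dcube j k) x \<partial>lborel)"
      by (rule level_estimate[OF j(1)])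
    also have "(\<integral>\<^sup>+x. ennreal (norm (D x) * charge j x) * indicator (dcube j k) x \<partial>lborel) =
      (\<integral>\<^sup>+x. ennreal (norm (D x) * charge j x) * indicator (dcube m l) x * indicator (dcube j k) x \<partial>lborel)"
      using sub by (intro nn_integral_cong) (auto split: split_indicator)
    finally show ?thesis .
  next
    case False
    then have "x \<in> dcube j k \<Longrightarrow> x \<notin> dcube m l" for x
      using cidx_eq_mono[OF j(2), of x "corner j k"] by (auto simp: mem_dcube)
    then have "(\<integral>\<^sup>+x. ennreal (max_quant j x - max_quant (j + 1) x) * indicator (dcube m l) x * indicator (dcube j k) x \<partial>lborel)
      = (\<integral>\<^sup>+x. 0 \<partial>(lborel :: (real^'n) measure))"
      by (intro nn_integral_cong) (auto split: split_indicator)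
    then show ?thesis by simp
  qed
  have "(\<integral>\<^sup>+x. ennreal (max_quant j x - max_quant (j + 1) x) * indicator (dcube m l) x \<partial>lborel)
    = (\<integral>\<^sup>+k. \<integral>\<^sup>+x. ennreal (max_quant j x - max_quant (j + 1) x) * indicator (dcube m l) x * indicator (dcube j k) x \<partial>lborel \<partial>count_space UNIV)"
    by (rule nn_integral_dcubes) measurable
  also have "\<dots> \<le> (\<integral>\<^sup>+k. ennreal (poincare_const * 2 powr j) * (\<integral>\<^sup>+x. ennreal (norm (D x) * charge j x) * indicator (dcube m l) x * indicator (dcube j k) x \<partial>lborel) \<partial>count_space UNIV)"
    by (intro nn_integral_mono step)
  also have "\<dots> = ennreal (poincare_const * 2 powr j) * (\<integral>\<^sup>+k. \<integral>\<^sup>+x. ennreal (norm (D x) * charge j x) * indicator (dcube m l) x * indicator (dcube j k) x \<partial>lborel \<partial>count_space UNIV)"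
    by (rule nn_integral_cmult) simp
  also have "(\<integral>\<^sup>+k. \<integral>\<^sup>+x. ennreal (norm (D x) * charge j x) * indicator (dcube m l) x * indicator (dcube j k) x \<partial>lborel \<partial>count_space UNIV)
    = (\<integral>\<^sup>+x. ennreal (norm (D x) * charge j x) * indicator (dcube m l) x \<partial>lborel)"
    by (rule nn_integral_dcubes[symmetric]) measurable
  finally show ?thesis .
qed

text \<open>At most one level below \<open>N\<close> is charged at a point, so for
  \<open>m \<le> N\<close> the sum has at most one nonzero term: it is the scale \<ell>(x), or 0 if
  no level in the range is charged.\<close>

definition weight :: "int \<Rightarrow> int \<Rightarrow> real^'n \<Rightarrow> real" where
  "weight M m x = (\<Sum>j\<in>{M..<m}. 2 powr j * charge j x)"

lemma borel_weight [measurable]: "weight M m \<in> borel_measurable borel"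
  unfolding weight_def[abs_def] by measurable

lemma weight_nonneg: "0 \<le> weight M m x"
  unfolding weight_def by (intro sum_nonneg mult_nonneg_nonneg charge_nonneg) auto

lemma max_quant_telescope:
  assumes "M \<le> m"
  shows "max_quant M x = max_quant m x + (\<Sum>j\<in>{M..<m}. max_quant j x - max_quant (j + 1) x)"
  using assms
proof (induction m rule: int_ge_induct)
  case (step i)
  then have "{M..<i + 1} = insert i {M..<i}" by auto
  then show ?case using step by simp
qed simp

text \<open>For i < j the point would satisfy \<open>\<bar>f x\<bar> > max_quant (i + 1) x \<ge>
  max_quant j x > \<bar>f x\<bar>\<close>.\<close>

lemma charge_unique:
  assumes "charge i x \<noteq> 0" "charge j x \<noteq> 0" "i < N" "j < N"
  shows "i = j"
proof (rule ccontr)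
  have *: False if "i < j" "charge i x \<noteq> 0" "charge j x \<noteq> 0" "j < N" for i j
    using that max_quant_antimono[of "i + 1" j x] by (auto simp: charge_def indicator_def split: if_splits)
  assume "i \<noteq> j"
  then show False using *[of i j] *[of j i] assms by linarith
qed

text \<open>Only the ancestors up to level \<open>N\<close> are compared: these are finitely many strict
  inequalities, which therefore persist under mollification.\<close>

definition good_cube :: "real \<Rightarrow> int \<Rightarrow> int^'n \<Rightarrow> bool" where
  "good_cube \<alpha> n k \<longleftrightarrow> (\<forall>j x. n < j \<longrightarrow> j \<le> N \<longrightarrow> x \<in> dcube n k \<longrightarrow>
     side j powr \<alpha> * avg f (dcube j (cidx j x)) < side n powr \<alpha> * avg f (dcube n k))"

text \<open>At a level j \<ge> n + \<kappa> the comparison of averages gains 2^(-\<alpha>(j - n))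
  \<le> 2^(-(d + 3)), while Chebyshev's inequality loses 2^(d + 1); the net factor is 1/4. The gain
  improves with j, so the bound survives the maximum over all ancestors up to
  \<open>N\<close>.\<close>

lemma good_cube_max_quant:
  assumes good: "good_cube \<alpha> n k" and \<alpha>: "\<alpha> > 0" and \<kappa>: "real CARD('n) + 3 \<le> \<alpha> * \<kappa>" "0 < \<kappa>"
    and m: "n + \<kappa> \<le> N" and x: "x \<in> dcube n k"
  shows "max_quant (n + \<kappa>) x \<le> avg f (dcube n k) / 4"
proof (rule max_quant_le[OF m])
  fix j assume j: "n + \<kappa> \<le> j" "j \<le> N"
  have *: "2 powr (\<alpha> * j) * avg f (dcube j (cidx j x)) < 2 powr (\<alpha> * n) * avg f (dcube n k)"
    using good j \<kappa> x unfolding good_cube_def side_def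
    by (auto simp: powr_powr mult.commute dest!: spec[of _ j] spec[of _ x])
  have "2 powr (\<alpha> * (j - n)) * avg f (dcube j (cidx j x)) = 2 powr (\<alpha> * j) * avg f (dcube j (cidx j x)) / 2 powr (\<alpha> * n)"
    by (simp add: right_diff_distrib powr_diff)
  also have "\<dots> \<le> avg f (dcube n k)"
    using * by (simp add: field_simps)
  finally have 1: "2 powr (\<alpha> * (j - n)) * avg f (dcube j (cidx j x)) \<le> avg f (dcube n k)" .
  have "\<alpha> * \<kappa> \<le> \<alpha> * (j - n)" using j \<alpha> by (intro mult_left_mono) auto
  then have "real (CARD('n) + 3) \<le> \<alpha> * (j - n)" using \<kappa> by simp
  then have "2 ^ (CARD('n) + 3) \<le> 2 powr (\<alpha> * (j - n))"
    by (subst powr_realpow[symmetric]) (auto intro!: powr_mono simp del: of_nat_add)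
  then have "2 ^ (CARD('n) + 3) * avg f (dcube j (cidx j x)) \<le> 2 powr (\<alpha> * (j - n)) * avg f (dcube j (cidx j x))"
    by (rule mult_right_mono[OF _ avg_nonneg])
  also note 1
  finally have 2: "2 ^ (CARD('n) + 3) * avg f (dcube j (cidx j x)) \<le> avg f (dcube n k)" .
  have "quant j (cidx j x) \<le> avg f (dcube j (cidx j x)) / \<delta>"
    using quant_le_avg[of j "cidx j x"] delta by (simp add: field_simps)
  also have "\<dots> = 2 ^ (CARD('n) + 3) * avg f (dcube j (cidx j x)) / 4"
    by (simp add: \<delta>_def power_add)
  also have "\<dots> \<le> avg f (dcube n k) / 4" using 2 by simp
  finally show "quant j (cidx j x) \<le> avg f (dcube n k) / 4" .
qed

text \<open>On Q the function |f| exceeds the telescoping sum by at most half of its average: a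
  quarter comes from the top level n + \<kappa>, a quarter from stopping at level M. Absorbing this
  half gives the factor 2. The right side integrates over the ancestor because the levels from n + 1
  to n + \<kappa> - 1 have cubes larger than Q.\<close>

lemma cube_estimate:
  assumes good: "good_cube \<alpha> n k" and \<alpha>: "\<alpha> > 0" and \<kappa>: "real CARD('n) + 3 \<le> \<alpha> * \<kappa>" "0 < \<kappa>"
    and m: "n + \<kappa> \<le> N" and M: "M \<le> n"
    and approx: "\<And>x. x \<in> dcube n k \<Longrightarrow> \<bar>f x\<bar> \<le> max_quant M x + avg f (dcube n k) / 4"
    and l: "l = cidx (n + \<kappa>) (corner n k)"
  shows "ennreal (avg f (dcube n k)) * ennreal (2 powr (real_of_int n * CARD('n)))
    \<le> ennreal (2 * poincare_const) * (\<integral>\<^sup>+x. ennreal (norm (D x) * weight M (n + \<kappa>) x) * indicator (dcube (n + \<kappa>) l) x \<partial>lborel)"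
proof -
  let ?Q = "dcube n k" and ?P = "dcube (n + \<kappa>) l" and ?m = "n + \<kappa>"
  define F where "F = avg f ?Q"
  define p where "p = 2 powr (real_of_int n * CARD('n))"
  have F0: "0 \<le> F" by (simp add: F_def avg_nonneg)
  have p: "p > 0" "emeasure lborel ?Q = ennreal p" by (auto simp: p_def emeasure_dcube)
  have sub: "x \<in> ?Q \<Longrightarrow> x \<in> ?P" for x
    using dcube_mono[of n ?m "corner n k"] \<kappa> by (auto simp: l)
  have pw: "\<bar>f x\<bar> \<le> F / 2 + (\<Sum>j\<in>{M..<?m}. max_quant j x - max_quant (j + 1) x)" if "x \<in> ?Q" for x
    using approx[OF that] good_cube_max_quant[OF good \<alpha> \<kappa> m that] max_quant_telescope[of M ?m x] M \<kappa> by (simp add: F_def)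
  have Bnn: "0 \<le> max_quant j x - max_quant (j + 1) x" if "j \<in> {M..<?m}" for j x
    using max_quant_antimono[of j "j + 1" x] that m by auto
  have LINT: "(LINT x:?Q|lborel. \<bar>f x\<bar>) = F * p"
    by (simp add: F_def avg_lborel[OF borel_f] p_def)
  have "ennreal (F * p) = (\<integral>\<^sup>+x. ennreal (indicator ?Q x *\<^sub>R \<bar>f x\<bar>) \<partial>lborel)"
    using LINT[symmetric] set_integrable_dcube[of n k]
    by (simp add: set_lebesgue_integral_def set_integrable_def nn_integral_eq_integral)
  also have "\<dots> \<le> (\<integral>\<^sup>+x. ennreal (F / 2) * indicator ?Q x
      + (\<Sum>j\<in>{M..<?m}. ennreal (max_quant j x - max_quant (j + 1) x) * indicator ?P x) \<partial>lborel)"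
  proof (rule nn_integral_mono)
    fix x
    show "ennreal (indicator ?Q x *\<^sub>R \<bar>f x\<bar>) \<le> ennreal (F / 2) * indicator ?Q x
      + (\<Sum>j\<in>{M..<?m}. ennreal (max_quant j x - max_quant (j + 1) x) * indicator ?P x)"
    proof (cases "x \<in> ?Q")
      case True
      have "ennreal \<bar>f x\<bar> \<le> ennreal (F / 2 + (\<Sum>j\<in>{M..<?m}. max_quant j x - max_quant (j + 1) x))"
        by (rule ennreal_leI[OF pw[OF True]])
      also have "\<dots> = ennreal (F / 2) + (\<Sum>j\<in>{M..<?m}. ennreal (max_quant j x - max_quant (j + 1) x))"
        using F0 Bnn by (subst ennreal_plus) (auto intro!: sum_nonneg sum_ennreal[symmetric])
      finally show ?thesis using True sub[OF True] by simp
    qed simp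
  qed
  also have "\<dots> = ennreal (F / 2) * ennreal p
     + (\<Sum>j\<in>{M..<?m}. \<integral>\<^sup>+x. ennreal (max_quant j x - max_quant (j + 1) x) * indicator ?P x \<partial>lborel)"
    by (subst nn_integral_add, measurable, subst nn_integral_sum, measurable,
        subst nn_integral_cmult_indicator) (simp_all only: sets_lborel borel_dcube p)
  also have "(\<Sum>j\<in>{M..<?m}. \<integral>\<^sup>+x. ennreal (max_quant j x - max_quant (j + 1) x) * indicator ?P x \<partial>lborel)
    \<le> (\<Sum>j\<in>{M..<?m}. ennreal (poincare_const * 2 powr j) * (\<integral>\<^sup>+x. ennreal (norm (D x) * charge j x) * indicator ?P x \<partial>lborel))"
    using m by (intro sum_mono level_estimate_ancestor) auto
  also have "\<dots> = (\<integral>\<^sup>+x. (\<Sum>j\<in>{M..<?m}. ennreal (poincare_const * 2 powr j) * (ennreal (norm (D x) * charge j x) * indicator ?P x)) \<partial>lborel)"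
    by (subst nn_integral_sum, measurable, intro sum.cong refl nn_integral_cmult[symmetric]) measurable
  also have "\<dots> = (\<integral>\<^sup>+x. ennreal poincare_const * (ennreal (norm (D x) * weight M ?m x) * indicator ?P x) \<partial>lborel)"
  proof (rule nn_integral_cong)
    fix x
    have "(\<Sum>j\<in>{M..<?m}. ennreal (poincare_const * 2 powr j) * ennreal (norm (D x) * charge j x))
      = (\<Sum>j\<in>{M..<?m}. ennreal (poincare_const * (norm (D x) * (2 powr j * charge j x))))"
      using poincare_const_pos charge_nonneg by (intro sum.cong) (auto simp: ennreal_mult[symmetric] mult_ac)
    also have "\<dots> = ennreal (poincare_const * (norm (D x) * weight M ?m x))"
      using poincare_const_pos charge_nonneg by (subst sum_ennreal) (auto simp: weight_def sum_distrib_left)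
    finally show "(\<Sum>j\<in>{M..<?m}. ennreal (poincare_const * 2 powr j) * (ennreal (norm (D x) * charge j x) * indicator ?P x))
      = ennreal poincare_const * (ennreal (norm (D x) * weight M ?m x) * indicator ?P x)"
      using poincare_const_pos weight_nonneg by (auto split: split_indicator simp: ennreal_mult)
  qed
  also have "\<dots> = ennreal poincare_const * (\<integral>\<^sup>+x. ennreal (norm (D x) * weight M ?m x) * indicator ?P x \<partial>lborel)"
    by (rule nn_integral_cmult) measurable
  finally have main: "ennreal (F * p) \<le> ennreal (F / 2) * ennreal p
    + ennreal poincare_const * (\<integral>\<^sup>+x. ennreal (norm (D x) * weight M ?m x) * indicator ?P x \<partial>lborel)"
    by (simp add: add_left_mono)
  show ?thesis
  proof (cases "\<integral>\<^sup>+x. ennreal (norm (D x) * weight M ?m x) * indicator ?P x \<partial>lborel")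
    case (real r)
    then have "F * p \<le> F / 2 * p + poincare_const * r"
      using main F0 p poincare_const_pos by (simp add: ennreal_mult[symmetric] ennreal_plus[symmetric] del: ennreal_plus)
    then have "F * p \<le> 2 * poincare_const * r" by simp
    then show ?thesis
      using real F0 p poincare_const_pos by (simp add: F_def[symmetric] p_def[symmetric] ennreal_mult[symmetric] ennreal_leI)
  next
    case top
    then show ?thesis using poincare_const_pos by (simp add: ennreal_mult_top)
  qed
qed

text \<open>By uniform continuity f varies by less than \<epsilon> on all sufficiently small cubes
  inside Q, so the quantile of the small cube around x is at least |f x| - \<epsilon>. The
  telescoping thus ends at a finite level.\<close>

lemma approx_level:
  assumes "\<epsilon> > 0" "n \<le> N"
  obtains M0 where "M0 \<le> n" "\<And>M x. M \<le> M0 \<Longrightarrow> x \<in> dcube n k \<Longrightarrow> \<bar>f x\<bar> \<le> max_quant M x + \<epsilon>"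
proof -
  have "uniformly_continuous_on (closure (dcube n k)) f"
    by (intro compact_uniformly_continuous continuous_on_subset[OF cont_f])
      (auto simp: compact_closure bounded_dcube)
  then obtain d where d: "d > 0" "\<And>x y. x \<in> closure (dcube n k) \<Longrightarrow> y \<in> closure (dcube n k) \<Longrightarrow> dist y x < d \<Longrightarrow> dist (f y) (f x) < \<epsilon>"
    using assms unfolding uniformly_continuous_on_def by metis
  obtain i :: nat where i: "(1/2) ^ i < d / CARD('n)"
    using real_arch_pow_inv[of "d / CARD('n)" "1/2"] d by auto
  define M0 where "M0 = min n (- int i)"
  have "\<bar>f x\<bar> \<le> max_quant M x + \<epsilon>" if M: "M \<le> M0" and x: "x \<in> dcube n k" for M x
  proof -
    have "2 powr real_of_int M \<le> 2 powr (- real i)"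
      using M by (intro powr_mono) (auto simp: M0_def)
    also have "\<dots> = (1/2) ^ i" by (simp add: powr_minus powr_realpow power_one_over inverse_eq_divide)
    also note i
    finally have s: "real CARD('n) * 2 powr M < d" by (simp add: less_divide_eq mult.commute)
    have "\<bar>f x\<bar> - \<epsilon> \<le> quant M (cidx M x)"
    proof (rule quant_ge)
      fix y assume y: "y \<in> dcube M (cidx M x)"
      then have "y \<in> dcube n k"
        using x M dcube_mono[of M n x] by (auto simp: M0_def mem_dcube)
      moreover have "norm (y - x) \<le> CARD('n) * 2 powr M"
        using y by (intro norm_diff_dcube) (auto simp: mem_dcube)
      ultimately have "dist (f y) (f x) < \<epsilon>"
        using x s closure_subset[of "dcube n k"] by (intro d) (auto simp: dist_norm)
      then show "\<bar>f x\<bar> - \<epsilon> \<le> \<bar>f y\<bar>" by (auto simp: dist_real_def)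
    qed
    also have "\<dots> \<le> max_quant M x" using M assms by (intro max_quant_ge) (auto simp: M0_def)
    finally show ?thesis by simp
  qed
  then show ?thesis using that[of M0] by (simp add: M0_def)
qed

end

section \<open>Jensen's inequality for powers\<close>

lemma powr_above_tangent:
  fixes a t p :: real
  assumes "a > 0" "t \<ge> 0" "p \<ge> 1"
  shows "a powr p + p * a powr (p - 1) * (t - a) \<le> t powr p"
proof (cases "t = 0")
  \<comment> \<open>Convexity is applied on the open half-line, so the end point is treated by hand:
    the left side equals (1 - p) a^p \<le> 0.\<close>
  case True
  have "a powr (p - 1) * a = a powr p"
    using assms by (simp add: powr_diff)
  then have "a powr p + p * a powr (p - 1) * (t - a) = (1 - p) * a powr p"
    using True by (simp add: algebra_simps)
  also have "\<dots> \<le> 0" using assms by (intro mult_nonpos_nonneg) auto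
  finally show ?thesis using True by simp
next
  case False
  have "t powr p - a powr p \<ge> (p * a powr (p - 1)) * (t - a)"
  proof (rule convex_on_imp_above_tangent[where A = "{0<..}"])
    show "convex_on {0<..} (\<lambda>x. x powr p)" using assms by (simp add: powr_convex)
    show "((\<lambda>x. x powr p) has_field_derivative p * a powr (p - 1)) (at a within {0<..})"
      using assms by (auto intro!: derivative_eq_intros)
    show "connected {0::real<..}" by simp
    show "a \<in> interior {0<..}" using assms by (simp add: interior_open)
    show "t \<in> {0<..}" using False assms by simp
  qed
  then show ?thesis by simp
qed

text \<open>Integrates the tangent line of t^p at the mean against \<open>w\<close>. The density is
  a factor rather than part of the measure, so the lemma serves both the normalised indicator of a
  cube and a mollifier.\<close>

lemma powr_integral_le:
  fixes w h :: "'a \<Rightarrow> real"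
  assumes w: "\<And>x. 0 \<le> w x" "integrable M w" "integral\<^sup>L M w = 1" and h: "\<And>x. 0 \<le> h x"
    and i1: "integrable M (\<lambda>x. w x * h x)" and i2: "integrable M (\<lambda>x. w x * h x powr p)" and p: "1 \<le> p"
  shows "(\<integral>x. w x * h x \<partial>M) powr p \<le> (\<integral>x. w x * h x powr p \<partial>M)"
proof -
  define a where "a = (\<integral>x. w x * h x \<partial>M)"
  have "0 \<le> a" unfolding a_def using w h by (intro integral_nonneg_AE AE_I2) auto
  show ?thesis
  proof (cases "a = 0")
    case True
    then show ?thesis using w h p by (auto simp: a_def[symmetric] intro!: integral_nonneg_AE AE_I2)
  next
    case False
    with \<open>0 \<le> a\<close> have a: "a > 0" by simp
    have "a powr p = (a powr p - p * a powr (p - 1) * a) * integral\<^sup>L M w + p * a powr (p - 1) * a"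
      by (simp add: w)
    also have "\<dots> = (\<integral>x. (a powr p - p * a powr (p - 1) * a) * w x + p * a powr (p - 1) * (w x * h x) \<partial>M)"
      using w i1 by (simp add: a_def)
    also have "\<dots> \<le> (\<integral>x. w x * h x powr p \<partial>M)"
    proof (rule integral_mono)
      fix x
      have "w x * (a powr p + p * a powr (p - 1) * (h x - a)) \<le> w x * h x powr p"
        using w h by (intro mult_left_mono powr_above_tangent a p)
      then show "(a powr p - p * a powr (p - 1) * a) * w x + p * a powr (p - 1) * (w x * h x) \<le> w x * h x powr p"
        by (simp add: algebra_simps)
    qed (use w i1 i2 in auto)
    finally show ?thesis by (simp add: a_def)
  qed
qed

text \<open>Only a finite right side needs an argument. Then h is integrable over P because h \<le>
  1 + h^p and P has finite measure, and Jensen's inequality applies to the average of h over P,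
  which is at least c/(Kq).\<close>

lemma nn_jensen_set:
  fixes h :: "'a::euclidean_space \<Rightarrow> real"
  assumes p: "1 \<le> p" and [measurable]: "h \<in> borel_measurable borel" "P \<in> sets borel" and h: "\<And>x. 0 \<le> h x"
    and P: "emeasure lborel P = ennreal q" "q > 0" and K: "K > 0" "c \<ge> 0"
    and le: "ennreal c \<le> ennreal K * (\<integral>\<^sup>+x. ennreal (h x) * indicator P x \<partial>lborel)"
  shows "ennreal (q * (c / (K * q)) powr p) \<le> (\<integral>\<^sup>+x. ennreal (h x powr p) * indicator P x \<partial>lborel)"
proof (cases "\<integral>\<^sup>+x. ennreal (h x powr p) * indicator P x \<partial>lborel")
  case (real s)
  have eqi: "ennreal (h x powr r) * indicator P x = ennreal (indicator P x * h x powr r)" for x r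
    by (auto split: split_indicator)
  have i0: "integrable lborel (indicator P :: 'a \<Rightarrow> real)"
    using P by (intro integrable_real_indicator) auto
  have ip: "integrable lborel (\<lambda>x. indicator P x * h x powr p)"
    using real by (intro integrableI_nonneg) (auto simp: eqi)
  have i1: "integrable lborel (\<lambda>x. indicator P x * h x)"
  proof (rule Bochner_Integration.integrable_bound)
    show "integrable lborel (\<lambda>x. indicator P x + indicator P x * h x powr p)"
      using i0 ip by (rule Bochner_Integration.integrable_add)
    have "h x \<le> 1 + h x powr p" for x
    proof (cases "h x \<le> 1")
      case False
      then have "h x powr 1 \<le> h x powr p" using p by (intro powr_mono) auto
      then show ?thesis using False by simp
    qed (use powr_ge_zero[of "h x" p] in linarith)
    then show "AE x in lborel. norm (indicator P x * h x) \<le> norm (indicator P x + indicator P x * h x powr p)"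
      using h by (auto split: split_indicator)
  qed measurable
  define r where "r = (\<integral>x. indicator P x * h x \<partial>lborel)"
  have r0: "r \<ge> 0" unfolding r_def using h by (intro integral_nonneg_AE AE_I2) auto
  have "(\<integral>\<^sup>+x. ennreal (h x) * indicator P x \<partial>lborel) = (\<integral>\<^sup>+x. ennreal (indicator P x * h x) \<partial>lborel)"
    by (intro nn_integral_cong) (auto split: split_indicator)
  also have "\<dots> = ennreal r"
    unfolding r_def using i1 h by (intro nn_integral_eq_integral) auto
  finally have cr: "c \<le> K * r" using le K r0 by (simp add: ennreal_mult[symmetric])
  have "(\<integral>\<^sup>+x. ennreal (h x powr p) * indicator P x \<partial>lborel) = ennreal (\<integral>x. indicator P x * h x powr p \<partial>lborel)"
    unfolding eqi using ip by (intro nn_integral_eq_integral) auto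
  moreover have "q * (c / (K * q)) powr p \<le> (\<integral>x. indicator P x * h x powr p \<partial>lborel)"
  proof -
    have "integral\<^sup>L lborel (indicator P :: 'a \<Rightarrow> real) = q"
      using P by (simp add: measure_def)
    then have "(\<integral>x. (indicator P x / q) * h x \<partial>lborel) powr p \<le> (\<integral>x. (indicator P x / q) * h x powr p \<partial>lborel)"
      using P i0 i1 ip h p by (intro powr_integral_le) auto
    then have "(r / q) powr p \<le> (\<integral>x. indicator P x * h x powr p \<partial>lborel) / q"
      by (simp add: r_def)
    moreover have "(c / (K * q)) powr p \<le> (r / q) powr p"
      using cr K P p by (intro powr_mono2) (auto simp: field_simps)
    ultimately have "(c / (K * q)) powr p \<le> (\<integral>x. indicator P x * h x powr p \<partial>lborel) / q" by linarith
    then show ?thesis using P by (simp add: field_simps)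
  qed
  ultimately show ?thesis by (simp add: ennreal_leI)
qed simp

section \<open>Geometric sums and the number of descendants of a cube\<close>

lemma sum_half_powers_le:
  assumes "finite I" "\<And>i. i \<in> I \<Longrightarrow> 1 \<le> (i::int)"
  shows "(\<Sum>i\<in>I. 2 powr (- real_of_int i)) \<le> 1"
proof -
  have inj: "inj_on nat I"
  proof (rule inj_onI)
    fix x y assume "x \<in> I" "y \<in> I" "nat x = nat y"
    then show "x = y" using assms(2)[of x] assms(2)[of y] by arith
  qed
  have "(\<Sum>i\<in>I. 2 powr (- real_of_int i)) = (\<Sum>i\<in>I. (1/2) ^ nat i)"
  proof (rule sum.cong[OF refl])
    fix i assume "i \<in> I"
    then have "real_of_int i = real (nat i)" using assms(2)[of i] by simp
    moreover have "2 powr (- real j) = (1/2) ^ j" for j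
      by (simp add: powr_minus powr_realpow power_one_over inverse_eq_divide)
    ultimately show "2 powr (- real_of_int i) = (1/2) ^ nat i" by (simp only:)
  qed
  also have "\<dots> = (\<Sum>i\<in>nat ` I. (1/2) ^ i)" using inj by (simp add: sum.reindex)
  also have "\<dots> \<le> (\<Sum>i\<in>{1..Max (insert 1 (nat ` I))}. (1/2) ^ i)"
  proof (rule sum_mono2)
    show "nat ` I \<subseteq> {1..Max (insert 1 (nat ` I))}"
    proof (rule image_subsetI)
      fix i assume i: "i \<in> I"
      have "1 \<le> nat i" using assms(2)[OF i] by linarith
      moreover have "nat i \<le> Max (insert 1 (nat ` I))" using assms(1) i by (intro Max_ge) auto
      ultimately show "nat i \<in> {1..Max (insert 1 (nat ` I))}" by (simp only: atLeastAtMost_iff)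
    qed
  qed auto
  also have "\<dots> \<le> 1"
  proof -
    have "(\<Sum>i\<in>{1..n}. (1/2::real) ^ i) = 1 - (1/2) ^ n" for n
      by (induct n) auto
    then show ?thesis by simp
  qed
  finally show ?thesis .
qed

text \<open>The number of subcubes of relative order \<kappa>. It is kept as a cardinality because
  only its independence of the level and of the function matters; the type argument supplies the
  dimension.\<close>

definition residues_card :: "'n::finite itself \<Rightarrow> int \<Rightarrow> nat" where
  "residues_card _ \<kappa> = card {r :: int^'n. \<forall>i. r$i \<in> {0..<2 ^ nat \<kappa>}}"

lemma finite_residues: "finite {r :: int^'n. \<forall>i. r$i \<in> {0..<c}}"
proof -
  have "{r :: int^'n. \<forall>i. r$i \<in> {0..<c}} \<subseteq> vec_lambda ` (UNIV \<rightarrow>\<^sub>E {0..<c})"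
  proof safe
    fix r :: "int^'n" assume "\<forall>i. r $ i \<in> {0..<c}"
    then show "r \<in> vec_lambda ` (UNIV \<rightarrow>\<^sub>E {0..<c})" by (intro image_eqI[of _ _ "vec_nth r"]) auto
  qed
  then show ?thesis by (rule finite_subset) (intro finite_imageI finite_PiE, auto)
qed

text \<open>Cubes with the same ancestor share the quotients of their indices by 2^\<kappa>, so the
  remainders tell them apart.\<close>

lemma card_descendants_le:
  assumes "0 < \<kappa>"
  shows "card {k. (n, k) \<in> F \<and> x \<in> dcube (n + \<kappa>) (cidx (n + \<kappa>) (corner n (k :: int^'n)))}
      \<le> residues_card TYPE('n) \<kappa>"
  unfolding residues_card_def
proof (rule card_inj_on_le[OF _ _ finite_residues])
  let ?c = "2 ^ nat \<kappa> :: int"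
  let ?g = "\<lambda>k. (\<chi> i. k $ i mod ?c) :: int^'n"
  let ?A = "{k. (n, k) \<in> F \<and> x \<in> dcube (n + \<kappa>) (cidx (n + \<kappa>) (corner n k))}"
  show "?g ` ?A \<subseteq> {r. \<forall>i. r $ i \<in> {0..<?c}}" by auto
  show "inj_on ?g ?A"
  proof (rule inj_onI)
    fix k l :: "int^'n" assume kl: "k \<in> ?A" "l \<in> ?A" "?g k = ?g l"
    then have "cidx (n + \<kappa>) (corner n k) = cidx (n + \<kappa>) (corner n l)" by (simp add: mem_dcube)
    then have "k $ i div ?c = l $ i div ?c" for i
      using assms by (simp add: cidx_coarsen[of n "n + \<kappa>"] vec_eq_iff)
    moreover have "k $ i mod ?c = l $ i mod ?c" for i
      using kl(3) by (simp add: vec_eq_iff)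
    ultimately have "k $ i = l $ i" for i
      by (metis div_mult_mod_eq)
    then show "k = l" by (simp add: vec_eq_iff)
  qed
qed

section \<open>Summation over the cubes\<close>

context smooth_dyadic
begin

lemma charge_values: "charge j x = 0 \<or> charge j x = 1"
  by (auto simp: charge_def indicator_def)

lemma weight_values:
  assumes "m \<le> N" "charge j x \<noteq> 0" "j < N"
  shows "weight M m x = (if M \<le> j \<and> j < m then 2 powr j else 0)"
proof -
  have "weight M m x = (\<Sum>i\<in>{M..<m}. if i = j then 2 powr j else 0)"
    unfolding weight_def
  proof (intro sum.cong refl)
    fix i assume i: "i \<in> {M..<m}"
    show "2 powr real_of_int i * charge i x = (if i = j then 2 powr real_of_int j else 0)"
    proof (cases "i = j")
      case True
      then show ?thesis using charge_values[of j x] assms(2) by auto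
    next
      case False
      then have "charge i x = 0" using charge_unique[OF _ assms(2) _ assms(3)] i assms(1) by fastforce
      then show ?thesis using False by simp
    qed
  qed
  then show ?thesis by simp
qed

lemma weight_zero:
  assumes "m \<le> N" "\<And>j. j < N \<Longrightarrow> charge j x = 0"
  shows "weight M m x = 0"
  unfolding weight_def using assms by (intro sum.neutral) auto

lemma weight_le: "m \<le> N \<Longrightarrow> weight M m x \<le> 2 powr m"
proof (cases "\<exists>j<N. charge j x \<noteq> 0")
  case True
  assume "m \<le> N"
  with True show ?thesis by (auto simp: weight_values intro!: powr_mono)
next
  case False
  assume "m \<le> N"
  with False show ?thesis by (subst weight_zero) auto
qed

text \<open>Only one scale 2^j can be charged at x. A cube of level n then contributes at most
  2^(-(n + \<kappa> - j)), and nothing unless j < n + \<kappa> and its ancestor contains x. At each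
  level the latter leaves boundedly many cubes, and the geometric series over the levels is at most
  1.\<close>

lemma sum_weight_le:
  assumes F: "finite F" "\<And>n k. (n, k) \<in> F \<Longrightarrow> n + \<kappa> \<le> N" and \<kappa>: "0 < \<kappa>" and p: "1 \<le> p"
  shows "(\<Sum>(n, k)\<in>F. (weight M (n + \<kappa>) x / 2 powr (n + \<kappa>)) powr p *
           indicator (dcube (n + \<kappa>) (cidx (n + \<kappa>) (corner n k))) x) \<le> real (residues_card TYPE('n) \<kappa>)"
    (is "(\<Sum>(n, k)\<in>F. ?t n k) \<le> ?c")
proof (cases "\<exists>j<N. charge j x \<noteq> 0")
  case True
  then obtain j where j: "j < N" "charge j x \<noteq> 0" by auto
  let ?w = "\<lambda>n. if j < n + \<kappa> then 2 powr (- real_of_int (n + \<kappa> - j)) else 0"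
  have t_le: "?t n k \<le> ?w n * indicator (dcube (n + \<kappa>) (cidx (n + \<kappa>) (corner n k))) x" if "n + \<kappa> \<le> N" for n k
  proof (cases "M \<le> j \<and> j < n + \<kappa>")
    case True
    have "2 powr real_of_int j / 2 powr (real_of_int n + real_of_int \<kappa>) = 2 powr (- real_of_int (n + \<kappa> - j))"
      by (simp add: powr_diff[symmetric])
    moreover have "(2 powr (- real_of_int (n + \<kappa> - j))) powr p \<le> 2 powr (- real_of_int (n + \<kappa> - j))"
    proof -
      have "real_of_int (n + \<kappa> - j) * 1 \<le> real_of_int (n + \<kappa> - j) * p"
        using True p by (intro mult_left_mono) auto
      then show ?thesis unfolding powr_powr by (intro powr_mono) (auto simp: algebra_simps)
    qed
    ultimately show ?thesis
      using True that j by (subst weight_values[OF that j(2,1)]) (auto simp del: of_int_add of_int_diff split: split_indicator)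
  next
    case False
    then show ?thesis using that j p by (subst weight_values[OF that j(2,1)]) auto
  qed
  let ?A = "\<lambda>n. {k. (n, k) \<in> F}" and ?B = "\<lambda>n. {k. (n, k) \<in> F \<and> x \<in> dcube (n + \<kappa>) (cidx (n + \<kappa>) (corner n k))}"
  have FS: "F = Sigma (fst ` F) ?A" by force
  have finA: "finite (?A n)" for n
    using F(1) by (rule finite_subset[rotated, OF finite_imageI[of F snd]]) force
  have "(\<Sum>(n, k)\<in>F. ?t n k) \<le> (\<Sum>(n, k)\<in>F. ?w n * indicator (dcube (n + \<kappa>) (cidx (n + \<kappa>) (corner n k))) x)"
    using t_le F(2) by (intro sum_mono) auto
  also have "\<dots> = (\<Sum>n\<in>fst ` F. \<Sum>k\<in>?A n. ?w n * indicator (dcube (n + \<kappa>) (cidx (n + \<kappa>) (corner n k))) x)"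
    using F(1) finA by (subst sum.Sigma) (auto simp flip: FS)
  also have "\<dots> = (\<Sum>n\<in>fst ` F. ?w n * real (card (?B n)))"
  proof (intro sum.cong refl)
    fix n
    have "(\<Sum>k\<in>?A n. indicator (dcube (n + \<kappa>) (cidx (n + \<kappa>) (corner n k))) x) = (\<Sum>k\<in>?B n. 1::real)"
      using finA by (intro sum.mono_neutral_cong_right) auto
    then show "(\<Sum>k\<in>?A n. ?w n * indicator (dcube (n + \<kappa>) (cidx (n + \<kappa>) (corner n k))) x) = ?w n * real (card (?B n))"
      by (subst sum_distrib_left[symmetric]) simp
  qed
  also have "\<dots> \<le> (\<Sum>n\<in>fst ` F. ?w n * ?c)"
    by (intro sum_mono mult_left_mono of_nat_mono card_descendants_le \<kappa>) auto
  also have "\<dots> = (\<Sum>n\<in>fst ` F. ?w n) * ?c" by (simp add: sum_distrib_right)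
  also have "(\<Sum>n\<in>fst ` F. ?w n) = (\<Sum>n\<in>{n\<in>fst ` F. j < n + \<kappa>}. 2 powr (- real_of_int (n + \<kappa> - j)))"
    using F(1) by (intro sum.mono_neutral_cong_right) auto
  also have "\<dots> = (\<Sum>i\<in>(\<lambda>n. n + \<kappa> - j) ` {n\<in>fst ` F. j < n + \<kappa>}. 2 powr (- real_of_int i))"
    by (subst sum.reindex) (auto simp: inj_on_def)
  also have "\<dots> * ?c \<le> 1 * ?c"
    using F(1) by (intro mult_right_mono sum_half_powers_le) auto
  finally show ?thesis by simp
next
  case False
  then have "weight M (n + \<kappa>) x = 0" if "n + \<kappa> \<le> N" for n
    using that by (intro weight_zero) auto
  then have "(\<Sum>(n, k)\<in>F. ?t n k) = 0"
    using F p by (intro sum.neutral) auto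
  then show ?thesis by simp
qed

text \<open>Origin of the factors before the power is taken: 2 from the absorption,
  \<open>poincare_const\<close> from the level estimates, 2^(\<kappa>d) = |P|/|Q| and 2^\<kappa> =
  \<ell>(P)/\<ell>(Q).\<close>

definition cube_const :: "real \<Rightarrow> int \<Rightarrow> real" where
  "cube_const p \<kappa> = (2 * poincare_const * 2 powr (\<kappa> * real CARD('n)) * 2 powr \<kappa>) powr p"

text \<open>The estimate for Q is normalised by \<ell>(P), so that Jensen's inequality over P acts
  on |D| times the relative scale \<ell>(x)/\<ell>(P); the p-th powers of the latter can be summed
  over the cubes.\<close>

lemma cube_powr_estimate:
  assumes good: "good_cube \<alpha> n k" and \<alpha>: "\<alpha> > 0" and \<kappa>: "real CARD('n) + 3 \<le> \<alpha> * \<kappa>" "0 < \<kappa>"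
    and m: "n + \<kappa> \<le> N" and M: "M \<le> n" and p: "1 \<le> p"
    and approx: "\<And>x. x \<in> dcube n k \<Longrightarrow> \<bar>f x\<bar> \<le> max_quant M x + avg f (dcube n k) / 4"
  shows "ennreal ((side n powr (real CARD('n) / p - 1) * avg f (dcube n k)) powr p)
    \<le> ennreal (cube_const p \<kappa>) * (\<integral>\<^sup>+x. ennreal (norm (D x) powr p * (weight M (n + \<kappa>) x / 2 powr (n + \<kappa>)) powr p)
         * indicator (dcube (n + \<kappa>) (cidx (n + \<kappa>) (corner n k))) x \<partial>lborel)"
proof -
  let ?P = "dcube (n + \<kappa>) (cidx (n + \<kappa>) (corner n k))"
  define F where "F = avg f (dcube n k)"
  define d where "d = real CARD('n)"
  have F0: "F \<ge> 0" by (simp add: F_def avg_nonneg)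
  define q where "q = 2 powr (real_of_int (n + \<kappa>) * d)"
  have q: "q > 0" by (simp add: q_def)
  have est: "ennreal (F * 2 powr (n * d)) \<le> ennreal (2 * poincare_const * 2 powr (n + \<kappa>)) *
      (\<integral>\<^sup>+x. ennreal (norm (D x) * (weight M (n + \<kappa>) x / 2 powr (n + \<kappa>))) * indicator ?P x \<partial>lborel)"
  proof -
    have "ennreal (F * 2 powr (n * d)) \<le> ennreal (2 * poincare_const) * (\<integral>\<^sup>+x. ennreal (norm (D x) * weight M (n + \<kappa>) x) * indicator ?P x \<partial>lborel)"
      using cube_estimate[OF good \<alpha> \<kappa> m M approx refl] F0 by (simp add: F_def d_def ennreal_mult)
    also have "(\<integral>\<^sup>+x. ennreal (norm (D x) * weight M (n + \<kappa>) x) * indicator ?P x \<partial>lborel)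
      = (\<integral>\<^sup>+x. ennreal (2 powr (n + \<kappa>)) * (ennreal (norm (D x) * (weight M (n + \<kappa>) x / 2 powr (n + \<kappa>))) * indicator ?P x) \<partial>lborel)"
      using weight_nonneg by (intro nn_integral_cong) (auto split: split_indicator simp: ennreal_mult[symmetric])
    also have "\<dots> = ennreal (2 powr (n + \<kappa>)) * (\<integral>\<^sup>+x. ennreal (norm (D x) * (weight M (n + \<kappa>) x / 2 powr (n + \<kappa>))) * indicator ?P x \<partial>lborel)"
      by (rule nn_integral_cmult) measurable
    finally show ?thesis using poincare_const_pos by (simp add: ennreal_mult mult.assoc)
  qed
  let ?J = "\<integral>\<^sup>+x. ennreal (norm (D x) powr p * (weight M (n + \<kappa>) x / 2 powr (n + \<kappa>)) powr p) * indicator ?P x \<partial>lborel"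
  define K where "K = 2 * poincare_const * 2 powr (n + \<kappa>)"
  have K: "K > 0" using poincare_const_pos by (simp add: K_def)
  have "ennreal (q * (F * 2 powr (n * d) / (K * q)) powr p)
     \<le> (\<integral>\<^sup>+x. ennreal ((norm (D x) * (weight M (n + \<kappa>) x / 2 powr (n + \<kappa>))) powr p) * indicator ?P x \<partial>lborel)"
  proof (rule nn_jensen_set[OF p])
    show "emeasure lborel ?P = ennreal q" by (simp add: emeasure_dcube q_def d_def)
    show "ennreal (F * 2 powr (n * d)) \<le> ennreal K *
      (\<integral>\<^sup>+x. ennreal (norm (D x) * (weight M (n + \<kappa>) x / 2 powr (n + \<kappa>))) * indicator ?P x \<partial>lborel)"
      using est by (simp add: K_def)
  qed (use q K F0 weight_nonneg in auto)
  also have "\<dots> = ?J" using weight_nonneg by (intro nn_integral_cong) (subst powr_mult, auto)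
  finally have J: "ennreal (q * (F * 2 powr (n * d) / (K * q)) powr p) \<le> ?J" .
  have "((2 powr n) powr (d / p - 1) * F) powr p = 2 powr (n * d - n * p) * F powr p"
  proof -
    have "real_of_int n * (d / p - 1) * p = n * d - n * p" using p by (simp add: field_simps)
    then show ?thesis using F0 by (simp add: powr_mult powr_powr)
  qed
  \<comment> \<open>Jensen's inequality carries |P| where the claim carries |Q|. The quotient
    2^(\<kappa>d) is at least 1 and may be inserted.\<close>
  also have "\<dots> \<le> 2 powr (\<kappa> * d) * (2 powr (n * d - n * p) * F powr p)"
  proof -
    have "1 \<le> 2 powr (\<kappa> * d)" using \<kappa> by (intro ge_one_powr_ge_zero) (auto simp: d_def)
    then have "1 * (2 powr (n * d - n * p) * F powr p) \<le> 2 powr (\<kappa> * d) * (2 powr (n * d - n * p) * F powr p)"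
      by (rule mult_right_mono) simp
    then show ?thesis by simp
  qed
  also have "\<dots> = cube_const p \<kappa> * (q * (F * 2 powr (n * d) / (K * q)) powr p)"
  proof -
    \<comment> \<open>In terms of cubes K is 2 \<open>poincare_const\<close> \<ell>(P), so the
      product of the constant with F|Q|/(K|P|) collapses to F/\<ell>(Q).\<close>
    have "2 * poincare_const * 2 powr (\<kappa> * d) * 2 powr \<kappa> * (F * 2 powr (n * d) / (K * q)) = F * 2 powr (- real_of_int n)"
    proof -
      have cancel: "2 * poincare_const * A * B * (F * E / (2 * poincare_const * (G * B) * (E * A))) = F / G"
        if "A > 0" "B > 0" "E > 0" "G > 0" for A B E G :: real
        using that poincare_const_pos by (simp add: field_simps)
      have eqs: "K = 2 * poincare_const * (2 powr n * 2 powr \<kappa>)" "q = 2 powr (n * d) * 2 powr (\<kappa> * d)"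
        by (simp_all add: K_def q_def powr_add distrib_right)
      have r: "F * 2 powr (- real_of_int n) = F / 2 powr n" by (simp add: powr_minus divide_inverse)
      show ?thesis unfolding eqs r by (rule cancel) auto
    qed
    then have "cube_const p \<kappa> * (F * 2 powr (n * d) / (K * q)) powr p = (F * 2 powr (- real_of_int n)) powr p"
      using poincare_const_pos F0 K q powr_mult[of "2 * poincare_const * 2 powr (\<kappa> * d) * 2 powr \<kappa>" "F * 2 powr (n * d) / (K * q)" p]
      by (simp only: cube_const_def d_def)
    also have "\<dots> = F powr p * 2 powr (- (n * p))"
      using F0 by (simp add: powr_mult powr_powr)
    finally have "cube_const p \<kappa> * (q * (F * 2 powr (n * d) / (K * q)) powr p) = q * (F powr p * 2 powr (- (n * p)))"
      by (simp only: mult.left_commute)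
    also have "\<dots> = 2 powr (\<kappa> * d) * (2 powr (n * d + - (n * p)) * F powr p)"
      unfolding q_def by (simp only: powr_add distrib_left of_int_add mult_ac)
    finally show ?thesis unfolding add_uminus_conv_diff by (rule sym)
  qed
  finally have "ennreal (((2 powr n) powr (d / p - 1) * F) powr p) \<le> ennreal (cube_const p \<kappa> * (q * (F * 2 powr (n * d) / (K * q)) powr p))"
    by (rule ennreal_leI)
  also have "\<dots> \<le> ennreal (cube_const p \<kappa>) * ?J"
    using J q by (subst ennreal_mult) (auto simp: cube_const_def intro!: mult_left_mono)
  finally show ?thesis by (simp add: side_def F_def d_def)
qed

text \<open>The average of the parent is nonnegative, so a strict comparison with it forces
  positivity. A quarter of the average can therefore serve as the \<epsilon> of the
  approximation.\<close>

lemma good_cube_avg_pos: "good_cube \<alpha> n k \<Longrightarrow> n < N \<Longrightarrow> 0 < avg f (dcube n k)"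
proof -
  assume g: "good_cube \<alpha> n k" "n < N"
  have "corner n k \<in> dcube n k" by (simp add: mem_dcube)
  then have "side (n + 1) powr \<alpha> * avg f (dcube (n + 1) (cidx (n + 1) (corner n k))) < side n powr \<alpha> * avg f (dcube n k)"
    using g by (auto simp: good_cube_def)
  moreover have "0 \<le> side (n + 1) powr \<alpha> * avg f (dcube (n + 1) (cidx (n + 1) (corner n k)))"
    by (simp add: avg_nonneg)
  ultimately have "0 < side n powr \<alpha> * avg f (dcube n k)" by linarith
  then show ?thesis using avg_nonneg[of f "dcube n k"] by (auto simp: zero_less_mult_iff)
qed

text \<open>The integral is confined to a ball because the mollified gradient of a BV function will
  be estimated on balls. The radius depends on the cubes in \<open>F\<close>, the constant does
  not.\<close>

theorem sum_estimate:
  assumes F: "finite F" "\<And>n k. (n, k) \<in> F \<Longrightarrow> n + \<kappa> \<le> N \<and> good_cube \<alpha> n k"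
    and \<alpha>: "\<alpha> > 0" and \<kappa>: "real CARD('n) + 3 \<le> \<alpha> * \<kappa>" "0 < \<kappa>" and p: "1 \<le> p"
  obtains R where "ennreal (\<Sum>(n, k)\<in>F. (side n powr (real CARD('n) / p - 1) * avg f (dcube n k)) powr p)
     \<le> ennreal (cube_const p \<kappa> * real (residues_card TYPE('n) \<kappa>)) *
        (\<integral>\<^sup>+x. ennreal (norm (D x) powr p) * indicator (cball 0 R) x \<partial>lborel)"
proof -
  have "\<exists>M0\<le>fst Q. \<forall>M x. M \<le> M0 \<longrightarrow> x \<in> dcube (fst Q) (snd Q) \<longrightarrow> \<bar>f x\<bar> \<le> max_quant M x + avg f (dcube (fst Q) (snd Q)) / 4"
    if "Q \<in> F" for Q
  proof -
    have Q: "fst Q + \<kappa> \<le> N" "good_cube \<alpha> (fst Q) (snd Q)" using F(2)[of "fst Q" "snd Q"] that by auto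
    then have "0 < avg f (dcube (fst Q) (snd Q)) / 4" using good_cube_avg_pos \<kappa> by auto
    moreover have "fst Q \<le> N" using Q \<kappa> by auto
    ultimately show ?thesis using approx_level[of "avg f (dcube (fst Q) (snd Q)) / 4" "fst Q" "snd Q"] by metis
  qed
  then obtain M0 where M0: "\<And>Q. Q \<in> F \<Longrightarrow> M0 Q \<le> fst Q"
    "\<And>Q M x. Q \<in> F \<Longrightarrow> M \<le> M0 Q \<Longrightarrow> x \<in> dcube (fst Q) (snd Q) \<Longrightarrow> \<bar>f x\<bar> \<le> max_quant M x + avg f (dcube (fst Q) (snd Q)) / 4"
    by metis
  \<comment> \<open>A common bottom level for all cubes, so that every term uses the same lower
    cut-off; the 0 covers empty \<open>F\<close>.\<close>
  define M where "M = Min (insert 0 (M0 ` F))"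
  have M: "M \<le> M0 Q" if "Q \<in> F" for Q unfolding M_def using F(1) that by (intro Min_le) auto
  let ?P = "\<lambda>n k. dcube (n + \<kappa>) (cidx (n + \<kappa>) (corner n k))"
  have "bounded (\<Union>(n, k)\<in>F. ?P n k)" using F(1) by (intro bounded_UN) (auto intro: bounded_dcube)
  then obtain R where R: "(\<Union>(n, k)\<in>F. ?P n k) \<subseteq> cball 0 R"
    using bounded_iff[of "\<Union>(n, k)\<in>F. ?P n k"] by (auto simp: subset_iff)
  let ?V = "\<lambda>n x. (weight M (n + \<kappa>) x / 2 powr (real_of_int n + real_of_int \<kappa>)) powr p"
  let ?c = "real (residues_card TYPE('n) \<kappa>)"
  have "ennreal (\<Sum>(n, k)\<in>F. (side n powr (real CARD('n) / p - 1) * avg f (dcube n k)) powr p)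
    = (\<Sum>(n, k)\<in>F. ennreal ((side n powr (real CARD('n) / p - 1) * avg f (dcube n k)) powr p))"
    by (subst sum_ennreal[symmetric]) (auto simp: split_beta)
  also have "\<dots> \<le> (\<Sum>(n, k)\<in>F. ennreal (cube_const p \<kappa>) *
       (\<integral>\<^sup>+x. ennreal (norm (D x) powr p * ?V n x) * indicator (?P n k) x \<partial>lborel))"
  proof (rule sum_mono, safe)
    fix n k assume nk: "(n, k) \<in> F"
    show "ennreal ((side n powr (real CARD('n) / p - 1) * avg f (dcube n k)) powr p) \<le> ennreal (cube_const p \<kappa>) *
       (\<integral>\<^sup>+x. ennreal (norm (D x) powr p * ?V n x) * indicator (?P n k) x \<partial>lborel)"
      using F(2)[OF nk] M[OF nk] M0(1)[OF nk] M0(2)[OF nk] by (intro cube_powr_estimate[OF _ \<alpha> \<kappa> _ _ p]) auto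
  qed
  also have "\<dots> = ennreal (cube_const p \<kappa>) * (\<Sum>(n, k)\<in>F.
       (\<integral>\<^sup>+x. ennreal (norm (D x) powr p * ?V n x) * indicator (?P n k) x \<partial>lborel))"
    by (simp add: sum_distrib_left split_beta)
  also have "(\<Sum>(n, k)\<in>F. (\<integral>\<^sup>+x. ennreal (norm (D x) powr p * ?V n x) * indicator (?P n k) x \<partial>lborel))
    = (\<integral>\<^sup>+x. (\<Sum>(n, k)\<in>F. ennreal (norm (D x) powr p * ?V n x) * indicator (?P n k) x) \<partial>lborel)"
    unfolding split_beta by (rule nn_integral_sum[symmetric]) measurable
  also have "\<dots> \<le> (\<integral>\<^sup>+x. ennreal ?c * (ennreal (norm (D x) powr p) * indicator (cball 0 R) x) \<partial>lborel)"
  proof (rule nn_integral_mono)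
    fix x
    have "(\<Sum>(n, k)\<in>F. ennreal (norm (D x) powr p * ?V n x) * indicator (?P n k) x)
      = (\<Sum>(n, k)\<in>F. ennreal (norm (D x) powr p * (?V n x * indicator (?P n k) x)))"
      by (intro sum.cong) (auto split: split_indicator)
    also have "\<dots> = ennreal (\<Sum>(n, k)\<in>F. norm (D x) powr p * (?V n x * indicator (?P n k) x))"
      by (subst sum_ennreal[symmetric]) (auto simp: split_beta)
    also have "\<dots> = ennreal (norm (D x) powr p * (\<Sum>(n, k)\<in>F. ?V n x * indicator (?P n k) x))"
      by (simp add: sum_distrib_left split_beta)
    finally have eq: "(\<Sum>(n, k)\<in>F. ennreal (norm (D x) powr p * ?V n x) * indicator (?P n k) x)
      = ennreal (norm (D x) powr p * (\<Sum>(n, k)\<in>F. ?V n x * indicator (?P n k) x))" .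
    show "(\<Sum>(n, k)\<in>F. ennreal (norm (D x) powr p * ?V n x) * indicator (?P n k) x)
      \<le> ennreal ?c * (ennreal (norm (D x) powr p) * indicator (cball 0 R) x)"
    proof (cases "x \<in> cball 0 R")
      case True
      have "norm (D x) powr p * (\<Sum>(n, k)\<in>F. ?V n x * indicator (?P n k) x) \<le> norm (D x) powr p * ?c"
        using F(2) by (intro mult_left_mono sum_weight_le F \<kappa> p) auto
      then have "ennreal (norm (D x) powr p * (\<Sum>(n, k)\<in>F. ?V n x * indicator (?P n k) x)) \<le> ennreal (norm (D x) powr p * ?c)"
        by (rule ennreal_leI)
      then show ?thesis unfolding eq using True by (simp add: ennreal_mult mult.commute)
    next
      case False
      have "x \<notin> ?P n k" if "(n, k) \<in> F" for n k using False R that by blast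
      then have "(\<Sum>(n, k)\<in>F. ?V n x * indicator (?P n k) x) = 0"
        by (intro sum.neutral) (auto split: split_indicator)
      then show ?thesis unfolding eq by simp
    qed
  qed
  also have "\<dots> = ennreal ?c * (\<integral>\<^sup>+x. ennreal (norm (D x) powr p) * indicator (cball 0 R) x \<partial>lborel)"
    by (rule nn_integral_cmult) measurable
  finally have "ennreal (\<Sum>(n, k)\<in>F. (side n powr (real CARD('n) / p - 1) * avg f (dcube n k)) powr p)
     \<le> ennreal (cube_const p \<kappa> * ?c) * (\<integral>\<^sup>+x. ennreal (norm (D x) powr p) * indicator (cball 0 R) x \<partial>lborel)"
    by (simp add: ennreal_mult cube_const_def mult.assoc mult_left_mono)
  then show ?thesis by (rule that)
qed

text \<open>A single cube requires no summation over scales, so the scale of a point may be bounded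
  crudely by that of the ancestor.\<close>

theorem sup_estimate:
  assumes good: "good_cube \<alpha> n k" and \<alpha>: "\<alpha> > 0" and \<kappa>: "real CARD('n) + 3 \<le> \<alpha> * \<kappa>" "0 < \<kappa>"
    and m: "n + \<kappa> \<le> N" and L: "\<And>x. norm (D x) \<le> L"
  shows "side n powr (-1) * avg f (dcube n k) \<le> cube_const 1 \<kappa> * L"
proof -
  define d where "d = real CARD('n)"
  let ?P = "dcube (n + \<kappa>) (cidx (n + \<kappa>) (corner n k))"
  define F where "F = avg f (dcube n k)"
  have F0: "F > 0" unfolding F_def using good_cube_avg_pos[OF good] m \<kappa> by simp
  have L0: "0 \<le> L" using L[of 0] norm_ge_zero order_trans by blast
  have "F / 4 > 0" "n \<le> N" using F0 m \<kappa> by auto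
  then obtain M where M: "M \<le> n" "\<And>x. x \<in> dcube n k \<Longrightarrow> \<bar>f x\<bar> \<le> max_quant M x + F / 4"
    using approx_level[of "F / 4" n k] by (metis order_refl)
  have "ennreal (F * 2 powr (n * d)) \<le> ennreal (2 * poincare_const) * (\<integral>\<^sup>+x. ennreal (norm (D x) * weight M (n + \<kappa>) x) * indicator ?P x \<partial>lborel)"
    using cube_estimate[OF good \<alpha> \<kappa> m M(1) _ refl] M(2) F0 by (simp add: F_def d_def ennreal_mult)
  also have "\<dots> \<le> ennreal (2 * poincare_const) * (\<integral>\<^sup>+x. ennreal (L * 2 powr (n + \<kappa>)) * indicator ?P x \<partial>lborel)"
    using L weight_le[OF m] weight_nonneg L0 by (intro mult_left_mono nn_integral_mono mult_right_mono ennreal_leI mult_mono) auto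
  also have "\<dots> = ennreal (2 * poincare_const * ((L * 2 powr (n + \<kappa>)) * 2 powr (real_of_int (n + \<kappa>) * d)))"
    using poincare_const_pos L0 by (subst nn_integral_cmult_indicator) (auto simp: emeasure_dcube ennreal_mult d_def)
  finally have "F * 2 powr (n * d) \<le> 2 * poincare_const * ((L * 2 powr (n + \<kappa>)) * 2 powr (real_of_int (n + \<kappa>) * d))"
    using poincare_const_pos L0 by (subst (asm) ennreal_le_iff) auto
  also have "\<dots> = (2 * poincare_const * 2 powr (\<kappa> * d) * 2 powr \<kappa> * L * 2 powr n) * 2 powr (n * d)"
    by (simp only: powr_add distrib_left of_int_add mult_ac)
  finally have "F \<le> 2 * poincare_const * 2 powr (\<kappa> * d) * 2 powr \<kappa> * L * 2 powr n"
    by simp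
  then have "F / 2 powr n \<le> 2 * poincare_const * 2 powr (\<kappa> * d) * 2 powr \<kappa> * L"
    by (simp add: divide_le_eq)
  moreover have "side n powr (-1) * F = F / 2 powr n"
    by (simp add: side_def powr_minus divide_inverse)
  ultimately have "side n powr (-1) * F \<le> 2 * poincare_const * 2 powr (\<kappa> * d) * 2 powr \<kappa> * L" by (simp only:)
  moreover have "cube_const 1 \<kappa> = 2 * poincare_const * 2 powr (\<kappa> * d) * 2 powr \<kappa>"
    unfolding cube_const_def d_def using poincare_const_pos by (intro powr_one) simp
  ultimately show ?thesis by (simp only: F_def)
qed

end

section \<open>Test functions\<close>

text \<open>For j = 0 this is the standard flat function; the powers of 1/t are those that
  differentiation produces.\<close>

definition bump :: "nat \<Rightarrow> real \<Rightarrow> real" where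
  "bump j t = (if t \<le> 0 then 0 else exp (- 1 / t) / t ^ j)"

text \<open>From the right, the substitution s = 1/t turns the claim into the decay of s^j exp(-s)
  at infinity.\<close>

lemma bump_tendsto_0: "(bump j \<longlongrightarrow> 0) (at 0)"
proof -
  have "((\<lambda>s::real. s ^ j / exp s) \<longlongrightarrow> 0) at_top" by (rule tendsto_power_div_exp_0)
  then have "((\<lambda>t::real. (inverse t) ^ j / exp (inverse t)) \<longlongrightarrow> 0) (at_right 0)"
    by (rule filterlim_compose[OF _ filterlim_inverse_at_top_right])
  moreover have "\<forall>\<^sub>F t in at_right 0. (inverse t) ^ j / exp (inverse t) = bump j t"
    by (rule eventually_at_right_less[of 0, THEN eventually_mono])
      (auto simp: bump_def exp_minus field_simps)
  ultimately have r: "(bump j \<longlongrightarrow> 0) (at_right 0)" by (rule Lim_transform_eventually)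
  have "\<forall>\<^sub>F t in at_left 0. 0 = bump j t"
    by (auto simp: eventually_at_filter bump_def)
  then have "(bump j \<longlongrightarrow> 0) (at_left 0)"
    by (rule Lim_transform_eventually[OF tendsto_const])
  with r show ?thesis by (simp add: filterlim_split_at)
qed

text \<open>At t = 0 the difference quotient of \<open>bump j\<close> is exactly
  \<open>bump (j + 1)\<close>, so the preceding limit settles the only delicate point.\<close>

lemma bump_deriv: "(bump j has_real_derivative bump (j + 2) t - real j * bump (j + 1) t) (at t)"
proof -
  consider "t < 0" | "t = 0" | "t > 0" by linarith
  then show ?thesis
  proof cases
    case 1
    have "(bump j has_real_derivative 0) (at t)"
    proof (rule has_field_derivative_transform_within[where S = UNIV])
      show "((\<lambda>x. 0) has_real_derivative 0) (at t)" by simp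
      show "0 < - t" using 1 by simp
      show "dist x t < - t \<Longrightarrow> 0 = bump j x" for x by (auto simp: bump_def dist_real_def)
    qed auto
    then show ?thesis using 1 by (simp add: bump_def)
  next
    case 2
    have "\<forall>\<^sub>F h in at 0. bump (j + 1) h = (bump j (0 + h) - bump j 0) / h"
      by (auto simp: eventually_at_filter bump_def)
    then have "((\<lambda>h. (bump j (0 + h) - bump j 0) / h) \<longlongrightarrow> 0) (at 0)"
      by (rule Lim_transform_eventually[OF bump_tendsto_0])
    then have "(bump j has_real_derivative 0) (at 0)" by (simp add: DERIV_def)
    then show ?thesis using 2 by (simp add: bump_def)
  next
    case 3
    show ?thesis
    proof (rule has_field_derivative_transform_within[where S = UNIV])
      have "((\<lambda>x. exp (- 1 / x) / x ^ j) has_real_derivative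
          (exp (- 1 / t) * (1 / t ^ 2) * t ^ j - exp (- 1 / t) * (real j * t ^ (j - 1))) / (t ^ j * t ^ j)) (at t)"
        using 3 by (auto intro!: derivative_eq_intros simp: power2_eq_square)
      also have "(exp (- 1 / t) * (1 / t ^ 2) * t ^ j - exp (- 1 / t) * (real j * t ^ (j - 1))) / (t ^ j * t ^ j)
        = bump (j + 2) t - real j * bump (j + 1) t"
      proof (cases j)
        case 0
        then show ?thesis using 3 by (simp add: bump_def power2_eq_square)
      next
        case (Suc i)
        have "(ex * (1 / t ^ 2) * (t * P) - ex * (J * P)) / ((t * P) * (t * P)) = ex / (P * t * t ^ 2) - J * (ex / (t * P * t))"
          if "P > 0" for ex P J :: real
          using 3 that by (simp add: field_simps power2_eq_square)
        from this[of "t ^ i" "exp (- 1 / t)" "real j"] show ?thesis using 3 Suc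
          by (simp add: bump_def power2_eq_square mult_ac)
      qed
      finally show "((\<lambda>x. exp (- 1 / x) / x ^ j) has_real_derivative bump (j + 2) t - real j * bump (j + 1) t) (at t)" .
      show "0 < t" by fact
      show "dist x t < t \<Longrightarrow> exp (- 1 / x) / x ^ j = bump j x" for x
        by (auto simp: bump_def dist_real_def)
    qed auto
  qed
qed

text \<open>This class contains all partial derivatives of its members, because the derivative of
  \<open>bump j\<close> is a linear combination of \<open>bump (j + 1)\<close> and \<open>bump (j + 2)\<close>.\<close>

inductive bumps :: "real \<Rightarrow> (real^'n \<Rightarrow> real) \<Rightarrow> bool" for r :: real where
  base: "bumps r (\<lambda>x. bump j (r - x \<bullet> x))"
| add: "bumps r \<phi> \<Longrightarrow> bumps r \<psi> \<Longrightarrow> bumps r (\<lambda>x. \<phi> x + \<psi> x)"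
| scale: "bumps r \<phi> \<Longrightarrow> bumps r (\<lambda>x. c * \<phi> x)"
| coord: "bumps r \<phi> \<Longrightarrow> bumps r (\<lambda>x. x $ i * \<phi> x)"

text \<open>Carries the coordinates of the derivative as explicit functions, so that a class can be
  shown closed under differentiation without computing with
  \<open>frechet_derivative\<close>.\<close>

definition has_partials :: "(real^'n \<Rightarrow> real) \<Rightarrow> ('n \<Rightarrow> real^'n \<Rightarrow> real) \<Rightarrow> bool" where
  "has_partials \<phi> \<psi> \<longleftrightarrow> (\<forall>x. (\<phi> has_derivative (\<lambda>h. \<Sum>i\<in>UNIV. h $ i * \<psi> i x)) (at x))"

lemma has_partials_imp_partial:
  assumes "has_partials \<phi> \<psi>"
  shows "partial i \<phi> = \<psi> i"
proof
  fix x
  have "frechet_derivative \<phi> (at x) = (\<lambda>h. \<Sum>i\<in>UNIV. h $ i * \<psi> i x)"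
    using assms by (intro frechet_derivative_at[symmetric]) (auto simp: has_partials_def)
  then show "partial i \<phi> x = \<psi> i x"
    by (simp add: partial_def axis_def if_distrib[of "\<lambda>u. u * _"] sum.delta cong: if_cong)
qed

text \<open>Closure under one differentiation suffices: induction on the list of indices keeps every
  iterated partial derivative in the class, and no formula for it is needed.\<close>

lemma smooth_coinduct:
  assumes "X \<phi>" and step: "\<And>\<phi>. X \<phi> \<Longrightarrow> \<exists>\<psi>. (\<forall>i. X (\<psi> i)) \<and> has_partials \<phi> \<psi>"
  shows "smooth \<phi>"
proof -
  have "X (iter_partial is \<phi>)" for "is"
  proof (induction "is")
    case (Cons i "is")
    then obtain \<psi> where "\<forall>i. X (\<psi> i)" "has_partials (iter_partial is \<phi>) \<psi>" using step by blast
    then show ?case by (simp add: has_partials_imp_partial)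
  qed (simp add: assms)
  then have "\<exists>\<psi>. has_partials (iter_partial is \<phi>) \<psi>" for "is"
    using step by blast
  then show ?thesis unfolding smooth_def has_partials_def differentiable_def
    by fast
qed

lemma bumps_has_partials:
  fixes \<phi> :: "real^'n \<Rightarrow> real"
  shows "bumps r \<phi> \<Longrightarrow> \<exists>\<psi>. (\<forall>i. bumps r (\<psi> i)) \<and> has_partials \<phi> \<psi>"
proof (induction rule: bumps.induct)
  case (base j)
  \<comment> \<open>The inner derivative -2 x_i times the derivative of \<open>bump j\<close>,
    arranged so that only constructors of the class occur.\<close>
  define \<psi> where "\<psi> i x = x $ i * ((-2) * (bump (j + 2) (r - x \<bullet> x) + (- real j) * bump (j + 1) (r - x \<bullet> x)))" for i and x :: "real^'n"
  have "bumps r (\<psi> i)" for i unfolding \<psi>_def by (intro bumps.intros)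
  moreover have "((\<lambda>x. bump j (r - x \<bullet> x)) has_derivative (\<lambda>h. \<Sum>i\<in>UNIV. h $ i * \<psi> i x)) (at x)" for x
  proof -
    have "((\<lambda>x. bump j (r - x \<bullet> x)) has_derivative
        (\<lambda>h. (bump (j + 2) (r - x \<bullet> x) - real j * bump (j + 1) (r - x \<bullet> x)) * (- (x \<bullet> h + h \<bullet> x)))) (at x)"
      by (rule has_derivative_compose[OF _ bump_deriv[unfolded has_field_derivative_def], of "\<lambda>x. r - x \<bullet> x"])
        (auto intro!: derivative_eq_intros)
    moreover have "(bump (j + 2) (r - x \<bullet> x) - real j * bump (j + 1) (r - x \<bullet> x)) * (- (x \<bullet> h + h \<bullet> x)) = (\<Sum>i\<in>UNIV. h $ i * \<psi> i x)" for h
    proof -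
      have "(\<Sum>i\<in>UNIV. h $ i * \<psi> i x) = (\<Sum>i\<in>UNIV. (h $ i * x $ i) * ((-2) * (bump (j + 2) (r - x \<bullet> x) + (- real j) * bump (j + 1) (r - x \<bullet> x))))"
        by (simp add: \<psi>_def mult_ac)
      also have "\<dots> = (h \<bullet> x) * ((-2) * (bump (j + 2) (r - x \<bullet> x) + (- real j) * bump (j + 1) (r - x \<bullet> x)))"
        by (simp add: inner_vec_def sum_distrib_right[symmetric])
      finally show ?thesis by (simp add: inner_commute algebra_simps)
    qed
    ultimately show ?thesis by simp
  qed
  ultimately show ?case unfolding has_partials_def by blast
next
  case (add \<phi>1 \<phi>2)
  then obtain \<psi>1 \<psi>2 where "\<forall>i. bumps r (\<psi>1 i)" "has_partials \<phi>1 \<psi>1" "\<forall>i. bumps r (\<psi>2 i)" "has_partials \<phi>2 \<psi>2"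
    by blast
  then show ?case
    by (intro exI[of _ "\<lambda>i x. \<psi>1 i x + \<psi>2 i x"])
      (auto simp: has_partials_def distrib_left sum.distrib intro!: bumps.add has_derivative_add)
next
  case (scale \<phi> c)
  then obtain \<psi> where \<psi>: "\<forall>i. bumps r (\<psi> i)" "has_partials \<phi> \<psi>" by blast
  have "((\<lambda>x. c * \<phi> x) has_derivative (\<lambda>h. \<Sum>i\<in>UNIV. h $ i * (c * \<psi> i x))) (at x)" for x
  proof -
    have "((\<lambda>x. c * \<phi> x) has_derivative (\<lambda>h. c * (\<Sum>i\<in>UNIV. h $ i * \<psi> i x))) (at x)"
      using \<psi> by (intro has_derivative_mult_right) (auto simp: has_partials_def)
    then show ?thesis by (simp add: sum_distrib_left mult_ac)
  qed
  then show ?case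
    using \<psi> by (intro exI[of _ "\<lambda>i x. c * \<psi> i x"]) (auto simp: has_partials_def intro!: bumps.scale)
next
  case (coord \<phi> k)
  then obtain \<psi> where \<psi>: "\<forall>i. bumps r (\<psi> i)" "has_partials \<phi> \<psi>" by blast
  \<comment> \<open>Product rule: differentiating the coordinate contributes \<phi> in direction k
    only. The Kronecker symbol is written as a scalar so that closure under scaling applies.\<close>
  define \<omega> where "\<omega> i x = x $ k * \<psi> i x + (if i = k then 1 else 0) * \<phi> x" for i x
  have "bumps r (\<omega> i)" for i unfolding \<omega>_def using \<psi> coord by (intro bumps.intros) auto
  moreover have "((\<lambda>x. x $ k * \<phi> x) has_derivative (\<lambda>h. \<Sum>i\<in>UNIV. h $ i * \<omega> i x)) (at x)" for x
  proof -
    have "((\<lambda>x. x $ k * \<phi> x) has_derivative (\<lambda>h. x $ k * (\<Sum>i\<in>UNIV. h $ i * \<psi> i x) + h $ k * \<phi> x)) (at x)"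
      using \<psi> by (intro has_derivative_mult bounded_linear_imp_has_derivative bounded_linear_vec_nth)
         (auto simp: has_partials_def)
    moreover have "(\<Sum>i\<in>UNIV. h $ i * \<omega> i x) = x $ k * (\<Sum>i\<in>UNIV. h $ i * \<psi> i x) + h $ k * \<phi> x" for h
      by (simp add: \<omega>_def distrib_left sum.distrib sum_distrib_left mult_ac if_distrib[of "\<lambda>u. _ * u"] cong: if_cong)
    ultimately show ?thesis by simp
  qed
  ultimately show ?case unfolding has_partials_def by blast
qed

lemma bumps_support: "bumps r \<phi> \<Longrightarrow> r \<le> x \<bullet> x \<Longrightarrow> \<phi> x = 0"
  by (induction rule: bumps.induct) (auto simp: bump_def)

lemma has_partials_continuous: "has_partials \<phi> \<psi> \<Longrightarrow> continuous_on UNIV \<phi>"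
  by (auto simp: has_partials_def intro!: continuous_at_imp_continuous_on has_derivative_continuous)

lemma bumps_continuous: "bumps r \<phi> \<Longrightarrow> continuous_on UNIV \<phi>"
  using bumps_has_partials has_partials_continuous by blast

lemma test_funI:
  assumes "smooth \<phi>" "\<And>x. R < norm x \<Longrightarrow> \<phi> x = 0"
  shows "test_fun \<phi>"
proof -
  have "{x. \<phi> x \<noteq> 0} \<subseteq> cball 0 R" using assms(2) by force
  then have "bounded {x. \<phi> x \<noteq> 0}" using bounded_cball bounded_subset by blast
  then show ?thesis using assms(1) by (simp add: test_fun_def compact_closure)
qed

lemma has_partials_reflect:
  assumes "has_partials \<phi> \<psi>"
  shows "has_partials (\<lambda>y. c * \<phi> (x - y)) (\<lambda>i y. - c * \<psi> i (x - y))"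
  unfolding has_partials_def
proof
  fix y
  have "((\<lambda>y. x - y) has_derivative (\<lambda>h. - h)) (at y)"
    by (auto intro!: derivative_eq_intros)
  from has_derivative_compose[OF this] assms
  have "((\<lambda>y. \<phi> (x - y)) has_derivative (\<lambda>h. \<Sum>i\<in>UNIV. (- h) $ i * \<psi> i (x - y))) (at y)"
    unfolding has_partials_def by blast
  then have "((\<lambda>y. c * \<phi> (x - y)) has_derivative (\<lambda>h. c * (\<Sum>i\<in>UNIV. (- h) $ i * \<psi> i (x - y)))) (at y)"
    by (rule has_derivative_mult_right)
  then show "((\<lambda>y. c * \<phi> (x - y)) has_derivative (\<lambda>h. \<Sum>i\<in>UNIV. h $ i * (- c * \<psi> i (x - y)))) (at y)"
    by (simp add: sum_distrib_left sum_negf mult_ac)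
qed

text \<open>These are the test functions inserted into the definition of the weak gradient.
  Reflection flips the sign with each derivative, hence the scalar in the coinduction class.\<close>

lemma test_fun_reflect:
  assumes "bumps r \<phi>"
  shows "test_fun (\<lambda>y. \<phi> (x - y))"
proof (rule test_funI)
  have "smooth (\<lambda>y. 1 * \<phi> (x - y))"
  proof (rule smooth_coinduct[where X = "\<lambda>\<theta>. \<exists>c \<phi>. bumps r \<phi> \<and> \<theta> = (\<lambda>y. c * \<phi> (x - y))"])
    show "\<exists>c \<phi>'. bumps r \<phi>' \<and> (\<lambda>y. 1 * \<phi> (x - y)) = (\<lambda>y. c * \<phi>' (x - y))" using assms by blast
    fix \<theta> :: "real^'a \<Rightarrow> real" assume "\<exists>c \<phi>. bumps r \<phi> \<and> \<theta> = (\<lambda>y. c * \<phi> (x - y))"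
    then obtain c \<phi> where \<phi>: "bumps r \<phi>" "\<theta> = (\<lambda>y. c * \<phi> (x - y))" by blast
    obtain \<psi> where \<psi>: "\<forall>i. bumps r (\<psi> i)" "has_partials \<phi> \<psi>" using bumps_has_partials[OF \<phi>(1)] by blast
    show "\<exists>\<psi>. (\<forall>i. \<exists>c \<phi>. bumps r \<phi> \<and> \<psi> i = (\<lambda>y. c * \<phi> (x - y))) \<and> has_partials \<theta> \<psi>"
    proof (intro exI conjI allI)
      show "has_partials \<theta> (\<lambda>i y. - c * \<psi> i (x - y))"
        unfolding \<phi>(2) by (rule has_partials_reflect[OF \<psi>(2)])
      show "bumps r (\<psi> i)" for i using \<psi>(1) by blast
    qed (rule refl)
  qed
  then show "smooth (\<lambda>y. \<phi> (x - y))" by simp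
  fix y :: "real^'a" assume "norm x + sqrt \<bar>r\<bar> < norm y"
  then have "sqrt \<bar>r\<bar> \<le> norm (x - y)" using norm_triangle_ineq2[of y x] by (simp add: norm_minus_commute)
  then have "\<bar>r\<bar> \<le> (x - y) \<bullet> (x - y)" by (simp add: norm_eq_sqrt_inner)
  then show "\<phi> (x - y) = 0" by (intro bumps_support[OF assms]) auto
qed

section \<open>Convolution\<close>

text \<open>The counterpart of \<open>loc_integrable\<close> for Borel functions and
  \<open>lborel\<close>, where Fubini's theorem and substitutions are available.\<close>

definition locally_L1 :: "(real^'n \<Rightarrow> real) \<Rightarrow> bool" where
  "locally_L1 h \<longleftrightarrow> h \<in> borel_measurable borel \<and> (\<forall>R. integrable lborel (\<lambda>x. indicator (cball 0 R) x * h x))"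

definition kernel :: "real \<Rightarrow> (real^'n \<Rightarrow> real) \<Rightarrow> bool" where
  "kernel s \<phi> \<longleftrightarrow> continuous_on UNIV \<phi> \<and> (\<forall>z. s \<le> norm z \<longrightarrow> \<phi> z = 0)"

definition conv :: "(real^'n \<Rightarrow> real) \<Rightarrow> (real^'n \<Rightarrow> real) \<Rightarrow> real^'n \<Rightarrow> real" where
  "conv h \<phi> x = (\<integral>y. h y * \<phi> (x - y) \<partial>lborel)"

lemma kernel_measurable: "kernel s \<phi> \<Longrightarrow> \<phi> \<in> borel_measurable borel"
  by (auto simp: kernel_def intro: borel_measurable_continuous_onI)

lemma kernel_bounded:
  assumes "kernel s \<phi>"
  obtains K where "K \<ge> 0" "\<And>z. \<bar>\<phi> z\<bar> \<le> K"
proof -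
  have "compact (\<phi> ` cball 0 s)"
    using assms by (intro compact_continuous_image) (auto simp: kernel_def intro: continuous_on_subset)
  then obtain K where K: "\<forall>y\<in>\<phi> ` cball 0 s. norm y \<le> K" using compact_imp_bounded bounded_iff by metis
  have "\<bar>\<phi> z\<bar> \<le> max K 0" for z
  proof (cases "norm z \<le> s")
    case True
    then have "\<phi> z \<in> \<phi> ` cball 0 s" by simp
    then have "norm (\<phi> z) \<le> K" using K by blast
    then show ?thesis by simp
  next
    case False
    then show ?thesis using assms by (simp add: kernel_def)
  qed
  then show ?thesis using that[of "max K 0"] by simp
qed

lemma bumps_kernel:
  assumes "bumps r \<phi>"
  shows "kernel (sqrt r) \<phi>"
  unfolding kernel_def
proof (intro conjI allI impI)
  show "continuous_on UNIV \<phi>" by (rule bumps_continuous[OF assms])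
  fix z :: "real^'a" assume z: "sqrt r \<le> norm z"
  have "r \<le> z \<bullet> z"
    using z by (simp add: norm_eq_sqrt_inner)
  then show "\<phi> z = 0" by (rule bumps_support[OF assms])
qed

lemma locally_L1_bound_integrable:
  assumes h: "locally_L1 h" and [measurable]: "\<phi> \<in> borel_measurable borel"
    and b: "\<And>y. \<bar>\<phi> y\<bar> \<le> K * indicator (cball 0 R) y"
  shows "integrable lborel (\<lambda>y. h y * \<phi> y)"
proof (rule Bochner_Integration.integrable_bound)
  have [measurable]: "h \<in> borel_measurable borel" using h by (simp add: locally_L1_def)
  show "integrable lborel (\<lambda>y. K * (indicator (cball 0 R) y * h y))"
    using h by (intro integrable_mult_right) (auto simp: locally_L1_def)
  show "(\<lambda>y. h y * \<phi> y) \<in> borel_measurable lborel" by measurable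
  have "norm (h y * \<phi> y) \<le> norm (K * (indicator (cball 0 R) y * h y))" for y
  proof -
    have "\<bar>h y\<bar> * \<bar>\<phi> y\<bar> \<le> \<bar>h y\<bar> * (K * indicator (cball 0 R) y)" by (intro mult_left_mono b) auto
    also have "\<dots> \<le> \<bar>h y\<bar> * (\<bar>K\<bar> * indicator (cball 0 R) y)" by (intro mult_left_mono mult_right_mono) auto
    finally show ?thesis by (simp add: abs_mult mult_ac)
  qed
  then show "AE y in lborel. norm (h y * \<phi> y) \<le> norm (K * (indicator (cball 0 R) y * h y))" by simp
qed

lemma kernel_shift_bound:
  assumes "kernel s \<phi>" "\<And>z. \<bar>\<phi> z\<bar> \<le> K"
  shows "\<bar>\<phi> (x - y)\<bar> \<le> K * indicator (cball 0 (norm x + s)) y"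
proof (cases "norm y \<le> norm x + s")
  case True
  then show ?thesis using assms by simp
next
  case False
  then have "s \<le> norm (x - y)" using norm_triangle_ineq2[of y x] by (simp add: norm_minus_commute)
  then show ?thesis using assms(1) False by (simp add: kernel_def)
qed

lemma conv_integrable:
  assumes "locally_L1 h" "kernel s \<phi>"
  shows "integrable lborel (\<lambda>y. h y * \<phi> (x - y))"
proof -
  obtain K where "\<And>z. \<bar>\<phi> z\<bar> \<le> K" using kernel_bounded[OF assms(2)] by metis
  note kernel_shift_bound[OF assms(2) this]
  moreover have "(\<lambda>y. \<phi> (x - y)) \<in> borel_measurable borel"
    using kernel_measurable[OF assms(2)] by measurable
  ultimately show ?thesis using assms(1) by (intro locally_L1_bound_integrable) auto
qed

lemma lborel_distr_reflect: "distr lborel borel (\<lambda>z. x - z) = (lborel :: 'a::euclidean_space measure)"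
  using lborel_affine[of "-1" x, symmetric]
  by (simp add: density_1 one_ennreal_def[symmetric])

lemma conv_reflect:
  assumes [measurable]: "h \<in> borel_measurable borel" "\<phi> \<in> borel_measurable borel"
  shows "conv h \<phi> x = (\<integral>z. h (x - z) * \<phi> z \<partial>lborel)"
proof -
  have "conv h \<phi> x = (\<integral>y. h y * \<phi> (x - y) \<partial>distr lborel borel (\<lambda>z. x - z))"
    by (simp add: conv_def lborel_distr_reflect)
  also have "\<dots> = (\<integral>z. h (x - z) * \<phi> z \<partial>lborel)"
    by (subst integral_distr) auto
  finally show ?thesis .
qed

lemma nn_integral_reflect:
  fixes G :: "'a::euclidean_space \<Rightarrow> ennreal"
  assumes [measurable]: "G \<in> borel_measurable borel"
  shows "(\<integral>\<^sup>+z. G (x - z) \<partial>lborel) = (\<integral>\<^sup>+z. G z \<partial>lborel)"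
proof -
  have "(\<integral>\<^sup>+z. G z \<partial>lborel) = (\<integral>\<^sup>+z. G z \<partial>distr lborel borel (\<lambda>z. x - z))"
    by (simp add: lborel_distr_reflect)
  also have "\<dots> = (\<integral>\<^sup>+z. G (x - z) \<partial>lborel)" by (subst nn_integral_distr) auto
  finally show ?thesis by simp
qed

lemma sum_nth_mult_le:
  fixes v :: "real^'n"
  assumes "\<And>i. \<bar>a i\<bar> \<le> K i"
  shows "\<bar>\<Sum>i\<in>UNIV. v $ i * a i\<bar> \<le> norm v * (\<Sum>i\<in>UNIV. K i)"
proof -
  have "\<bar>\<Sum>i\<in>UNIV. v $ i * a i\<bar> \<le> (\<Sum>i\<in>UNIV. \<bar>v $ i * a i\<bar>)" by (rule sum_abs)
  also have "\<dots> \<le> (\<Sum>i\<in>UNIV. norm v * K i)"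
    using assms component_le_norm_cart by (intro sum_mono) (auto simp: abs_mult intro!: mult_mono)
  finally show ?thesis by (simp add: sum_distrib_left)
qed

text \<open>Differentiation under the integral sign. For |w - x| < 1 the first-order remainder
  \<open>q\<close> of the kernel lives on a fixed ball and is at most 2L|w - x|, with L a Lipschitz
  constant of the kernel. Divided by |w - x| it tends to 0 pointwise and, multiplied by h, is
  dominated by a multiple of |h| on that ball.\<close>

lemma conv_has_partials:
  assumes h: "locally_L1 h" and \<phi>: "kernel s \<phi>" and \<psi>: "\<And>i. kernel s (\<psi> i)" and d: "has_partials \<phi> \<psi>"
  shows "has_partials (conv h \<phi>) (\<lambda>i. conv h (\<psi> i))"
  unfolding has_partials_def
proof
  fix x
  have [measurable]: "h \<in> borel_measurable borel" using h by (simp add: locally_L1_def)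
  note [measurable] = kernel_measurable[OF \<phi>] kernel_measurable[OF \<psi>]
  have "\<exists>K. K \<ge> 0 \<and> (\<forall>z. \<bar>\<psi> i z\<bar> \<le> K)" for i using kernel_bounded[OF \<psi>] by metis
  then obtain K where K: "\<And>i. K i \<ge> 0" "\<And>i z. \<bar>\<psi> i z\<bar> \<le> K i" by metis
  define L where "L = (\<Sum>i\<in>UNIV. K i)"
  have L0: "L \<ge> 0" unfolding L_def using K by (intro sum_nonneg) auto
  have lin: "\<bar>\<Sum>i\<in>UNIV. v $ i * \<psi> i z\<bar> \<le> norm v * L" for v z
    unfolding L_def by (rule sum_nth_mult_le) (rule K)
  have lip: "\<bar>\<phi> a - \<phi> b\<bar> \<le> L * norm (a - b)" for a b
  proof -
    have "norm (\<phi> a - \<phi> b) \<le> L * norm (a - b)"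
    proof (rule differentiable_bound[where S = UNIV])
      show "(\<phi> has_derivative (\<lambda>h. \<Sum>i\<in>UNIV. h $ i * \<psi> i z)) (at z within UNIV)" for z
        using d by (simp add: has_partials_def)
      show "onorm (\<lambda>h. \<Sum>i\<in>UNIV. h $ i * \<psi> i z) \<le> L" for z
        using lin by (intro onorm_le) (auto simp: mult.commute)
    qed auto
    then show ?thesis by simp
  qed
  define q where "q w y = \<phi> (w - y) - \<phi> (x - y) - (\<Sum>i\<in>UNIV. (w - x) $ i * \<psi> i (x - y))" for w y
  define R where "R = norm x + 1 + s"
  have q_bound: "\<bar>q w y\<bar> \<le> 2 * L * norm (w - x) * indicator (cball 0 R) y" if w: "w \<in> ball x 1" for w y
  proof (cases "y \<in> cball 0 R")
    case True
    have "\<bar>q w y\<bar> \<le> \<bar>\<phi> (w - y) - \<phi> (x - y)\<bar> + \<bar>\<Sum>i\<in>UNIV. (w - x) $ i * \<psi> i (x - y)\<bar>"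
      unfolding q_def by linarith
    also have "\<dots> \<le> L * norm (w - x) + norm (w - x) * L"
      using lip[of "w - y" "x - y"] by (intro add_mono lin) simp
    finally show ?thesis using True by (simp add: algebra_simps)
  next
    case False
    then have y: "norm x + 1 + s < norm y" by (simp add: R_def)
    have "norm w \<le> norm x + 1" using w norm_triangle_ineq2[of w x] by (auto simp: dist_norm norm_minus_commute)
    then have "s \<le> norm (w - y)" "s \<le> norm (x - y)"
      using y norm_triangle_ineq2[of y w] norm_triangle_ineq2[of y x] by (auto simp: norm_minus_commute)
    then have "q w y = 0" using \<phi> \<psi> by (simp add: q_def kernel_def)
    then show ?thesis using L0 by simp
  qed
  have q_lim: "((\<lambda>w. q w y / norm (w - x)) \<longlongrightarrow> 0) (at x)" for y
  proof -
    have "((\<lambda>w. w - y) has_derivative (\<lambda>h. h)) (at x)" by (auto intro!: derivative_eq_intros)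
    from has_derivative_compose[OF this] d
    have "((\<lambda>w. \<phi> (w - y)) has_derivative (\<lambda>h. \<Sum>i\<in>UNIV. h $ i * \<psi> i (x - y))) (at x)"
      unfolding has_partials_def by blast
    then have "((\<lambda>w. norm (q w y) / norm (w - x)) \<longlongrightarrow> 0) (at x)"
      unfolding has_derivative_iff_norm q_def by blast
    then have "((\<lambda>w. \<bar>q w y / norm (w - x)\<bar>) \<longlongrightarrow> 0) (at x)" by simp
    then show ?thesis by (rule tendsto_rabs_zero_cancel)
  qed
  have lim: "((\<lambda>w. \<integral>y. h y * (q w y / norm (w - x)) \<partial>lborel) \<longlongrightarrow> 0) (at x within ball x 1)"
    unfolding tendsto_at_iff_sequentially o_def
  proof (intro allI impI)
    fix X assume X: "\<forall>i. X i \<in> ball x 1 - {x}" "X \<longlonglongrightarrow> x"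
    have "(\<lambda>n. \<integral>y. h y * (q (X n) y / norm (X n - x)) \<partial>lborel) \<longlonglongrightarrow> (\<integral>y. 0 \<partial>(lborel :: (real^'a) measure))"
    proof (rule integral_dominated_convergence)
      show "integrable lborel (\<lambda>y. \<bar>h y * (2 * L * indicator (cball 0 R) y)\<bar>)"
        using L0 by (intro integrable_abs locally_L1_bound_integrable[OF h, where K = "2 * L" and R = R]) auto
      show "(\<lambda>y. h y * (q (X n) y / norm (X n - x))) \<in> borel_measurable lborel" for n
        unfolding q_def by measurable
      have "(\<lambda>n. h y * (q (X n) y / norm (X n - x))) \<longlonglongrightarrow> h y * 0" for y
        using q_lim[of y, unfolded tendsto_at_iff_sequentially o_def] X by (intro tendsto_mult tendsto_const) auto
      then show "AE y in lborel. (\<lambda>n. h y * (q (X n) y / norm (X n - x))) \<longlonglongrightarrow> 0" by simp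
      show "AE y in lborel. norm (h y * (q (X n) y / norm (X n - x))) \<le> \<bar>h y * (2 * L * indicator (cball 0 R) y)\<bar>" for n
      proof (rule AE_I2)
        fix y
        have Xn: "X n \<in> ball x 1" "norm (X n - x) > 0" using X(1) by auto
        have "\<bar>q (X n) y\<bar> / norm (X n - x) \<le> 2 * L * indicator (cball 0 R) y"
          using q_bound[OF Xn(1), of y] Xn(2) by (simp add: divide_le_eq mult_ac)
        then have "\<bar>h y\<bar> * (\<bar>q (X n) y\<bar> / norm (X n - x)) \<le> \<bar>h y\<bar> * (2 * L * indicator (cball 0 R) y)"
          by (rule mult_left_mono) simp
        then show "norm (h y * (q (X n) y / norm (X n - x))) \<le> \<bar>h y * (2 * L * indicator (cball 0 R) y)\<bar>"
          using L0 by (simp add: abs_mult)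
      qed
    qed measurable
    then show "(\<lambda>n. \<integral>y. h y * (q (X n) y / norm (X n - x)) \<partial>lborel) \<longlonglongrightarrow> 0" by simp
  qed
  have int_q: "(\<integral>y. h y * (q w y / norm (w - x)) \<partial>lborel) =
      (conv h \<phi> w - conv h \<phi> x - (\<Sum>i\<in>UNIV. (w - x) $ i * conv h (\<psi> i) x)) / norm (w - x)" for w
  proof -
    have "(\<integral>y. h y * (q w y / norm (w - x)) \<partial>lborel) = (\<integral>y. (h y * \<phi> (w - y) - h y * \<phi> (x - y)
        - (\<Sum>i\<in>UNIV. (w - x) $ i * (h y * \<psi> i (x - y)))) / norm (w - x) \<partial>lborel)"
      by (rule Bochner_Integration.integral_cong[OF refl])
        (simp add: q_def right_diff_distrib sum_distrib_left mult_ac)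
    also have "\<dots> = ((\<integral>y. h y * \<phi> (w - y) \<partial>lborel) - (\<integral>y. h y * \<phi> (x - y) \<partial>lborel)
        - (\<Sum>i\<in>UNIV. (w - x) $ i * (\<integral>y. h y * \<psi> i (x - y) \<partial>lborel))) / norm (w - x)"
      using conv_integrable[OF h \<phi>] conv_integrable[OF h \<psi>] by simp
    finally show ?thesis by (simp add: conv_def)
  qed
  have "((\<lambda>w. norm (conv h \<phi> w - conv h \<phi> x - (\<Sum>i\<in>UNIV. (w - x) $ i * conv h (\<psi> i) x)) / norm (w - x)) \<longlongrightarrow> 0) (at x)"
    using tendsto_rabs_zero[OF lim[unfolded int_q]] at_within_open[of x "ball x 1"] by simp
  moreover have "bounded_linear (\<lambda>v::real^'a. \<Sum>i\<in>UNIV. v $ i * conv h (\<psi> i) x)"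
    by (intro bounded_linear_sum bounded_linear_mult_const bounded_linear_vec_nth)
  ultimately show "(conv h \<phi> has_derivative (\<lambda>v. \<Sum>i\<in>UNIV. v $ i * conv h (\<psi> i) x)) (at x)"
    unfolding has_derivative_iff_norm by blast
qed

section \<open>Continuity of translations in the mean\<close>

text \<open>The modulus of continuity in L1, taken as an extended value so that no integrability has
  to be established beforehand.\<close>

definition shift_diff :: "('a::euclidean_space \<Rightarrow> real) \<Rightarrow> 'a \<Rightarrow> ennreal" where
  "shift_diff h z = (\<integral>\<^sup>+x. ennreal \<bar>h (x - z) - h x\<bar> \<partial>lborel)"

lemma nn_integral_translate:
  fixes G :: "'a::euclidean_space \<Rightarrow> ennreal"
  assumes "G \<in> borel_measurable borel"
  shows "(\<integral>\<^sup>+x. G (x - z) \<partial>lborel) = (\<integral>\<^sup>+x. G x \<partial>lborel)"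
  using nn_integral_lborel_affine[OF assms, of 1 "- z"] by simp

text \<open>For open \<open>U\<close> the mass that leaves \<open>U\<close> under a shift tends to zero by dominated
  convergence, and the mass that enters is the one that leaves under the opposite shift.\<close>

lemma shift_diff_open:
  fixes X :: "nat \<Rightarrow> 'a::euclidean_space"
  assumes U: "open U" "emeasure lborel U < \<infinity>" and X: "X \<longlonglongrightarrow> 0"
  shows "(\<lambda>n. shift_diff (indicator U) (X n)) \<longlonglongrightarrow> 0"
proof -
  have [measurable]: "U \<in> sets borel" using U by (rule_tac borel_open)
  define g where "g z x = (indicator U x - indicator U x * indicator U (x - z) :: real)" for z x
  have gm [measurable]: "g z \<in> borel_measurable borel" for z unfolding g_def by measurable
  have lim: "(\<lambda>n. \<integral>\<^sup>+x. ennreal (g (Y n) x) \<partial>lborel) \<longlonglongrightarrow> 0" if Y: "Y \<longlonglongrightarrow> 0" for Y :: "nat \<Rightarrow> 'a"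
  proof -
    have "(\<lambda>n. \<integral>\<^sup>+x. ennreal (g (Y n) x) \<partial>lborel) \<longlonglongrightarrow> (\<integral>\<^sup>+x. 0 \<partial>(lborel :: 'a measure))"
    proof (rule nn_integral_dominated_convergence[where w = "indicator U"])
      show "AE x in lborel. (\<lambda>n. ennreal (g (Y n) x)) \<longlonglongrightarrow> 0"
      proof (rule AE_I2)
        fix x
        have "\<forall>\<^sub>F n in sequentially. g (Y n) x = 0"
        proof (cases "x \<in> U")
          case True
          have "(\<lambda>n. x - Y n) \<longlonglongrightarrow> x - 0" using Y by (intro tendsto_intros)
          then have "\<forall>\<^sub>F n in sequentially. x - Y n \<in> U"
            using U(1) True by (auto dest: topological_tendstoD)
          then show ?thesis by eventually_elim (use True in \<open>simp add: g_def\<close>)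
        qed (simp add: g_def)
        then have "\<forall>\<^sub>F n in sequentially. ennreal (g (Y n) x) = 0" by eventually_elim simp
        then show "(\<lambda>n. ennreal (g (Y n) x)) \<longlonglongrightarrow> 0" by (simp add: tendsto_eventually)
      qed
      show "(\<integral>\<^sup>+x. indicator U x \<partial>lborel) < \<infinity>" using U by simp
      show "AE x in lborel. ennreal (g (Y n) x) \<le> indicator U x" for n
        by (intro AE_I2) (auto simp: g_def split: split_indicator)
    qed auto
    then show ?thesis by simp
  qed
  have eq: "shift_diff (indicator U) z = (\<integral>\<^sup>+x. ennreal (g z x) \<partial>lborel) + (\<integral>\<^sup>+x. ennreal (g (- z) x) \<partial>lborel)" for z
  proof -
    have "shift_diff (indicator U) z = (\<integral>\<^sup>+x. ennreal (g z x) + ennreal (g (- z) (x - z)) \<partial>lborel)"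
      unfolding shift_diff_def by (intro nn_integral_cong) (auto simp: g_def split: split_indicator)
    also have "\<dots> = (\<integral>\<^sup>+x. ennreal (g z x) \<partial>lborel) + (\<integral>\<^sup>+x. ennreal (g (- z) (x - z)) \<partial>lborel)"
      by (intro nn_integral_add) measurable
    also have "(\<integral>\<^sup>+x. ennreal (g (- z) (x - z)) \<partial>lborel) = (\<integral>\<^sup>+x. ennreal (g (- z) x) \<partial>lborel)"
      by (rule nn_integral_translate[of "\<lambda>x. ennreal (g (- z) x)"]) measurable
    finally show ?thesis .
  qed
  have "(\<lambda>n. - X n) \<longlonglongrightarrow> 0" using tendsto_minus[OF X] by simp
  from tendsto_add[OF lim[OF X] lim[OF this]] show ?thesis by (simp add: eq)
qed

lemma shift_diff_add:
  assumes [measurable]: "f \<in> borel_measurable borel" "g \<in> borel_measurable borel"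
  shows "shift_diff (\<lambda>x. f x + g x) z \<le> shift_diff f z + shift_diff g z"
proof -
  have "shift_diff (\<lambda>x. f x + g x) z \<le> (\<integral>\<^sup>+x. ennreal \<bar>f (x - z) - f x\<bar> + ennreal \<bar>g (x - z) - g x\<bar> \<partial>lborel)"
    unfolding shift_diff_def
    by (intro nn_integral_mono) (auto simp: ennreal_plus[symmetric] simp del: ennreal_plus intro!: ennreal_leI)
  also have "\<dots> = shift_diff f z + shift_diff g z"
    unfolding shift_diff_def by (intro nn_integral_add) measurable
  finally show ?thesis .
qed

lemma shift_diff_approx:
  assumes [measurable]: "f \<in> borel_measurable borel" "g \<in> borel_measurable borel"
  shows "shift_diff f z \<le> shift_diff g z + 2 * (\<integral>\<^sup>+x. ennreal \<bar>f x - g x\<bar> \<partial>lborel)"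
proof -
  let ?d = "\<lambda>x. f x - g x"
  have "shift_diff f z = shift_diff (\<lambda>x. g x + ?d x) z" by simp
  also have "\<dots> \<le> shift_diff g z + shift_diff ?d z" by (rule shift_diff_add) measurable
  also have "shift_diff ?d z \<le> (\<integral>\<^sup>+x. ennreal \<bar>?d (x - z)\<bar> + ennreal \<bar>?d x\<bar> \<partial>lborel)"
    unfolding shift_diff_def
    by (intro nn_integral_mono) (auto simp: ennreal_plus[symmetric] simp del: ennreal_plus intro!: ennreal_leI)
  also have "\<dots> = (\<integral>\<^sup>+x. ennreal \<bar>?d (x - z)\<bar> \<partial>lborel) + (\<integral>\<^sup>+x. ennreal \<bar>?d x\<bar> \<partial>lborel)"
    by (intro nn_integral_add) measurable
  also have "(\<integral>\<^sup>+x. ennreal \<bar>?d (x - z)\<bar> \<partial>lborel) = (\<integral>\<^sup>+x. ennreal \<bar>?d x\<bar> \<partial>lborel)"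
    by (rule nn_integral_translate[of "\<lambda>x. ennreal \<bar>?d x\<bar>"]) measurable
  finally show ?thesis by (simp add: mult_2 add_left_mono)
qed

text \<open>The approximation error enters twice, once shifted and once not. Hence the choice r/4,
  which leaves r/2 for the modulus of the approximant.\<close>

lemma shift_diff_limit:
  fixes X :: "nat \<Rightarrow> 'a::euclidean_space"
  assumes [measurable]: "f \<in> borel_measurable borel"
    and approx: "\<And>e::real. e > 0 \<Longrightarrow> \<exists>g\<in>borel_measurable borel. (\<lambda>n. shift_diff g (X n)) \<longlonglongrightarrow> 0 \<and>
       (\<integral>\<^sup>+x. ennreal \<bar>f x - g x\<bar> \<partial>lborel) \<le> ennreal e"
  shows "(\<lambda>n. shift_diff f (X n)) \<longlonglongrightarrow> 0"
proof (rule tendsto_zero_ennreal)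
  fix r :: real assume r: "r > 0"
  obtain g where g[measurable]: "g \<in> borel_measurable borel" and lim: "(\<lambda>n. shift_diff g (X n)) \<longlonglongrightarrow> 0"
    and d: "(\<integral>\<^sup>+x. ennreal \<bar>f x - g x\<bar> \<partial>lborel) \<le> ennreal (r / 4)"
    using approx[of "r / 4"] r by auto
  have "\<forall>\<^sub>F n in sequentially. shift_diff g (X n) < ennreal (r / 2)"
    using order_tendstoD(2)[OF lim, of "ennreal (r / 2)"] r by simp
  then show "\<forall>\<^sub>F n in sequentially. shift_diff f (X n) < ennreal r"
  proof eventually_elim
    case (elim n)
    have "shift_diff f (X n) \<le> shift_diff g (X n) + 2 * (\<integral>\<^sup>+x. ennreal \<bar>f x - g x\<bar> \<partial>lborel)"
      by (rule shift_diff_approx) measurable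
    also have "\<dots> \<le> shift_diff g (X n) + ennreal (r / 2)"
    proof (rule add_left_mono)
      have "2 * (\<integral>\<^sup>+x. ennreal \<bar>f x - g x\<bar> \<partial>lborel) \<le> 2 * ennreal (r / 4)"
        by (rule mult_left_mono[OF d]) simp
      also have "\<dots> = ennreal (r / 2)"
        using r by (simp add: ennreal_mult[symmetric] flip: ennreal_numeral)
      finally show "2 * (\<integral>\<^sup>+x. ennreal \<bar>f x - g x\<bar> \<partial>lborel) \<le> ennreal (r / 2)" .
    qed
    also have "\<dots> < ennreal (r / 2) + ennreal (r / 2)"
      using elim by (simp add: ennreal_add_left_cancel_less add.commute)
    also have "\<dots> = ennreal r" using r by (simp add: ennreal_plus[symmetric] del: ennreal_plus)
    finally show ?case .
  qed
qed

text \<open>Outer regularity approximates an indicator by that of an open set of finite measure; the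
  general case follows through sums and dominated limits.\<close>

lemma shift_diff_tendsto_0:
  fixes h :: "'a::euclidean_space \<Rightarrow> real"
  assumes "integrable lborel h" and X: "X \<longlonglongrightarrow> 0"
  shows "(\<lambda>n. shift_diff h (X n)) \<longlonglongrightarrow> 0"
  using assms(1)
proof (induction rule: integrable_induct)
  case (base A c)
  then have A[measurable]: "A \<in> sets borel" by simp
  have ind: "(\<lambda>n. shift_diff (indicator A) (X n)) \<longlonglongrightarrow> 0"
  proof (rule shift_diff_limit)
    fix e :: real assume e: "e > 0"
    obtain U where U: "open U" "A \<subseteq> U" "emeasure lborel (U - A) < ennreal e"
      using outer_regular_lborel[OF A e] by blast
    have [measurable]: "U \<in> sets borel" using U by (rule_tac borel_open)
    have "emeasure lborel U = emeasure lborel A + emeasure lborel (U - A)"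
      using U(2) by (subst plus_emeasure) (auto simp: Un_absorb1)
    then have fin: "emeasure lborel U < \<infinity>"
      using base(2) U(3) order_less_trans[OF U(3) ennreal_less_top] by simp
    have "(\<integral>\<^sup>+x. ennreal \<bar>indicator A x - indicator U x\<bar> \<partial>lborel) = (\<integral>\<^sup>+x. indicator (U - A) x \<partial>lborel)"
      using U(2) by (intro nn_integral_cong) (auto split: split_indicator)
    also have "\<dots> \<le> ennreal e" using U(3) by simp
    finally show "\<exists>g\<in>borel_measurable borel. (\<lambda>n. shift_diff g (X n)) \<longlonglongrightarrow> 0 \<and>
       (\<integral>\<^sup>+x. ennreal \<bar>indicator A x - g x\<bar> \<partial>lborel) \<le> ennreal e"
      using shift_diff_open[OF U(1) fin X] by (intro bexI[of _ "indicator U"]) auto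
  qed measurable
  have "shift_diff (\<lambda>x. indicator A x *\<^sub>R c) z = ennreal \<bar>c\<bar> * shift_diff (indicator A) z" for z
  proof -
    have "shift_diff (\<lambda>x. indicator A x *\<^sub>R c) z = (\<integral>\<^sup>+x. ennreal \<bar>c\<bar> * ennreal \<bar>indicator A (x - z) - indicator A x\<bar> \<partial>lborel)"
      unfolding shift_diff_def
      by (intro nn_integral_cong) (auto simp: ennreal_mult[symmetric] abs_mult[symmetric] algebra_simps)
    also have "\<dots> = ennreal \<bar>c\<bar> * shift_diff (indicator A) z"
      unfolding shift_diff_def by (rule nn_integral_cmult) measurable
    finally show ?thesis .
  qed
  moreover have "(\<lambda>n. ennreal \<bar>c\<bar> * shift_diff (indicator A) (X n)) \<longlonglongrightarrow> ennreal \<bar>c\<bar> * 0"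
    by (intro ennreal_tendsto_cmult ind) simp
  ultimately show ?case by simp
next
  case (add f g)
  have m: "f \<in> borel_measurable borel" "g \<in> borel_measurable borel"
    using add(1,2) by (auto dest: borel_measurable_integrable)
  show ?case
  proof (rule tendsto_sandwich[where f = "\<lambda>_. 0"])
    show "(\<lambda>n. shift_diff f (X n) + shift_diff g (X n)) \<longlonglongrightarrow> 0"
      using tendsto_add[OF add(3,4)] by simp
    show "\<forall>\<^sub>F n in sequentially. shift_diff (\<lambda>x. f x + g x) (X n) \<le> shift_diff f (X n) + shift_diff g (X n)"
      using shift_diff_add[OF m] by simp
    show "\<forall>\<^sub>F n in sequentially. 0 \<le> shift_diff (\<lambda>x. f x + g x) (X n)" by simp
  qed simp
next
  case (lim f s)
  have [measurable]: "f \<in> borel_measurable borel" "s i \<in> borel_measurable borel" for i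
    using lim by (auto dest: borel_measurable_integrable)
  have "(\<lambda>i. \<integral>\<^sup>+x. ennreal \<bar>f x - s i x\<bar> \<partial>lborel) \<longlonglongrightarrow> (\<integral>\<^sup>+x. 0 \<partial>(lborel :: 'a measure))"
  proof (rule nn_integral_dominated_convergence[where w = "\<lambda>x. ennreal (3 * \<bar>f x\<bar>)"])
    show "AE x in lborel. ennreal \<bar>f x - s i x\<bar> \<le> ennreal (3 * \<bar>f x\<bar>)" for i
    proof (intro AE_I2 ennreal_leI)
      fix x
      have "norm (s i x) \<le> 2 * norm (f x)" using lim by simp
      then show "\<bar>f x - s i x\<bar> \<le> 3 * \<bar>f x\<bar>" by simp
    qed
    have "integrable lborel (\<lambda>x. 3 * \<bar>f x\<bar>)" using lim by auto
    then show "(\<integral>\<^sup>+x. ennreal (3 * \<bar>f x\<bar>) \<partial>lborel) < \<infinity>"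
      by (subst nn_integral_eq_integral) auto
    show "AE x in lborel. (\<lambda>i. ennreal \<bar>f x - s i x\<bar>) \<longlonglongrightarrow> 0"
    proof (rule AE_I2)
      fix x
      have "(\<lambda>i. s i x) \<longlonglongrightarrow> f x" using lim by simp
      then have "(\<lambda>i. \<bar>f x - s i x\<bar>) \<longlonglongrightarrow> \<bar>f x - f x\<bar>" by (intro tendsto_intros)
      then show "(\<lambda>i. ennreal \<bar>f x - s i x\<bar>) \<longlonglongrightarrow> 0"
        using tendsto_ennrealI by fastforce
    qed
  qed auto
  then have conv: "(\<lambda>i. \<integral>\<^sup>+x. ennreal \<bar>f x - s i x\<bar> \<partial>lborel) \<longlonglongrightarrow> 0" by simp
  show ?case
  proof (rule shift_diff_limit)
    fix e :: real assume "e > 0"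
    then have "\<forall>\<^sub>F i in sequentially. (\<integral>\<^sup>+x. ennreal \<bar>f x - s i x\<bar> \<partial>lborel) < ennreal e"
      using order_tendstoD(2)[OF conv] by simp
    then obtain i where "(\<integral>\<^sup>+x. ennreal \<bar>f x - s i x\<bar> \<partial>lborel) < ennreal e"
      unfolding eventually_sequentially by blast
    then show "\<exists>g\<in>borel_measurable borel. (\<lambda>n. shift_diff g (X n)) \<longlonglongrightarrow> 0 \<and>
       (\<integral>\<^sup>+x. ennreal \<bar>f x - g x\<bar> \<partial>lborel) \<le> ennreal e"
      using lim by (intro bexI[of _ "s i"]) auto
  qed measurable
qed

lemma shift_diff_uniform:
  fixes h :: "'a::euclidean_space \<Rightarrow> real"
  assumes "integrable lborel h" "e > 0"
  obtains d where "d > 0" "\<And>z. norm z \<le> d \<Longrightarrow> shift_diff h z \<le> ennreal e"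
proof (rule ccontr)
  assume "\<not> thesis"
  then have "\<exists>z. norm z \<le> 1 / real (Suc n) \<and> \<not> shift_diff h z \<le> ennreal e" for n
    using that[of "1 / real (Suc n)"] by auto
  then obtain X where X: "\<And>n. norm (X n) \<le> 1 / real (Suc n)" "\<And>n. \<not> shift_diff h (X n) \<le> ennreal e"
    by metis
  have X0: "X \<longlonglongrightarrow> 0"
    by (rule Lim_null_comparison[OF _ LIMSEQ_Suc[OF lim_1_over_n]]) (use X(1) in auto)
  have "\<forall>\<^sub>F n in sequentially. shift_diff h (X n) < ennreal e"
    using order_tendstoD(2)[OF shift_diff_tendsto_0[OF assms(1) X0], of "ennreal e"] assms(2) by simp
  then obtain n where "shift_diff h (X n) < ennreal e" unfolding eventually_sequentially by blast
  then show False using X(2)[of n] by simp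
qed

section \<open>Mollification\<close>

lemma locally_L1_const: "locally_L1 (\<lambda>_. c)"
  unfolding locally_L1_def
  using emeasure_bounded_finite[OF bounded_cball] by (auto intro!: integrable_mult_left integrable_real_indicator)

lemma kernel_bound:
  assumes "kernel s \<phi>" "\<And>z. \<bar>\<phi> z\<bar> \<le> K"
  shows "\<bar>\<phi> y\<bar> \<le> K * indicator (cball 0 s) y"
  using assms by (cases "norm y \<le> s") (auto simp: kernel_def)

lemma kernel_integrable:
  assumes "kernel s \<phi>"
  shows "integrable lborel \<phi>"
proof -
  obtain K where "\<And>z. \<bar>\<phi> z\<bar> \<le> K" using kernel_bounded[OF assms] by metis
  from kernel_bound[OF assms this]
  have "integrable lborel (\<lambda>y. 1 * \<phi> y)"
    using kernel_measurable[OF assms] by (intro locally_L1_bound_integrable[OF locally_L1_const]) auto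
  then show ?thesis by simp
qed

text \<open>\<open>r\<close> is the square of the radius of the support. For r \<le> 0 the numerator
  vanishes identically and so does the quotient, so only the normalisation calls for r > 0.\<close>

definition mol :: "real \<Rightarrow> real^'n \<Rightarrow> real" where
  "mol r z = bump 0 (r - z \<bullet> z) / (\<integral>y. bump 0 (r - y \<bullet> y) \<partial>(lborel :: (real^'n) measure))"

lemma bump_nonneg: "0 \<le> bump j t"
  by (simp add: bump_def)

lemma mol_nonneg: "0 \<le> mol r z"
  unfolding mol_def by (intro divide_nonneg_nonneg integral_nonneg_AE AE_I2 bump_nonneg)

lemma mol_bumps: "bumps r (mol r :: real^'n \<Rightarrow> real)"
proof -
  have eq: "(mol r :: real^'n \<Rightarrow> real) = (\<lambda>z. (1 / (\<integral>y. bump 0 (r - y \<bullet> y) \<partial>(lborel :: (real^'n) measure))) * bump 0 (r - z \<bullet> z))"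
    by (simp add: mol_def fun_eq_iff)
  show ?thesis unfolding eq by (rule bumps.scale[OF bumps.base])
qed

lemma mol_kernel: "kernel (sqrt r) (mol r)"
  by (rule bumps_kernel[OF mol_bumps])

lemma mol_zero: "sqrt r \<le> norm z \<Longrightarrow> mol r z = 0"
  using mol_kernel unfolding kernel_def by blast

lemma borel_mol [measurable]: "mol r \<in> borel_measurable borel"
  by (rule kernel_measurable[OF mol_kernel])

text \<open>Were the normalising integral 0, the nonnegative bump would vanish almost everywhere,
  although it is positive on a ball.\<close>

lemma integral_mol:
  assumes r: "r > 0"
  shows "(\<integral>z. mol r z \<partial>(lborel :: (real^'n) measure)) = 1"
proof -
  let ?b = "\<lambda>y :: real^'n. bump 0 (r - y \<bullet> y)"
  have int: "integrable lborel ?b" by (rule kernel_integrable[OF bumps_kernel[OF bumps.base]])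
  have "(\<integral>y. ?b y \<partial>lborel) \<noteq> 0"
  proof
    assume "(\<integral>y. ?b y \<partial>lborel) = 0"
    then have ae: "AE y in lborel. ?b y = 0"
      using int bump_nonneg by (subst (asm) integral_nonneg_eq_0_iff_AE) auto
    have "AE y in (lborel :: (real^'n) measure). y \<notin> ball 0 (sqrt r)"
      using ae
    proof eventually_elim
      case (elim y)
      then have "r \<le> y \<bullet> y" by (auto simp: bump_def split: if_splits)
      then show ?case by (simp add: norm_eq_sqrt_inner)
    qed
    then have "emeasure lborel (ball (0 :: real^'n) (sqrt r)) = 0"
      by (subst (asm) AE_iff_measurable[of "ball 0 (sqrt r)"]) auto
    then have "negligible (ball (0 :: real^'n) (sqrt r))"
      by (simp add: negligible_iff_null_sets null_sets_def)
    then show False using open_not_negligible[of "ball (0 :: real^'n) (sqrt r)"] r by simp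
  qed
  then show ?thesis by (simp add: mol_def)
qed

lemma mol_integrable: "integrable lborel (mol r)"
  by (rule kernel_integrable[OF mol_kernel])

lemma nn_integral_mol: "r > 0 \<Longrightarrow> (\<integral>\<^sup>+z. ennreal (mol r z) \<partial>(lborel :: (real^'n) measure)) = 1"
  by (subst nn_integral_eq_integral) (auto simp: mol_integrable mol_nonneg integral_mol)

lemma nn_integral_mol_reflect: "r > 0 \<Longrightarrow> (\<integral>\<^sup>+y. ennreal (mol r (x - y)) \<partial>(lborel :: (real^'n) measure)) = 1"
  using nn_integral_reflect[of "\<lambda>z. ennreal (mol r z)" x] by (simp add: nn_integral_mol)

lemma nn_integral_mol_translate: "r > 0 \<Longrightarrow> (\<integral>\<^sup>+x. ennreal (mol r (x - y)) \<partial>(lborel :: (real^'n) measure)) = 1"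
  using nn_integral_translate[of "\<lambda>z. ennreal (mol r z)" y] by (simp add: nn_integral_mol)

lemma mol_reflect_integrable: "integrable lborel (\<lambda>y. mol r (x - y))"
  using conv_integrable[OF locally_L1_const[of 1] mol_kernel[of r], of x] by simp

lemma integral_mol_reflect: "r > 0 \<Longrightarrow> (\<integral>y. mol r (x - y) \<partial>lborel) = 1"
  using nn_integral_mol_reflect[of r x] mol_reflect_integrable[of r x]
  by (subst (asm) nn_integral_eq_integral) (auto simp: mol_nonneg)

lemma mol_minus: "mol r (- z) = mol r z"
  by (simp add: mol_def)

lemma mol_partials:
  fixes i :: "'n::finite"
  shows "has_partials (mol r :: real^'n \<Rightarrow> real) (\<lambda>i. partial i (mol r))" "bumps r (partial i (mol r))"
proof -
  obtain \<psi> :: "'n \<Rightarrow> real^'n \<Rightarrow> real" where "\<forall>i. bumps r (\<psi> i)" "has_partials (mol r) \<psi>" using bumps_has_partials[OF mol_bumps] by blast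
  moreover from this have "\<psi> = (\<lambda>i. partial i (mol r))" by (auto simp: has_partials_imp_partial)
  ultimately show "has_partials (mol r :: real^'n \<Rightarrow> real) (\<lambda>i. partial i (mol r))" "bumps r (partial i (mol r))" by auto
qed

text \<open>The mollifier is even, so its partial derivatives are odd. This is the sign that appears
  when the convolution is moved to the other factor.\<close>

lemma partial_mol_minus: "partial i (mol r) (- z) = - partial i (mol r) z"
proof -
  have "has_partials (\<lambda>y. 1 * mol r (0 - y)) (\<lambda>i y. - 1 * partial i (mol r) (0 - y))"
    by (rule has_partials_reflect[OF mol_partials(1)])
  then have "has_partials (mol r) (\<lambda>i y. - partial i (mol r) (- y))" by (simp add: mol_minus)
  from has_partials_imp_partial[OF this, of i] have "partial i (mol r) z = - partial i (mol r) (- z)"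
    by (rule fun_cong)
  then show ?thesis by simp
qed

lemma partial_mol_kernel: "kernel (sqrt r) (partial i (mol r))"
  by (rule bumps_kernel[OF mol_partials(2)])

lemma borel_partial_mol [measurable]: "partial i (mol r) \<in> borel_measurable borel"
  by (rule kernel_measurable[OF partial_mol_kernel])

lemma conv_bumps_continuous:
  assumes "locally_L1 h" "bumps r \<phi>"
  shows "continuous_on UNIV (conv h \<phi>)"
proof -
  obtain \<psi> where "\<forall>i. bumps r (\<psi> i)" "has_partials \<phi> \<psi>" using bumps_has_partials[OF assms(2)] by blast
  then have "has_partials (conv h \<phi>) (\<lambda>i. conv h (\<psi> i))"
    using assms by (intro conv_has_partials[where s = "sqrt r"] bumps_kernel) auto
  then show ?thesis by (rule has_partials_continuous)
qed

text \<open>The derivative falls on the mollifier, which makes sense for every locally integrable h,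
  also when the gradient of h is only a measure.\<close>

definition grad_conv :: "(real^'n \<Rightarrow> real) \<Rightarrow> real \<Rightarrow> real^'n \<Rightarrow> real^'n" where
  "grad_conv h r x = (\<chi> i. conv h (partial i (mol r)) x)"

lemma smooth_dyadic_conv:
  assumes h: "locally_L1 h"
  shows "smooth_dyadic (conv h (mol r)) (grad_conv h r)"
proof
  fix x
  have "has_partials (conv h (mol r)) (\<lambda>i. conv h (partial i (mol r)))"
    by (rule conv_has_partials[OF h mol_kernel partial_mol_kernel mol_partials(1)])
  then show "(conv h (mol r) has_derivative (\<lambda>v. grad_conv h r x \<bullet> v)) (at x)"
    by (simp add: has_partials_def grad_conv_def inner_vec_def mult.commute)
next
  show "continuous_on UNIV (grad_conv h r)"
    unfolding grad_conv_def[abs_def]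
    by (intro continuous_on_vec_lambda conv_bumps_continuous[OF h mol_partials(2)])
qed

text \<open>The difference is an average of h(x - z) - h(x) over small z, so its L1 norm is at most
  an average of shift moduli. These call for a globally integrable function: h is cut off at radius
  R + 1, which shifts of length at most 1 from the ball of radius R do not notice.\<close>

lemma conv_close:
  fixes h :: "real^'n \<Rightarrow> real"
  assumes h: "locally_L1 h" and e: "e > 0"
  obtains d where "d > 0" "\<And>r. 0 < r \<Longrightarrow> sqrt r \<le> d \<Longrightarrow>
     (\<integral>\<^sup>+x. ennreal \<bar>conv h (mol r) x - h x\<bar> * indicator (cball 0 R) x \<partial>lborel) \<le> ennreal e"
proof -
  have [measurable]: "h \<in> borel_measurable borel" using h by (simp add: locally_L1_def)
  define h1 where "h1 x = indicator (cball 0 (R + 1)) x * h x" for x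
  have [measurable]: "h1 \<in> borel_measurable borel" unfolding h1_def by measurable
  have "integrable lborel h1" using h unfolding h1_def locally_L1_def by auto
  then obtain d where d: "d > 0" "\<And>z. norm z \<le> d \<Longrightarrow> shift_diff h1 z \<le> ennreal e"
    using shift_diff_uniform e by metis
  have "(\<integral>\<^sup>+x. ennreal \<bar>conv h (mol r) x - h x\<bar> * indicator (cball 0 R) x \<partial>lborel) \<le> ennreal e"
    if r: "0 < r" "sqrt r \<le> min d 1" for r
  proof -
    have pt: "ennreal \<bar>conv h (mol r) x - h x\<bar> * indicator (cball 0 R) x
      \<le> (\<integral>\<^sup>+z. ennreal \<bar>h1 (x - z) - h1 x\<bar> * ennreal (mol r z) \<partial>lborel)" for x
    proof (cases "x \<in> cball 0 R")
      case True
      have i1: "integrable lborel (\<lambda>z. h (x - z) * mol r z)"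
      proof -
        have "integrable (distr lborel borel (\<lambda>z. x - z)) (\<lambda>y. h y * mol r (x - y))"
          using conv_integrable[OF h mol_kernel] by (simp add: lborel_distr_reflect)
        then show ?thesis by (subst (asm) integrable_distr_eq) auto
      qed
      have i2: "integrable lborel (\<lambda>z :: real^'n. h x * mol r z)" by (intro integrable_mult_right mol_integrable)
      have "conv h (mol r) x - h x = (\<integral>z. h (x - z) * mol r z \<partial>lborel) - (\<integral>z. h x * mol r z \<partial>(lborel :: (real^'n) measure))"
        by (simp add: conv_reflect mol_integrable integral_mol[OF r(1)])
      also have "\<dots> = (\<integral>z. h (x - z) * mol r z - h x * mol r z \<partial>lborel)"
        by (rule Bochner_Integration.integral_diff[OF i1 i2, symmetric])
      finally have eq: "conv h (mol r) x - h x = (\<integral>z. h (x - z) * mol r z - h x * mol r z \<partial>lborel)" .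
      have "ennreal \<bar>conv h (mol r) x - h x\<bar> \<le> (\<integral>\<^sup>+z. ennreal (norm (h (x - z) * mol r z - h x * mol r z)) \<partial>lborel)"
        unfolding eq real_norm_def[symmetric]
        by (rule integral_norm_bound_ennreal) (use i1 i2 in auto)
      also have "\<dots> = (\<integral>\<^sup>+z. ennreal \<bar>h1 (x - z) - h1 x\<bar> * ennreal (mol r z) \<partial>lborel)"
      proof (rule nn_integral_cong)
        fix z
        show "ennreal (norm (h (x - z) * mol r z - h x * mol r z)) = ennreal \<bar>h1 (x - z) - h1 x\<bar> * ennreal (mol r z)"
        proof (cases "norm z \<le> 1")
          case z: True
          have "norm (x - z) \<le> R + 1" using norm_triangle_ineq4[of x z] z True by simp
          then have "h1 (x - z) = h (x - z)" "h1 x = h x" using True by (auto simp: h1_def)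
          moreover have "h (x - z) * mol r z - h x * mol r z = (h (x - z) - h x) * mol r z" by (simp add: algebra_simps)
          ultimately show ?thesis using mol_nonneg[of r z] by (simp add: abs_mult ennreal_mult)
        next
          case False
          then have "mol r z = 0" using r(2) by (intro mol_zero) linarith
          then show ?thesis by simp
        qed
      qed
      finally show ?thesis using True by simp
    qed simp
    have "(\<integral>\<^sup>+x. ennreal \<bar>conv h (mol r) x - h x\<bar> * indicator (cball 0 R) x \<partial>lborel)
      \<le> (\<integral>\<^sup>+x. \<integral>\<^sup>+z. ennreal \<bar>h1 (x - z) - h1 x\<bar> * ennreal (mol r z) \<partial>lborel \<partial>lborel)"
      by (intro nn_integral_mono pt)
    also have "\<dots> = (\<integral>\<^sup>+z. \<integral>\<^sup>+x. ennreal \<bar>h1 (x - z) - h1 x\<bar> * ennreal (mol r z) \<partial>lborel \<partial>lborel)"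
      by (intro lborel_pair.Fubini') measurable
    also have "\<dots> = (\<integral>\<^sup>+z. shift_diff h1 z * ennreal (mol r z) \<partial>lborel)"
      unfolding shift_diff_def by (intro nn_integral_cong nn_integral_multc) measurable
    also have "\<dots> \<le> (\<integral>\<^sup>+z. ennreal e * ennreal (mol r z) \<partial>(lborel :: (real^'n) measure))"
    proof (rule nn_integral_mono)
      fix z
      show "shift_diff h1 z * ennreal (mol r z) \<le> ennreal e * ennreal (mol r z)"
      proof (cases "norm z \<le> d")
        case True
        then show ?thesis by (intro mult_right_mono d) auto
      next
        case False
        then have "mol r z = 0" using r(2) by (intro mol_zero) linarith
        then show ?thesis by simp
      qed
    qed
    also have "\<dots> = ennreal e"
      by (subst nn_integral_cmult) (auto simp: nn_integral_mol[OF r(1)])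
    finally show ?thesis .
  qed
  then show ?thesis using that[of "min d 1"] d(1) by simp
qed

lemma locally_L1_continuous:
  assumes "continuous_on UNIV f"
  shows "locally_L1 f"
  unfolding locally_L1_def
proof (intro conjI allI)
  show "f \<in> borel_measurable borel" by (rule borel_measurable_continuous_onI[OF assms])
  fix R
  have "set_integrable lborel (cball 0 R) f"
    unfolding set_integrable_def by (rule borel_integrable_compact) (auto intro: continuous_on_subset[OF assms])
  then show "integrable lborel (\<lambda>x. indicator (cball 0 R) x * f x)" by (simp add: set_integrable_def)
qed

lemma locally_L1_dcube:
  assumes "locally_L1 h"
  shows "integrable lborel (\<lambda>x. indicator (dcube n k) x * h x)"
proof -
  obtain R where R: "dcube n k \<subseteq> cball 0 R"
    using bounded_dcube[of n k] unfolding bounded_iff by (auto simp: subset_iff)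
  have "integrable lborel (\<lambda>x. h x * indicator (dcube n k) x)"
    by (rule locally_L1_bound_integrable[OF assms, where K = 1 and R = R])
      (use R in \<open>auto split: split_indicator\<close>)
  then show ?thesis by (simp add: mult.commute)
qed

text \<open>The mollifier has radius 1/(j + 1). Local L1 convergence passes to absolute values by
  the reverse triangle inequality.\<close>

lemma avg_conv_tendsto:
  assumes h: "locally_L1 h"
  shows "(\<lambda>j. avg (conv h (mol (1 / (real (Suc j))\<^sup>2))) (dcube n k)) \<longlonglongrightarrow> avg h (dcube n (k :: int^'n))"
proof -
  have [measurable]: "h \<in> borel_measurable borel" using h by (simp add: locally_L1_def)
  define c where "c j = conv h (mol (1 / (real (Suc j))\<^sup>2))" for j
  have cL: "locally_L1 (c j)" for j
    unfolding c_def by (intro locally_L1_continuous conv_bumps_continuous[OF h mol_bumps])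
  have [measurable]: "c j \<in> borel_measurable borel" for j using cL by (simp add: locally_L1_def)
  let ?Q = "dcube n k"
  define p where "p = 2 powr (real_of_int n * CARD('n))"
  obtain R where R: "?Q \<subseteq> cball 0 R"
    using bounded_dcube[of n k] unfolding bounded_iff by (auto simp: subset_iff)
  have ih: "integrable lborel (\<lambda>x. indicator ?Q x * h x)" by (rule locally_L1_dcube[OF h])
  have ic: "integrable lborel (\<lambda>x. indicator ?Q x * c j x)" for j by (rule locally_L1_dcube[OF cL])
  have absi: "indicator ?Q x * \<bar>g x\<bar> = \<bar>indicator ?Q x * g x\<bar>" for g :: "real^'n \<Rightarrow> real" and x
    by (simp add: abs_mult)
  have "(\<lambda>j. \<integral>x. indicator ?Q x * \<bar>c j x\<bar> \<partial>lborel) \<longlonglongrightarrow> (\<integral>x. indicator ?Q x * \<bar>h x\<bar> \<partial>lborel)"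
  proof (rule LIMSEQ_I)
    fix e :: real assume e: "e > 0"
    obtain d where d: "d > 0" "\<And>r. 0 < r \<Longrightarrow> sqrt r \<le> d \<Longrightarrow>
     (\<integral>\<^sup>+x. ennreal \<bar>conv h (mol r) x - h x\<bar> * indicator (cball 0 R) x \<partial>lborel) \<le> ennreal (e / 2)"
      using conv_close[OF h, of "e / 2" R] e by auto
    obtain j0 where j0: "1 / real (Suc j0) < d" using d(1) nat_approx_posE by blast
    show "\<exists>no. \<forall>j\<ge>no. norm ((\<integral>x. indicator ?Q x * \<bar>c j x\<bar> \<partial>lborel) - (\<integral>x. indicator ?Q x * \<bar>h x\<bar> \<partial>lborel)) < e"
    proof (intro exI[of _ j0] allI impI)
      fix j assume j: "j0 \<le> j"
      have "1 / real (Suc j) \<le> 1 / real (Suc j0)" using j by (intro divide_left_mono) auto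
      moreover have "sqrt (1 / (real (Suc j))\<^sup>2) = 1 / real (Suc j)" by (simp add: real_sqrt_divide)
      ultimately have sq: "sqrt (1 / (real (Suc j))\<^sup>2) \<le> d" using j0 by linarith
      have "norm ((\<integral>x. indicator ?Q x * \<bar>c j x\<bar> \<partial>lborel) - (\<integral>x. indicator ?Q x * \<bar>h x\<bar> \<partial>lborel))
        = norm (\<integral>x. indicator ?Q x * \<bar>c j x\<bar> - indicator ?Q x * \<bar>h x\<bar> \<partial>lborel)"
        using ih ic by (simp add: absi)
      also have "ennreal \<dots> \<le> (\<integral>\<^sup>+x. ennreal (norm (indicator ?Q x * \<bar>c j x\<bar> - indicator ?Q x * \<bar>h x\<bar>)) \<partial>lborel)"
        by (rule integral_norm_bound_ennreal) (use ih ic in \<open>auto simp: absi\<close>)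
      also have "\<dots> \<le> (\<integral>\<^sup>+x. ennreal \<bar>c j x - h x\<bar> * indicator (cball 0 R) x \<partial>lborel)"
        using R by (intro nn_integral_mono) (auto split: split_indicator intro!: ennreal_leI)
      also have "\<dots> \<le> ennreal (e / 2)"
        unfolding c_def by (intro d sq) simp
      finally show "norm ((\<integral>x. indicator ?Q x * \<bar>c j x\<bar> \<partial>lborel) - (\<integral>x. indicator ?Q x * \<bar>h x\<bar> \<partial>lborel)) < e"
        using e by (subst (asm) ennreal_le_iff) auto
    qed
  qed
  then have "(\<lambda>j. (\<integral>x. indicator ?Q x * \<bar>c j x\<bar> \<partial>lborel) / p) \<longlonglongrightarrow> (\<integral>x. indicator ?Q x * \<bar>h x\<bar> \<partial>lborel) / p"
    by (intro tendsto_intros) (auto simp: p_def)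
  then show ?thesis
    unfolding c_def[symmetric] by (simp add: avg_lborel set_lebesgue_integral_def p_def)
qed

section \<open>Bounds for the gradient of a mollification\<close>

lemma locally_L1_integrable:
  assumes "integrable lborel h"
  shows "locally_L1 h"
  using borel_measurable_integrable[OF assms] integrable_real_mult_indicator[OF _ assms]
  by (simp add: locally_L1_def mult.commute)

lemma integrable_indicator_cball: "integrable lborel (indicator (cball (a :: 'a::euclidean_space) R) :: 'a \<Rightarrow> real)"
  using emeasure_bounded_finite[OF bounded_cball] by (auto intro!: integrable_real_indicator)

lemma locally_L1_norm:
  fixes G :: "real^'n \<Rightarrow> real^'n"
  assumes G: "\<And>i. locally_L1 (\<lambda>y. G y $ i)" and [measurable]: "G \<in> borel_measurable borel"
  shows "locally_L1 (\<lambda>y. norm (G y))"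
  unfolding locally_L1_def
proof (intro conjI allI)
  fix R
  show "integrable lborel (\<lambda>x. indicator (cball 0 R) x * norm (G x))"
  proof (rule Bochner_Integration.integrable_bound)
    show "integrable lborel (\<lambda>x. \<Sum>i\<in>UNIV. \<bar>indicator (cball 0 R) x * G x $ i\<bar>)"
      using G by (intro Bochner_Integration.integrable_sum integrable_abs) (auto simp: locally_L1_def)
    show "AE x in lborel. norm (indicator (cball 0 R) x * norm (G x)) \<le> norm (\<Sum>i\<in>UNIV. \<bar>indicator (cball 0 R) x * G x $ i\<bar>)"
    proof (rule AE_I2)
      fix x
      have "norm (G x) \<le> (\<Sum>i\<in>UNIV. \<bar>G x $ i\<bar>)" by (rule norm_le_l1_cart)
      then show "norm (indicator (cball 0 R) x * norm (G x)) \<le> norm (\<Sum>i\<in>UNIV. \<bar>indicator (cball 0 R) x * G x $ i\<bar>)"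
        by (auto split: split_indicator simp: sum_nonneg)
    qed
  qed measurable
qed measurable

lemma conv_mono:
  assumes "locally_L1 h" "locally_L1 k" "AE y in lborel. h y \<le> k y"
  shows "conv h (mol r) x \<le> conv k (mol r) x"
  unfolding conv_def
proof (rule integral_mono_AE)
  show "AE y in lborel. h y * mol r (x - y) \<le> k y * mol r (x - y)"
    using assms(3) by eventually_elim (auto intro: mult_right_mono mol_nonneg)
qed (intro conv_integrable[OF _ mol_kernel] assms)+

lemma conv_const: "r > 0 \<Longrightarrow> conv (\<lambda>_. c) (mol r) x = c"
  by (simp add: conv_def integral_mol_reflect)

text \<open>Pairing the vector v on the left with itself reduces the claim to Cauchy-Schwarz: |v|^2
  is the convolution of v \<bullet> G, which is at most |v| times the convolution of |G|.\<close>

lemma norm_conv_vec_le: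
  fixes G :: "real^'n \<Rightarrow> real^'n"
  assumes G: "\<And>i. locally_L1 (\<lambda>y. G y $ i)" and Gm: "G \<in> borel_measurable borel"
  shows "norm (\<chi> i. conv (\<lambda>y. G y $ i) (mol r) x) \<le> conv (\<lambda>y. norm (G y)) (mol r) x"
proof -
  define v where "v = (\<chi> i. conv (\<lambda>y. G y $ i) (mol r) x)"
  note gi = conv_integrable[OF G mol_kernel[of r], where x = x]
  have ni: "integrable lborel (\<lambda>y. norm (G y) * mol r (x - y))"
    by (rule conv_integrable[OF locally_L1_norm[OF G Gm] mol_kernel])
  have inn: "(\<Sum>i\<in>UNIV. v $ i * (G y $ i * mol r (x - y))) = (v \<bullet> G y) * mol r (x - y)" for y
    by (simp add: inner_vec_def sum_distrib_right mult.assoc)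
  have si: "integrable lborel (\<lambda>y. (v \<bullet> G y) * mol r (x - y))"
    unfolding inn[symmetric] using gi by (intro Bochner_Integration.integrable_sum integrable_mult_right)
  have "norm v * norm v = (\<Sum>i\<in>UNIV. v $ i * (\<integral>y. G y $ i * mol r (x - y) \<partial>lborel))"
    by (simp add: power2_norm_eq_inner[unfolded power2_eq_square] inner_vec_def v_def conv_def)
  also have "\<dots> = (\<integral>y. (v \<bullet> G y) * mol r (x - y) \<partial>lborel)"
    unfolding inn[symmetric] using gi by (subst Bochner_Integration.integral_sum) auto
  also have "\<dots> \<le> (\<integral>y. norm v * (norm (G y) * mol r (x - y)) \<partial>lborel)"
  proof (rule integral_mono)
    fix y
    have "(v \<bullet> G y) * mol r (x - y) \<le> (norm v * norm (G y)) * mol r (x - y)"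
      by (intro mult_right_mono norm_cauchy_schwarz mol_nonneg)
    then show "(v \<bullet> G y) * mol r (x - y) \<le> norm v * (norm (G y) * mol r (x - y))" by (simp add: mult.assoc)
  qed (use si ni in auto)
  also have "\<dots> = norm v * conv (\<lambda>y. norm (G y)) (mol r) x" by (simp add: conv_def)
  finally have *: "norm v * norm v \<le> norm v * conv (\<lambda>y. norm (G y)) (mol r) x" .
  show ?thesis
  proof (cases "v = 0")
    case True
    have "0 \<le> conv (\<lambda>y. norm (G y)) (mol r) x"
      unfolding conv_def by (intro integral_nonneg_AE AE_I2 mult_nonneg_nonneg mol_nonneg) auto
    then show ?thesis using True by (simp add: v_def[symmetric])
  next
    case False
    then show ?thesis using * by (simp add: v_def[symmetric])
  qed
qed

lemma nn_integral_conv_mol: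
  assumes h: "integrable lborel h" "\<And>x. 0 \<le> h x" and hm [measurable]: "h \<in> borel_measurable borel" and r: "r > 0"
  shows "(\<integral>\<^sup>+x. ennreal (conv h (mol r) x) \<partial>lborel) = ennreal (\<integral>x. h x \<partial>(lborel :: (real^'n) measure))"
proof -
  have hL: "locally_L1 h"
    using h by (intro locally_L1_integrable)
  have "ennreal (conv h (mol r) x) = (\<integral>\<^sup>+y. ennreal (h y) * ennreal (mol r (x - y)) \<partial>lborel)" for x
    unfolding conv_def
    using h by (subst nn_integral_eq_integral[symmetric])
      (auto intro: conv_integrable[OF hL mol_kernel] simp: ennreal_mult mol_nonneg)
  then have "(\<integral>\<^sup>+x. ennreal (conv h (mol r) x) \<partial>lborel) = (\<integral>\<^sup>+x. \<integral>\<^sup>+y. ennreal (h y) * ennreal (mol r (x - y)) \<partial>lborel \<partial>lborel)"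
    by simp
  also have "\<dots> = (\<integral>\<^sup>+y. \<integral>\<^sup>+x. ennreal (h y) * ennreal (mol r (x - y)) \<partial>lborel \<partial>lborel)"
    by (intro lborel_pair.Fubini') measurable
  also have "\<dots> = (\<integral>\<^sup>+y. ennreal (h y) * (\<integral>\<^sup>+x. ennreal (mol r (x - y)) \<partial>lborel) \<partial>lborel)"
    by (intro nn_integral_cong nn_integral_cmult) measurable
  also have "\<dots> = (\<integral>\<^sup>+y. ennreal (h y) \<partial>lborel)"
    by (simp add: nn_integral_mol_translate[OF r])
  also have "\<dots> = ennreal (\<integral>x. h x \<partial>lborel)"
    using h by (intro nn_integral_eq_integral) auto
  finally show ?thesis .
qed

text \<open>Jensen's inequality for the probability density \<open>mol r (x - y)\<close> in y bounds
  the p-th power pointwise by a convolution, and convolution with the mollifier preserves the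
  integral.\<close>

lemma nn_integral_conv_vec_powr_le:
  fixes G :: "real^'n \<Rightarrow> real^'n"
  assumes G: "\<And>i. locally_L1 (\<lambda>y. G y $ i)" and Gm [measurable]: "G \<in> borel_measurable borel"
    and p: "1 \<le> p" and Gp: "integrable lborel (\<lambda>y. norm (G y) powr p)" and r: "r > 0"
  shows "(\<integral>\<^sup>+x. ennreal (norm (\<chi> i. conv (\<lambda>y. G y $ i) (mol r) x) powr p) \<partial>lborel)
     \<le> ennreal (\<integral>y. norm (G y) powr p \<partial>lborel)"
proof -
  have pL: "locally_L1 (\<lambda>y. norm (G y) powr p)"
    using Gp by (rule locally_L1_integrable)
  have "norm (\<chi> i. conv (\<lambda>y. G y $ i) (mol r) x) powr p \<le> conv (\<lambda>y. norm (G y) powr p) (mol r) x" for x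
  proof -
    have "norm (\<chi> i. conv (\<lambda>y. G y $ i) (mol r) x) powr p \<le> (conv (\<lambda>y. norm (G y)) (mol r) x) powr p"
      using p by (intro powr_mono2 norm_conv_vec_le G Gm) auto
    also have "conv (\<lambda>y. norm (G y)) (mol r) x = (\<integral>y. mol r (x - y) * norm (G y) \<partial>lborel)"
      by (simp add: conv_def mult.commute)
    also have "\<dots> powr p \<le> (\<integral>y. mol r (x - y) * norm (G y) powr p \<partial>lborel)"
      using conv_integrable[OF locally_L1_norm[OF G Gm] mol_kernel[of r], where x = x]
        conv_integrable[OF pL mol_kernel[of r], where x = x]
      by (intro powr_integral_le p mol_nonneg mol_reflect_integrable integral_mol_reflect r) (auto simp: mult.commute)
    also have "\<dots> = conv (\<lambda>y. norm (G y) powr p) (mol r) x" by (simp add: conv_def mult.commute)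
    finally show ?thesis .
  qed
  then have "(\<integral>\<^sup>+x. ennreal (norm (\<chi> i. conv (\<lambda>y. G y $ i) (mol r) x) powr p) \<partial>lborel)
     \<le> (\<integral>\<^sup>+x. ennreal (conv (\<lambda>y. norm (G y) powr p) (mol r) x) \<partial>lborel)"
    by (intro nn_integral_mono ennreal_leI)
  also have "\<dots> = ennreal (\<integral>y. norm (G y) powr p \<partial>lborel)"
    by (intro nn_integral_conv_mol Gp r) auto
  finally show ?thesis .
qed

text \<open>All smoothness comes from the kernel, so \<sigma> may be discontinuous. This admits the
  cut-off sign function used for the variation.\<close>

lemma test_fun_conv:
  fixes \<sigma> \<phi> :: "real^'n \<Rightarrow> real"
  assumes s: "locally_L1 \<sigma>" "\<And>x. R < norm x \<Longrightarrow> \<sigma> x = 0" and \<phi>: "bumps r \<phi>"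
  shows "test_fun (conv \<sigma> \<phi>)"
proof (rule test_funI)
  show "smooth (conv \<sigma> \<phi>)"
  proof (rule smooth_coinduct[where X = "\<lambda>\<theta>. \<exists>\<phi>. bumps r \<phi> \<and> \<theta> = conv \<sigma> \<phi>"])
    show "\<exists>\<phi>'. bumps r \<phi>' \<and> conv \<sigma> \<phi> = conv \<sigma> \<phi>'" using \<phi> by blast
    fix \<theta> :: "real^'n \<Rightarrow> real" assume "\<exists>\<phi>. bumps r \<phi> \<and> \<theta> = conv \<sigma> \<phi>"
    then obtain \<phi> where \<phi>: "bumps r \<phi>" "\<theta> = conv \<sigma> \<phi>" by blast
    obtain \<psi> where \<psi>: "\<forall>i. bumps r (\<psi> i)" "has_partials \<phi> \<psi>" using bumps_has_partials[OF \<phi>(1)] by blast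
    have "has_partials \<theta> (\<lambda>i. conv \<sigma> (\<psi> i))"
      unfolding \<phi>(2) using \<psi> \<phi>(1) by (intro conv_has_partials[OF s(1), where s = "sqrt r"] bumps_kernel) auto
    then show "\<exists>\<psi>. (\<forall>i. \<exists>\<phi>. bumps r \<phi> \<and> \<psi> i = conv \<sigma> \<phi>) \<and> has_partials \<theta> \<psi>"
      using \<psi>(1) by (intro exI[of _ "\<lambda>i. conv \<sigma> (\<psi> i)"]) auto
  qed
  fix x :: "real^'n" assume x: "R + sqrt r < norm x"
  have z: "\<sigma> y * \<phi> (x - y) = 0" for y
  proof (cases "R < norm y")
    case False
    then have "sqrt r \<le> norm (x - y)" using x norm_triangle_ineq2[of x y] by simp
    then show ?thesis using bumps_kernel[OF \<phi>] by (simp add: kernel_def)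
  qed (simp add: s)
  show "conv \<sigma> \<phi> x = 0" by (simp only: conv_def z Bochner_Integration.integral_zero)
qed

lemma has_partials_zero: "has_partials (\<lambda>x. 0) (\<lambda>j x. 0)"
  by (simp add: has_partials_def)

lemma divg_zero: "divg (\<lambda>_. 0) = (\<lambda>x. 0)"
  by (simp add: divg_def[abs_def] has_partials_imp_partial[OF has_partials_zero])

lemma test_fun_zero: "test_fun (\<lambda>_. 0)"
  by (rule test_funI[of _ 0], rule smooth_coinduct[where X = "\<lambda>\<theta>. \<theta> = (\<lambda>x. 0)"]) (use has_partials_zero in auto)

text \<open>Integrating the sign of a partial derivative of a mollification against it moves the
  mollifier onto the sign, which makes it an admissible test function for the variation.\<close>

lemma nn_integral_partial_conv_le_var:
  fixes f :: "real^'n \<Rightarrow> real"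
  assumes f: "integrable lborel f" and [measurable]: "f \<in> borel_measurable borel" and r: "r > 0"
    and V: "\<And>\<Phi>. (\<And>i. test_fun (\<lambda>x. \<Phi> x $ i)) \<Longrightarrow> (\<And>x. norm (\<Phi> x) \<le> 1) \<Longrightarrow>
       (\<integral>x. f x * divg \<Phi> x \<partial>lborel) \<le> V"
  shows "(\<integral>\<^sup>+x. ennreal \<bar>conv f (partial i (mol r)) x\<bar> * indicator (cball 0 R) x \<partial>lborel) \<le> ennreal V"
proof -
  let ?\<psi> = "partial i (mol r)"
  have fL: "locally_L1 f"
    using f by (rule locally_L1_integrable)
  have c: "continuous_on UNIV (conv f ?\<psi>)" by (rule conv_bumps_continuous[OF fL mol_partials(2)])
  have cL: "locally_L1 (conv f ?\<psi>)" by (rule locally_L1_continuous[OF c])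
  have [measurable]: "conv f ?\<psi> \<in> borel_measurable borel" using cL by (simp add: locally_L1_def)
  \<comment> \<open>The cut-off to a ball gives the test field bounded support; it is the reason why
    the estimate is local.\<close>
  define \<sigma> where "\<sigma> x = sgn (conv f ?\<psi> x) * indicator (cball 0 R) x" for x
  have [measurable]: "\<sigma> \<in> borel_measurable borel" unfolding \<sigma>_def by measurable
  have \<sigma>1: "\<bar>\<sigma> x\<bar> \<le> indicator (cball 0 R) x" for x
    by (auto simp: \<sigma>_def sgn_if split: split_indicator)
  have \<sigma>0: "R < norm x \<Longrightarrow> \<sigma> x = 0" for x by (simp add: \<sigma>_def)
  have \<sigma>L: "locally_L1 \<sigma>"
    unfolding locally_L1_def
  proof (intro conjI allI)
    fix R'
    show "integrable lborel (\<lambda>x. indicator (cball 0 R') x * \<sigma> x)"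
    proof (rule Bochner_Integration.integrable_bound)
      show "integrable lborel (indicator (cball 0 R) :: real^'n \<Rightarrow> real)" by (rule integrable_indicator_cball)
      show "AE x in lborel. norm (indicator (cball 0 R') x * \<sigma> x) \<le> norm (indicator (cball 0 R) x :: real)"
      proof (rule AE_I2)
        fix x
        have "norm (indicator (cball 0 R') x * \<sigma> x) \<le> \<bar>\<sigma> x\<bar>" by (auto split: split_indicator)
        also have "\<dots> \<le> norm (indicator (cball 0 R) x :: real)" using \<sigma>1[of x] by simp
        finally show "norm (indicator (cball 0 R') x * \<sigma> x) \<le> norm (indicator (cball 0 R) x :: real)" .
      qed
    qed measurable
  qed measurable
  obtain K where K: "K \<ge> 0" "\<And>z. \<bar>?\<psi> z\<bar> \<le> K" by (rule kernel_bounded[OF partial_mol_kernel[of r i]]) blast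
  \<comment> \<open>Integrability for Fubini's theorem: the kernel is bounded, f is integrable and
    the ball has finite measure.\<close>
  have prod: "integrable (lborel \<Otimes>\<^sub>M lborel) (\<lambda>(x, y). \<sigma> x * (f y * ?\<psi> (x - y)))"
  proof (rule Bochner_Integration.integrable_bound)
    show "integrable (lborel \<Otimes>\<^sub>M lborel) (\<lambda>(x, y). indicator (cball (0::real^'n) R) x * (K * \<bar>f y\<bar>))"
    proof (rule lborel_pair.Fubini_integrable)
      have "(\<integral>y. norm (case (x, y) of (x, y) \<Rightarrow> indicator (cball (0::real^'n) R) x * (K * \<bar>f y\<bar>)) \<partial>lborel)
          = indicator (cball 0 R) x * (K * (\<integral>y. \<bar>f y\<bar> \<partial>lborel))" for x
        using K(1) by (simp add: abs_mult)
      then show "integrable lborel (\<lambda>x. \<integral>y. norm (case (x, y) of (x, y) \<Rightarrow> indicator (cball (0::real^'n) R) x * (K * \<bar>f y\<bar>)) \<partial>lborel)"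
        by (simp add: integrable_indicator_cball)
      show "AE x in lborel. integrable lborel (\<lambda>y. case (x, y) of (x, y) \<Rightarrow> indicator (cball (0::real^'n) R) x * (K * \<bar>f y\<bar>))"
        using f by simp
    qed measurable
    show "AE z in lborel \<Otimes>\<^sub>M lborel. norm (case z of (x, y) \<Rightarrow> \<sigma> x * (f y * ?\<psi> (x - y)))
       \<le> norm (case z of (x, y) \<Rightarrow> indicator (cball (0::real^'n) R) x * (K * \<bar>f y\<bar>))"
    proof (intro AE_I2, safe)
      fix x y
      have "\<bar>\<sigma> x\<bar> * (\<bar>f y\<bar> * \<bar>?\<psi> (x - y)\<bar>) \<le> indicator (cball 0 R) x * (\<bar>f y\<bar> * K)"
        by (intro mult_mono \<sigma>1 K(2)) (auto simp: K)
      then show "norm (\<sigma> x * (f y * ?\<psi> (x - y))) \<le> norm (indicator (cball (0::real^'n) R) x * (K * \<bar>f y\<bar>))"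
        using K(1) by (simp add: abs_mult mult_ac)
    qed
  qed measurable
  \<comment> \<open>Only the i-th component is nonzero. It is bounded by 1 because |\<sigma>| \<le>
    1 and the mollifier has mass 1; the minus sign anticipates the oddness of the partial
    derivative.\<close>
  define \<Phi> where "\<Phi> x = axis i (- conv \<sigma> (mol r) x)" for x
  have comp: "(\<lambda>x. \<Phi> x $ j) = (if j = i then (\<lambda>x. conv (\<lambda>x. - \<sigma> x) (mol r) x) else (\<lambda>x. 0))" for j
    by (auto simp: \<Phi>_def axis_def conv_def fun_eq_iff)
  have m\<sigma>L: "locally_L1 (\<lambda>x. - \<sigma> x)" using \<sigma>L by (auto simp: locally_L1_def)
  have test: "test_fun (\<lambda>x. \<Phi> x $ j)" for j
    using test_fun_conv[OF m\<sigma>L _ mol_bumps, of R r] \<sigma>0 test_fun_zero by (auto simp: comp)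
  have nrm: "norm (\<Phi> x) \<le> 1" for x
  proof -
    have \<sigma>le: "\<sigma> y \<le> 1" "-1 \<le> \<sigma> y" for y by (auto simp: \<sigma>_def sgn_if split: split_indicator)
    have "conv \<sigma> (mol r) x \<le> conv (\<lambda>_. 1) (mol r) x"
      by (intro conv_mono \<sigma>L locally_L1_const AE_I2 \<sigma>le)
    moreover have "conv (\<lambda>_. -1) (mol r) x \<le> conv \<sigma> (mol r) x"
      by (intro conv_mono \<sigma>L locally_L1_const AE_I2 \<sigma>le)
    ultimately show ?thesis by (simp add: \<Phi>_def norm_eq_sqrt_inner inner_axis_axis conv_const[OF r] abs_le_iff)
  qed
  have div: "divg \<Phi> y = - conv \<sigma> ?\<psi> y" for y
  proof -
    have "has_partials (conv (\<lambda>x. - \<sigma> x) (mol r)) (\<lambda>i. conv (\<lambda>x. - \<sigma> x) (partial i (mol r)))"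
      by (rule conv_has_partials[OF m\<sigma>L mol_kernel partial_mol_kernel mol_partials(1)])
    then have "partial j (\<lambda>x. \<Phi> x $ j) y = (if j = i then - conv \<sigma> ?\<psi> y else 0)" for j
      by (simp add: comp has_partials_imp_partial has_partials_imp_partial[OF has_partials_zero] conv_def)
    then show ?thesis by (simp add: divg_def)
  qed
  have "(\<integral>\<^sup>+x. ennreal \<bar>conv f ?\<psi> x\<bar> * indicator (cball 0 R) x \<partial>lborel) = (\<integral>\<^sup>+x. ennreal (\<sigma> x * conv f ?\<psi> x) \<partial>lborel)"
    by (intro nn_integral_cong) (auto simp: \<sigma>_def sgn_if split: split_indicator)
  also have "\<dots> = ennreal (\<integral>x. \<sigma> x * conv f ?\<psi> x \<partial>lborel)"
  proof (rule nn_integral_eq_integral)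
    have "integrable lborel (\<lambda>x. conv f ?\<psi> x * \<sigma> x)"
      by (rule locally_L1_bound_integrable[OF cL, where K = 1 and R = R]) (use \<sigma>1 in auto)
    then show "integrable lborel (\<lambda>x. \<sigma> x * conv f ?\<psi> x)" by (simp add: mult.commute)
    show "AE x in lborel. 0 \<le> \<sigma> x * conv f ?\<psi> x"
      by (intro AE_I2) (auto simp: \<sigma>_def sgn_if split: split_indicator)
  qed
  also have "(\<integral>x. \<sigma> x * conv f ?\<psi> x \<partial>lborel) = (\<integral>x. \<integral>y. \<sigma> x * (f y * ?\<psi> (x - y)) \<partial>lborel \<partial>lborel)"
    by (simp add: conv_def)
  also have "\<dots> = (\<integral>y. \<integral>x. \<sigma> x * (f y * ?\<psi> (x - y)) \<partial>lborel \<partial>lborel)"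
    using lborel_pair.Fubini_integral[OF prod] by simp
  also have "\<dots> = (\<integral>y. f y * divg \<Phi> y \<partial>lborel)"
  proof (rule Bochner_Integration.integral_cong[OF refl])
    fix y
    have "(\<integral>x. \<sigma> x * (f y * ?\<psi> (x - y)) \<partial>lborel) = (\<integral>x. - f y * (\<sigma> x * ?\<psi> (y - x)) \<partial>lborel)"
    proof (rule Bochner_Integration.integral_cong[OF refl])
      fix x
      show "\<sigma> x * (f y * ?\<psi> (x - y)) = - f y * (\<sigma> x * ?\<psi> (y - x))"
        using partial_mol_minus[of i r "y - x"] by (simp add: mult_ac)
    qed
    also have "\<dots> = - f y * conv \<sigma> ?\<psi> y"
      unfolding conv_def by (rule integral_mult_right_zero)
    finally show "(\<integral>x. \<sigma> x * (f y * ?\<psi> (x - y)) \<partial>lborel) = f y * divg \<Phi> y" by (simp add: div)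
  qed
  finally show ?thesis using V[OF test nrm] by (simp add: ennreal_leI)
qed

section \<open>From smooth functions to the general case\<close>

definition mollify :: "(real^'n \<Rightarrow> real) \<Rightarrow> nat \<Rightarrow> real^'n \<Rightarrow> real" where
  "mollify f j = conv f (mol (1 / (real (Suc j))\<^sup>2))"

definition mollify_grad :: "(real^'n \<Rightarrow> real) \<Rightarrow> nat \<Rightarrow> real^'n \<Rightarrow> real^'n" where
  "mollify_grad f j = grad_conv f (1 / (real (Suc j))\<^sup>2)"

lemma dcube_psubset_ancestor:
  assumes "n < m"
  shows "dcube n (k :: int^'n) \<subset> dcube m (cidx m (corner n k))"
proof
  show "dcube n k \<subseteq> dcube m (cidx m (corner n k))"
    using dcube_mono[of n m "corner n k"] assms by simp
  show "dcube n k \<noteq> dcube m (cidx m (corner n k))"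
  proof
    assume "dcube n k = dcube m (cidx m (corner n k))"
    then have "measure lborel (dcube n k) = measure lborel (dcube m (cidx m (corner n k)))" by simp
    moreover have "2 powr (real_of_int n * CARD('n)) < 2 powr (real_of_int m * CARD('n))"
      using assms by (intro powr_less_mono mult_strict_right_mono) auto
    ultimately show False by (simp add: measure_dcube)
  qed
qed

lemma Qalpha_ancestor:
  assumes "(n, k) \<in> Qalpha \<alpha> f" "n < m"
  shows "side m powr \<alpha> * avg f (dcube m (cidx m (corner n k))) < side n powr \<alpha> * avg f (dcube n k)"
  using assms(1) dcube_psubset_ancestor[OF assms(2), of k] by (simp add: Qalpha_def)

lemma eventually_good_cube:
  fixes f :: "real^'n \<Rightarrow> real"
  assumes f: "locally_L1 f" and F: "finite F" "F \<subseteq> Qalpha \<alpha> f"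
  shows "\<forall>\<^sub>F j in sequentially. \<forall>(n, k)\<in>F. smooth_dyadic.good_cube (mollify f j) N \<alpha> n k"
proof -
  have lim: "(\<lambda>j. avg (mollify f j) (dcube n k)) \<longlonglongrightarrow> avg f (dcube n k)" for n and k :: "int^'n"
    unfolding mollify_def by (rule avg_conv_tendsto[OF f])
  have "\<forall>\<^sub>F j in sequentially. side m powr \<alpha> * avg (mollify f j) (dcube m (cidx m (corner n k)))
      < side n powr \<alpha> * avg (mollify f j) (dcube n k)" if "(n, k) \<in> F" "n < m" for n k m
  proof -
    have "(\<lambda>j. side n powr \<alpha> * avg (mollify f j) (dcube n k) - side m powr \<alpha> * avg (mollify f j) (dcube m (cidx m (corner n k))))
      \<longlonglongrightarrow> side n powr \<alpha> * avg f (dcube n k) - side m powr \<alpha> * avg f (dcube m (cidx m (corner n k)))"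
      by (intro tendsto_intros lim)
    moreover have "0 < side n powr \<alpha> * avg f (dcube n k) - side m powr \<alpha> * avg f (dcube m (cidx m (corner n k)))"
      using Qalpha_ancestor[of n k \<alpha> f m] that F by auto
    ultimately have "\<forall>\<^sub>F j in sequentially. 0 < side n powr \<alpha> * avg (mollify f j) (dcube n k) - side m powr \<alpha> * avg (mollify f j) (dcube m (cidx m (corner n k)))"
      by (rule order_tendstoD)
    then show ?thesis by eventually_elim simp
  qed
  then have "\<forall>\<^sub>F j in sequentially. \<forall>Q\<in>F. \<forall>m\<in>{fst Q<..N}.
      side m powr \<alpha> * avg (mollify f j) (dcube m (cidx m (corner (fst Q) (snd Q))))
      < side (fst Q) powr \<alpha> * avg (mollify f j) (dcube (fst Q) (snd Q))"
    using F(1) by (intro eventually_ball_finite ballI) auto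
  then show ?thesis
  proof eventually_elim
    case (elim j)
    interpret smooth_dyadic "mollify f j" "mollify_grad f j" N
      unfolding mollify_def mollify_grad_def by (rule smooth_dyadic_conv[OF f])
    show ?case
    proof safe
      fix n k assume nk: "(n, k) \<in> F"
      show "good_cube \<alpha> n k"
        unfolding good_cube_def
      proof (intro allI impI)
        fix m x assume m: "n < m" "m \<le> N" and x: "x \<in> dcube n k"
        then have "cidx m x = cidx m (corner n k)"
          by (intro cidx_eq_mono[of n m]) (auto simp: mem_dcube)
        then show "side m powr \<alpha> * avg (mollify f j) (dcube m (cidx m x)) < side n powr \<alpha> * avg (mollify f j) (dcube n k)"
          using elim nk m by force
      qed
    qed
  qed
qed

lemma ex_kappa:
  fixes \<alpha> d :: real
  assumes "\<alpha> > 0"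
  obtains \<kappa> :: int where "d + 3 \<le> \<alpha> * \<kappa>" "0 < \<kappa>"
proof
  let ?\<kappa> = "max 1 \<lceil>(d + 3) / \<alpha>\<rceil>"
  have "(d + 3) / \<alpha> \<le> real_of_int ?\<kappa>" by linarith
  then show "d + 3 \<le> \<alpha> * real_of_int ?\<kappa>" using assms by (simp add: divide_le_eq mult.commute)
qed simp

text \<open>The constant is fixed before f, V and F. Asking only for a bound on the mollified
  gradients, uniform in the mollification and in the ball, lets Sobolev and BV functions be treated
  alike.\<close>

theorem finite_sum_bound:
  fixes \<alpha> p :: real
  assumes \<alpha>: "\<alpha> > 0" and p: "1 \<le> p"
  shows "\<exists>C\<ge>0. \<forall>(f :: real^'n \<Rightarrow> real) V F. locally_L1 f \<longrightarrow> 0 \<le> V \<longrightarrow>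
     (\<forall>j R. (\<integral>\<^sup>+x. ennreal (norm (mollify_grad f j x) powr p) * indicator (cball 0 R) x \<partial>lborel) \<le> ennreal V) \<longrightarrow>
     finite F \<longrightarrow> F \<subseteq> Qalpha \<alpha> f \<longrightarrow>
     (\<Sum>(n, k)\<in>F. (side n powr (real CARD('n) / p - 1) * avg f (dcube n k)) powr p) \<le> C * V"
proof -
  obtain \<kappa> :: int where \<kappa>: "real CARD('n) + 3 \<le> \<alpha> * \<kappa>" "0 < \<kappa>" using ex_kappa[OF \<alpha>] by blast
  define C where "C = smooth_dyadic.cube_const TYPE('n) p \<kappa> * real (residues_card TYPE('n) \<kappa>)"
  \<comment> \<open>The constant does not depend on the function; the instance at the zero function
    gives access to its definition.\<close>
  interpret zero: smooth_dyadic "\<lambda>_::real^'n. 0" "\<lambda>_. 0" 0 by unfold_locales auto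
  have C0: "0 \<le> C" by (simp add: C_def zero.cube_const_def)
  have "(\<Sum>(n, k)\<in>F. (side n powr (real CARD('n) / p - 1) * avg f (dcube n k)) powr p) \<le> C * V"
    if f: "locally_L1 f" and V: "0 \<le> V" and
      bound: "\<And>j R. (\<integral>\<^sup>+x. ennreal (norm (mollify_grad f j x) powr p) * indicator (cball 0 R) x \<partial>lborel) \<le> ennreal V"
      and F: "finite F" "F \<subseteq> Qalpha \<alpha> f" for f :: "real^'n \<Rightarrow> real" and V F
  proof (rule LIMSEQ_le_const2)
    \<comment> \<open>High enough for the ancestors of order \<kappa> of all cubes in F, and fixed
      before the mollification parameter varies.\<close>
    define N where "N = Max (insert 0 ((\<lambda>(n, k). n + \<kappa>) ` F))"
    have N: "n + \<kappa> \<le> N" if "(n, k) \<in> F" for n k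
      unfolding N_def using F(1) that by (intro Max_ge) force+
    have "(\<lambda>j. avg (mollify f j) (dcube n k)) \<longlonglongrightarrow> avg f (dcube n k)" for n and k :: "int^'n"
      unfolding mollify_def by (rule avg_conv_tendsto[OF f])
    then show "(\<lambda>j. \<Sum>(n, k)\<in>F. (side n powr (real CARD('n) / p - 1) * avg (mollify f j) (dcube n k)) powr p)
      \<longlonglongrightarrow> (\<Sum>(n, k)\<in>F. (side n powr (real CARD('n) / p - 1) * avg f (dcube n k)) powr p)"
      unfolding split_beta using p
      by (intro tendsto_sum tendsto_powr' tendsto_mult tendsto_const) (auto simp: avg_nonneg intro!: always_eventually)
    have "\<forall>\<^sub>F j in sequentially. (\<Sum>(n, k)\<in>F. (side n powr (real CARD('n) / p - 1) * avg (mollify f j) (dcube n k)) powr p) \<le> C * V"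
      using eventually_good_cube[OF f F, of N]
    proof eventually_elim
      case (elim j)
      interpret smooth_dyadic "mollify f j" "mollify_grad f j" N
        unfolding mollify_def mollify_grad_def by (rule smooth_dyadic_conv[OF f])
      obtain R where "ennreal (\<Sum>(n, k)\<in>F. (side n powr (real CARD('n) / p - 1) * avg (mollify f j) (dcube n k)) powr p)
         \<le> ennreal C * (\<integral>\<^sup>+x. ennreal (norm (mollify_grad f j x) powr p) * indicator (cball 0 R) x \<partial>lborel)"
        unfolding C_def using elim N F(1) \<alpha> \<kappa> p by (rule_tac sum_estimate[of F \<kappa> \<alpha> p]) auto
      also have "\<dots> \<le> ennreal C * ennreal V" by (intro mult_left_mono bound) simp
      also have "\<dots> = ennreal (C * V)" using C0 V by (simp add: ennreal_mult)
      finally show ?case using C0 V by (subst (asm) ennreal_le_iff) auto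
    qed
    then show "\<exists>N. \<forall>j\<ge>N. (\<Sum>(n, k)\<in>F. (side n powr (real CARD('n) / p - 1) * avg (mollify f j) (dcube n k)) powr p) \<le> C * V"
      by (simp add: eventually_sequentially)
  qed
  then show ?thesis using C0 by blast
qed

text \<open>Cubes are treated one at a time, so n + \<kappa> can serve as the cap on the
  levels.\<close>

theorem sup_bound:
  fixes \<alpha> :: real
  assumes \<alpha>: "\<alpha> > 0"
  shows "\<exists>C\<ge>0. \<forall>(f :: real^'n \<Rightarrow> real) L n k. locally_L1 f \<longrightarrow> (\<forall>j x. norm (mollify_grad f j x) \<le> L) \<longrightarrow>
     (n, k) \<in> Qalpha \<alpha> f \<longrightarrow> side n powr (-1) * avg f (dcube n k) \<le> C * L"
proof -
  obtain \<kappa> :: int where \<kappa>: "real CARD('n) + 3 \<le> \<alpha> * \<kappa>" "0 < \<kappa>" using ex_kappa[OF \<alpha>] by blast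
  define C where "C = smooth_dyadic.cube_const TYPE('n) 1 \<kappa>"
  interpret zero: smooth_dyadic "\<lambda>_::real^'n. 0" "\<lambda>_. 0" 0 by unfold_locales auto
  have C0: "0 \<le> C" by (simp add: C_def zero.cube_const_def)
  have "side n powr (-1) * avg f (dcube n k) \<le> C * L"
    if f: "locally_L1 f" and L: "\<And>j x. norm (mollify_grad f j x) \<le> L" and Q: "(n, k) \<in> Qalpha \<alpha> f"
    for f :: "real^'n \<Rightarrow> real" and L n k
  proof (rule LIMSEQ_le_const2)
    show "(\<lambda>j. side n powr (-1) * avg (mollify f j) (dcube n k)) \<longlonglongrightarrow> side n powr (-1) * avg f (dcube n k)"
      unfolding mollify_def by (intro tendsto_mult tendsto_const avg_conv_tendsto[OF f])
    have "\<forall>\<^sub>F j in sequentially. smooth_dyadic.good_cube (mollify f j) (n + \<kappa>) \<alpha> n k"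
      using eventually_good_cube[OF f, of "{(n, k)}" \<alpha> "n + \<kappa>"] Q by simp
    then have "\<forall>\<^sub>F j in sequentially. side n powr (-1) * avg (mollify f j) (dcube n k) \<le> C * L"
    proof eventually_elim
      case (elim j)
      interpret smooth_dyadic "mollify f j" "mollify_grad f j" "n + \<kappa>"
        unfolding mollify_def mollify_grad_def by (rule smooth_dyadic_conv[OF f])
      show ?case unfolding C_def using sup_estimate[OF elim \<alpha> \<kappa> _ L] by simp
    qed
    then show "\<exists>N. \<forall>j\<ge>N. side n powr (-1) * avg (mollify f j) (dcube n k) \<le> C * L"
      by (simp add: eventually_sequentially)
  qed
  then show ?thesis using C0 by blast
qed

section \<open>Borel representatives of Lebesgue measurable functions\<close>

lemma borel_representative:
  fixes f :: "real^'n \<Rightarrow> real"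
  assumes "f \<in> borel_measurable lebesgue"
  obtains f0 where "f0 \<in> borel_measurable borel" "AE x in lebesgue. f x = f0 x"
proof -
  obtain f0 where "f0 \<in> borel_measurable lborel" "AE x in lborel. f x = f0 x"
    using completion_ex_borel_measurable_real[OF assms] by blast
  then show ?thesis using that[of f0] by (auto intro: AE_completion)
qed

lemma borel_measurable_nth:
  fixes g :: "'a \<Rightarrow> real^'n"
  assumes "g \<in> borel_measurable M"
  shows "(\<lambda>x. g x $ i) \<in> borel_measurable M"
  by (rule measurable_compose[OF assms], rule borel_measurable_continuous_onI) (intro continuous_intros)

lemma borel_representative_vec:
  fixes g :: "real^'n \<Rightarrow> real^'n"
  assumes g: "g \<in> borel_measurable lebesgue"
  obtains g0 where "g0 \<in> borel_measurable borel" "AE x in lebesgue. g x = g0 x"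
proof -
  have "(\<lambda>x. g x $ i) \<in> borel_measurable lebesgue" for i using g by (rule borel_measurable_nth)
  then have "\<exists>h. h \<in> borel_measurable borel \<and> (AE x in lebesgue. g x $ i = h x)" for i
    using borel_representative by metis
  then obtain h where h: "\<And>i. h i \<in> borel_measurable borel" "\<And>i. AE x in lebesgue. g x $ i = h i x" by metis
  define g0 where "g0 x = (\<chi> i. h i x)" for x
  have "AE x in lebesgue. \<forall>i\<in>UNIV. g x $ i = h i x" using h(2) by (subst AE_finite_all) auto
  then have "AE x in lebesgue. g x = g0 x" by eventually_elim (simp add: g0_def vec_eq_iff)
  moreover have "g0 \<in> borel_measurable borel"
  proof (subst borel_measurable_euclidean_space, safe)
    fix b :: "real^'n" assume "b \<in> Basis"
    then obtain i where "b = axis i 1" by (auto simp: Basis_vec_def)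
    then show "(\<lambda>x. g0 x \<bullet> b) \<in> borel_measurable borel" using h(1) by (simp add: g0_def inner_axis)
  qed
  ultimately show ?thesis using that by blast
qed

lemma borel_lebesgue: "f \<in> borel_measurable borel \<Longrightarrow> f \<in> borel_measurable lebesgue"
  by (simp add: measurable_completion)

lemma loc_integrable_representative:
  fixes f :: "real^'n \<Rightarrow> real"
  assumes f: "loc_integrable f" "f \<in> borel_measurable lebesgue" and f0: "f0 \<in> borel_measurable borel" "AE x in lebesgue. f x = f0 x"
  shows "locally_L1 f0"
  unfolding locally_L1_def
proof (intro conjI allI)
  fix R
  note [measurable] = f(2) f0(1) borel_lebesgue[OF f0(1)]
  have c [measurable]: "cball (0 :: real^'n) R \<in> sets lebesgue" by (rule sets_completionI_sets) simp
  have I1: "integrable lebesgue (\<lambda>x. indicator (cball 0 R) x *\<^sub>R f x)"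
    using f(1) unfolding loc_integrable_def set_integrable_def by auto
  have I2: "AE x in lebesgue. indicator (cball 0 R) x *\<^sub>R f x = indicator (cball 0 R) x *\<^sub>R f0 x"
    using f0(2) by eventually_elim simp
  have "integrable lebesgue (\<lambda>x. indicator (cball 0 R) x *\<^sub>R f0 x)"
    by (rule integrable_cong_AE_imp[OF I1 _ I2]) measurable
  moreover have "(\<lambda>x. indicator (cball 0 R) x *\<^sub>R f0 x) \<in> borel_measurable lborel" by measurable
  ultimately show "integrable lborel (\<lambda>x. indicator (cball 0 R) x * f0 x)"
    using integrable_completion[of "\<lambda>x. indicator (cball 0 R) x *\<^sub>R f0 x" lborel] by simp
qed (fact f0)

lemma LINT_representative:
  fixes f \<phi> :: "real^'n \<Rightarrow> real"
  assumes f: "f \<in> borel_measurable lebesgue" and f0: "f0 \<in> borel_measurable borel" "AE x in lebesgue. f x = f0 x"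
    and \<phi>: "\<phi> \<in> borel_measurable borel"
  shows "(LINT x|lebesgue. f x * \<phi> x) = (\<integral>x. f0 x * \<phi> x \<partial>lborel)"
proof -
  note [measurable] = f f0(1) borel_lebesgue[OF f0(1)] \<phi> borel_lebesgue[OF \<phi>]
  have "(LINT x|lebesgue. f x * \<phi> x) = (LINT x|lebesgue. f0 x * \<phi> x)"
  proof (rule integral_cong_AE)
    show "AE x in lebesgue. f x * \<phi> x = f0 x * \<phi> x" using f0(2) by eventually_elim simp
  qed measurable
  also have "\<dots> = (\<integral>x. f0 x * \<phi> x \<partial>lborel)" by (rule integral_completion) measurable
  finally show ?thesis .
qed

text \<open>The averages, and with them \<open>Qalpha\<close>, see f only up to null sets; this is
  what allows the passage to a Borel representative.\<close>

lemma avg_representative: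
  fixes f :: "real^'n \<Rightarrow> real"
  assumes f: "f \<in> borel_measurable lebesgue" and f0: "f0 \<in> borel_measurable borel" "AE x in lebesgue. f x = f0 x"
  shows "avg f (dcube n k) = avg f0 (dcube n k)"
proof -
  note [measurable] = f borel_lebesgue[OF f0(1)] sets_completionI_sets[OF borel_dcube[of n k, folded sets_lborel]]
  have "(LINT x:dcube n k|lebesgue. \<bar>f x\<bar>) = (LINT x:dcube n k|lebesgue. \<bar>f0 x\<bar>)"
    unfolding set_lebesgue_integral_def
  proof (rule integral_cong_AE)
    show "AE x in lebesgue. indicator (dcube n k) x *\<^sub>R \<bar>f x\<bar> = indicator (dcube n k) x *\<^sub>R \<bar>f0 x\<bar>"
      using f0(2) by eventually_elim simp
  qed measurable
  then show ?thesis by (simp add: avg_def)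
qed

text \<open>The reflected mollifier is inserted as a test function. Its derivative in y is minus the
  partial derivative at x - y, which cancels the sign of the integration by parts.\<close>

lemma mollify_grad_weak:
  fixes f :: "real^'n \<Rightarrow> real" and g :: "real^'n \<Rightarrow> real^'n"
  assumes w: "weak_gradient f g" and f: "f \<in> borel_measurable lebesgue" and g: "g \<in> borel_measurable lebesgue"
    and f0: "f0 \<in> borel_measurable borel" "AE x in lebesgue. f x = f0 x"
    and g0: "g0 \<in> borel_measurable borel" "AE x in lebesgue. g x = g0 x"
  shows "mollify_grad f0 j x = (\<chi> i. conv (\<lambda>y. g0 y $ i) (mol (1 / (real (Suc j))\<^sup>2)) x)"
proof -
  define r where "r = 1 / (real (Suc j))\<^sup>2"
  have "conv f0 (partial i (mol r)) x = conv (\<lambda>y. g0 y $ i) (mol r) x" for i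
  proof -
    have "has_partials (\<lambda>y. 1 * mol r (x - y)) (\<lambda>i y. - 1 * partial i (mol r) (x - y))"
      by (rule has_partials_reflect[OF mol_partials(1)])
    from has_partials_imp_partial[OF this, of i]
    have par: "partial i (\<lambda>y. mol r (x - y)) = (\<lambda>y. - partial i (mol r) (x - y))" by simp
    have "(LINT y|lebesgue. f y * partial i (\<lambda>y. mol r (x - y)) y) = - (LINT y|lebesgue. g y $ i * mol r (x - y))"
      using w test_fun_reflect[OF mol_bumps, of r x] unfolding weak_gradient_def by blast
    moreover have "(LINT y|lebesgue. f y * partial i (\<lambda>y. mol r (x - y)) y) = (\<integral>y. f0 y * partial i (\<lambda>y. mol r (x - y)) y \<partial>lborel)"
      unfolding par by (rule LINT_representative[OF f f0]) measurable
    moreover have "(LINT y|lebesgue. g y $ i * mol r (x - y)) = (\<integral>y. g0 y $ i * mol r (x - y) \<partial>lborel)"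
    proof (rule LINT_representative)
      show "(\<lambda>y. g y $ i) \<in> borel_measurable lebesgue" using g by (rule borel_measurable_nth)
      show "(\<lambda>y. g0 y $ i) \<in> borel_measurable borel" using g0(1) by (rule borel_measurable_nth)
      show "AE y in lebesgue. g y $ i = g0 y $ i" using g0(2) by eventually_elim simp
    qed measurable
    ultimately have "(\<integral>y. f0 y * (- partial i (mol r) (x - y)) \<partial>lborel) = - (\<integral>y. g0 y $ i * mol r (x - y) \<partial>lborel)"
      by (simp only: par)
    then show ?thesis by (simp add: conv_def)
  qed
  then show ?thesis by (simp add: mollify_grad_def grad_conv_def r_def)
qed

lemma locally_L1_weak_gradient:
  fixes g :: "real^'n \<Rightarrow> real^'n"
  assumes w: "weak_gradient f g" and g: "g \<in> borel_measurable lebesgue"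
    and g0: "g0 \<in> borel_measurable borel" "AE x in lebesgue. g x = g0 x"
  shows "locally_L1 (\<lambda>y. g0 y $ i)"
proof (rule loc_integrable_representative)
  show "loc_integrable (\<lambda>y. g y $ i)" using w by (simp add: weak_gradient_def)
  show "(\<lambda>y. g y $ i) \<in> borel_measurable lebesgue" using g by (rule borel_measurable_nth)
  show "(\<lambda>y. g0 y $ i) \<in> borel_measurable borel" using g0(1) by (rule borel_measurable_nth)
  show "AE y in lebesgue. g y $ i = g0 y $ i" using g0(2) by eventually_elim simp
qed

lemma Qalpha_representative:
  fixes f :: "real^'n \<Rightarrow> real"
  assumes "f \<in> borel_measurable lebesgue" "f0 \<in> borel_measurable borel" "AE x in lebesgue. f x = f0 x"
  shows "Qalpha \<alpha> f = Qalpha \<alpha> f0"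
  by (simp add: Qalpha_def avg_representative[OF assms])

section \<open>Conclusion for Sobolev functions, BV functions and the endpoint\<close>

lemma infsum_le_of_finite_sums:
  fixes h :: "'a \<Rightarrow> real"
  assumes "\<And>x. x \<in> A \<Longrightarrow> 0 \<le> h x" "\<And>F. finite F \<Longrightarrow> F \<subseteq> A \<Longrightarrow> sum h F \<le> b"
  shows "h summable_on A" "infsum h A \<le> b" "0 \<le> infsum h A"
proof -
  show s: "h summable_on A"
    using assms by (intro nonneg_bdd_above_summable_on bdd_aboveI[of _ b]) auto
  show "infsum h A \<le> b" using s assms(2) by (rule infsum_le_finite_sums)
  show "0 \<le> infsum h A" using assms(1) by (rule infsum_nonneg)
qed

text \<open>The bound V on the mollified gradients is the p-th power of the norm of g; taking the
  p-th root of C V turns the constant into \<open>C powr (1 / p)\<close>.\<close>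

lemma sobolev_case:
  fixes \<alpha> p :: real
  assumes \<alpha>: "0 < \<alpha>" and p: "1 \<le> p"
  shows "\<exists>C. \<forall>(f :: real^'n \<Rightarrow> real) g. sobolev p f g \<longrightarrow>
       (\<lambda>(n, k). ((side n) powr (real CARD('n) / p - 1) * avg f (dcube n k)) powr p)
          summable_on Qalpha \<alpha> f \<and>
       (\<Sum>\<^sub>\<infinity>(n, k)\<in>Qalpha \<alpha> f. ((side n) powr (real CARD('n) / p - 1) * avg f (dcube n k)) powr p)
          powr (1 / p) \<le> C * Lp_norm p g"
proof -
  obtain C where C0: "C \<ge> 0" and C: "\<And>(f :: real^'n \<Rightarrow> real) V F. locally_L1 f \<Longrightarrow> 0 \<le> V \<Longrightarrow>
     (\<And>j R. (\<integral>\<^sup>+x. ennreal (norm (mollify_grad f j x) powr p) * indicator (cball 0 R) x \<partial>lborel) \<le> ennreal V) \<Longrightarrow>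
     finite F \<Longrightarrow> F \<subseteq> Qalpha \<alpha> f \<Longrightarrow>
     (\<Sum>(n, k)\<in>F. (side n powr (real CARD('n) / p - 1) * avg f (dcube n k)) powr p) \<le> C * V"
    using finite_sum_bound[OF \<alpha> p, where 'n = 'n] by blast
  show ?thesis
  proof (intro exI[of _ "C powr (1 / p)"] allI impI)
    fix f :: "real^'n \<Rightarrow> real" and g assume "sobolev p f g"
    then have f: "f \<in> borel_measurable lebesgue" and g: "g \<in> borel_measurable lebesgue"
      and gp: "integrable lebesgue (\<lambda>x. norm (g x) powr p)" and w: "weak_gradient f g"
      by (auto simp: sobolev_def Lp_def)
    obtain f0 where f0: "f0 \<in> borel_measurable borel" "AE x in lebesgue. f x = f0 x" by (rule borel_representative[OF f])
    obtain g0 where g0: "g0 \<in> borel_measurable borel" "AE x in lebesgue. g x = g0 x" by (rule borel_representative_vec[OF g])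
    note [measurable] = g0(1) borel_lebesgue[OF g0(1)] g
    have fL: "locally_L1 f0"
      using w by (intro loc_integrable_representative[OF _ f f0]) (simp add: weak_gradient_def)
    note gL = locally_L1_weak_gradient[OF w g g0]
    have aep: "AE x in lebesgue. norm (g x) powr p = norm (g0 x) powr p"
      using g0(2) by eventually_elim simp
    have "integrable lebesgue (\<lambda>x. norm (g0 x) powr p)"
      by (rule integrable_cong_AE_imp[OF gp _ aep]) measurable
    then have g0p: "integrable lborel (\<lambda>x. norm (g0 x) powr p)"
      by (subst (asm) integrable_completion) auto
    define V where "V = (\<integral>x. norm (g0 x) powr p \<partial>lborel)"
    have V0: "0 \<le> V" unfolding V_def by (intro integral_nonneg_AE AE_I2) simp
    have V: "(LINT x|lebesgue. norm (g x) powr p) = V"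
    proof -
      have "(LINT x|lebesgue. norm (g x) powr p) = (LINT x|lebesgue. norm (g0 x) powr p)"
        by (rule integral_cong_AE[OF _ _ aep]) measurable
      also have "\<dots> = V" unfolding V_def by (rule integral_completion) measurable
      finally show ?thesis .
    qed
    have bound: "(\<integral>\<^sup>+x. ennreal (norm (mollify_grad f0 j x) powr p) * indicator (cball 0 R) x \<partial>lborel) \<le> ennreal V" for j R
    proof -
      have "(\<integral>\<^sup>+x. ennreal (norm (mollify_grad f0 j x) powr p) * indicator (cball 0 R) x \<partial>lborel)
        \<le> (\<integral>\<^sup>+x. ennreal (norm (mollify_grad f0 j x) powr p) \<partial>lborel)"
        by (intro nn_integral_mono) (auto split: split_indicator)
      also have "\<dots> \<le> ennreal V"
        unfolding mollify_grad_weak[OF w f g f0 g0] V_def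
        by (rule nn_integral_conv_vec_powr_le[OF gL g0(1) p g0p]) simp
      finally show ?thesis .
    qed
    let ?h = "\<lambda>(n, k). ((side n) powr (real CARD('n) / p - 1) * avg f (dcube n k)) powr p"
    have nn: "0 \<le> ?h Q" for Q by (simp add: split_beta)
    have fin: "sum ?h F \<le> C * V" if "finite F" "F \<subseteq> Qalpha \<alpha> f" for F
      using C[OF fL V0 bound, of F] that
      by (simp add: avg_representative[OF f f0] Qalpha_representative[OF f f0])
    note s = infsum_le_of_finite_sums[OF nn fin]
    have "infsum ?h (Qalpha \<alpha> f) powr (1 / p) \<le> (C * V) powr (1 / p)"
      using s p by (intro powr_mono2) auto
    also have "\<dots> = C powr (1 / p) * Lp_norm p g"
      using C0 V0 by (simp add: powr_mult Lp_norm_def V)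
    finally show "?h summable_on Qalpha \<alpha> f \<and> infsum ?h (Qalpha \<alpha> f) powr (1 / p) \<le> C powr (1 / p) * Lp_norm p g"
      using s(1) by blast
  qed
qed

text \<open>Makes the divergence of a test field Borel, so that f can be replaced by its
  representative under the integral.\<close>

lemma test_fun_partial_borel:
  assumes "test_fun \<phi>"
  shows "partial i \<phi> \<in> borel_measurable borel"
proof -
  have "iter_partial [i] \<phi> differentiable (at x)" for x
    using assms unfolding test_fun_def smooth_def by blast
  then have "continuous_on UNIV (partial i \<phi>)"
    by (auto intro!: continuous_at_imp_continuous_on differentiable_imp_continuous_within)
  then show ?thesis by (rule borel_measurable_continuous_onI)
qed

text \<open>The norm of the mollified gradient is at most the sum of the moduli of its d components,
  and the integral of each over a ball is bounded by the variation; this is the factor d in the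
  constant.\<close>

lemma bv_case:
  fixes \<alpha> :: real
  assumes \<alpha>: "0 < \<alpha>"
  shows "\<exists>C. \<forall>f :: real^'n \<Rightarrow> real. BV f \<longrightarrow>
       (\<lambda>(n, k). (side n) powr (real CARD('n) - 1) * avg f (dcube n k)) summable_on Qalpha \<alpha> f \<and>
       (\<Sum>\<^sub>\<infinity>(n, k)\<in>Qalpha \<alpha> f. (side n) powr (real CARD('n) - 1) * avg f (dcube n k)) \<le> C * var f"
proof -
  obtain C where C0: "C \<ge> 0" and C: "\<And>(f :: real^'n \<Rightarrow> real) V F. locally_L1 f \<Longrightarrow> 0 \<le> V \<Longrightarrow>
     (\<And>j R. (\<integral>\<^sup>+x. ennreal (norm (mollify_grad f j x) powr 1) * indicator (cball 0 R) x \<partial>lborel) \<le> ennreal V) \<Longrightarrow>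
     finite F \<Longrightarrow> F \<subseteq> Qalpha \<alpha> f \<Longrightarrow>
     (\<Sum>(n, k)\<in>F. (side n powr (real CARD('n) / 1 - 1) * avg f (dcube n k)) powr 1) \<le> C * V"
    using finite_sum_bound[OF \<alpha> order_refl, where 'n = 'n] by blast
  show ?thesis
  proof (intro exI[of _ "C * CARD('n)"] allI impI)
    fix f :: "real^'n \<Rightarrow> real" assume "BV f"
    then have f: "f \<in> borel_measurable lebesgue" and fi: "integrable lebesgue (\<lambda>x. norm (f x) powr 1)"
      and bdd: "bdd_above (var_set f)"
      by (auto simp: BV_def Lp_def)
    have fi: "integrable lebesgue f" using fi integrable_norm_iff[OF f] by simp
    obtain f0 where f0: "f0 \<in> borel_measurable borel" "AE x in lebesgue. f x = f0 x" by (rule borel_representative[OF f])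
    note [measurable] = f0(1) borel_lebesgue[OF f0(1)] f
    have "integrable lebesgue f0" by (rule integrable_cong_AE_imp[OF fi _ f0(2)]) measurable
    then have f0i: "integrable lborel f0" by (subst (asm) integrable_completion) auto
    have fL: "locally_L1 f0" by (rule locally_L1_integrable[OF f0i])
    have V: "(\<integral>x. f0 x * divg \<Phi> x \<partial>lborel) \<le> var f"
      if "\<And>i. test_fun (\<lambda>x. \<Phi> x $ i)" "\<And>x. norm (\<Phi> x) \<le> 1" for \<Phi>
    proof -
      have "divg \<Phi> \<in> borel_measurable borel"
        unfolding divg_def[abs_def] by (intro borel_measurable_sum test_fun_partial_borel that)
      then have "(\<integral>x. f0 x * divg \<Phi> x \<partial>lborel) = (LINT x|lebesgue. f x * divg \<Phi> x)"
        by (rule LINT_representative[OF f f0, symmetric])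
      also have "\<dots> \<le> var f"
        unfolding var_def using that by (intro cSup_upper bdd) (auto simp: var_set_def)
      finally show ?thesis .
    qed
    \<comment> \<open>The zero field is admissible in the supremum.\<close>
    have var0: "0 \<le> var f"
      using V[of "\<lambda>_. 0"] by (simp add: divg_zero test_fun_zero)
    have bound: "(\<integral>\<^sup>+x. ennreal (norm (mollify_grad f0 j x) powr 1) * indicator (cball 0 R) x \<partial>lborel)
      \<le> ennreal (CARD('n) * var f)" for j R
    proof -
      let ?r = "1 / (real (Suc j))\<^sup>2"
      let ?c = "\<lambda>i. conv f0 (partial i (mol ?r))"
      have [measurable]: "?c i \<in> borel_measurable borel" for i
        by (intro borel_measurable_continuous_onI conv_bumps_continuous[OF fL mol_partials(2)])
      have "(\<integral>\<^sup>+x. ennreal (norm (mollify_grad f0 j x) powr 1) * indicator (cball 0 R) x \<partial>lborel)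
        \<le> (\<integral>\<^sup>+x. (\<Sum>i\<in>UNIV. ennreal \<bar>?c i x\<bar> * indicator (cball 0 R) x) \<partial>lborel)"
      proof (rule nn_integral_mono)
        fix x
        have "norm (mollify_grad f0 j x) \<le> (\<Sum>i\<in>UNIV. \<bar>?c i x\<bar>)"
          using norm_le_l1_cart[of "mollify_grad f0 j x"] by (simp add: mollify_grad_def grad_conv_def)
        then have "ennreal (norm (mollify_grad f0 j x)) \<le> ennreal (\<Sum>i\<in>UNIV. \<bar>?c i x\<bar>)" by (rule ennreal_leI)
        then have "ennreal (norm (mollify_grad f0 j x)) \<le> (\<Sum>i\<in>UNIV. ennreal \<bar>?c i x\<bar>)"
          by (subst sum_ennreal) auto
        then show "ennreal (norm (mollify_grad f0 j x) powr 1) * indicator (cball 0 R) x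
          \<le> (\<Sum>i\<in>UNIV. ennreal \<bar>?c i x\<bar> * indicator (cball 0 R) x)"
          by (auto split: split_indicator)
      qed
      also have "\<dots> = (\<Sum>i\<in>UNIV. \<integral>\<^sup>+x. ennreal \<bar>?c i x\<bar> * indicator (cball 0 R) x \<partial>lborel)"
        by (rule nn_integral_sum) measurable
      also have "\<dots> \<le> (\<Sum>i\<in>(UNIV::'n set). ennreal (var f))"
        by (intro sum_mono nn_integral_partial_conv_le_var[OF f0i f0(1) _ V]) auto
      also have "\<dots> = ennreal (CARD('n) * var f)"
        using var0 by (simp add: ennreal_mult ennreal_of_nat_eq_real_of_nat)
      finally show ?thesis .
    qed
    let ?h = "\<lambda>(n, k). (side n) powr (real CARD('n) - 1) * avg f (dcube n k)"
    have nn: "0 \<le> ?h Q" for Q by (simp add: avg_nonneg split_beta)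
    have fin: "sum ?h F \<le> C * (CARD('n) * var f)" if "finite F" "F \<subseteq> Qalpha \<alpha> f" for F
      using C[OF fL _ bound, of F] that var0
      by (simp add: avg_representative[OF f f0] Qalpha_representative[OF f f0] avg_nonneg)
    note s = infsum_le_of_finite_sums[OF nn fin]
    then show "?h summable_on Qalpha \<alpha> f \<and> infsum ?h (Qalpha \<alpha> f) \<le> C * CARD('n) * var f"
      by (simp add: mult.assoc)
  qed
qed

lemma sobolev_inf_case:
  fixes \<alpha> :: real
  assumes \<alpha>: "0 < \<alpha>"
  shows "\<exists>C. \<forall>(f :: real^'n \<Rightarrow> real) g. sobolev_inf f g \<longrightarrow>
       (\<forall>(n, k)\<in>Qalpha \<alpha> f. ereal ((side n) powr (-1) * avg f (dcube n k)) \<le> ereal C * Linf_norm g)"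
proof -
  obtain C where C: "\<And>(f :: real^'n \<Rightarrow> real) L n k. locally_L1 f \<Longrightarrow> (\<And>j x. norm (mollify_grad f j x) \<le> L) \<Longrightarrow>
     (n, k) \<in> Qalpha \<alpha> f \<Longrightarrow> side n powr (-1) * avg f (dcube n k) \<le> C * L"
    using sup_bound[OF \<alpha>, where 'n = 'n] by blast
  show ?thesis
  proof (intro exI[of _ C] allI impI)
    fix f :: "real^'n \<Rightarrow> real" and g :: "real^'n \<Rightarrow> real^'n" assume "sobolev_inf f g"
    then have f: "f \<in> borel_measurable lebesgue" and g: "g \<in> borel_measurable lebesgue"
      and gp: "Linf_norm g < \<infinity>" and w: "weak_gradient f g"
      by (auto simp: sobolev_inf_def Linf_def)
    have ae: "AE x in lebesgue. ereal (norm (g x)) \<le> Linf_norm g"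
      unfolding Linf_norm_def by (rule esssup_AE)
    \<comment> \<open>The essential supremum is an extended real. A negative value would make the
      whole space null, so together with the upper bound it is a real number
      \<open>L\<close>.\<close>
    have "0 \<le> Linf_norm g"
    proof (rule ccontr)
      assume "\<not> 0 \<le> Linf_norm g"
      then have neg: "Linf_norm g < 0" by simp
      have "AE x in lebesgue :: (real^'n) measure. False"
        using ae
      proof eventually_elim
        case (elim x)
        from le_less_trans[OF this neg] show ?case by simp
      qed
      then have "AE x in lborel :: (real^'n) measure. False" by (simp only: AE_completion_iff)
      then have "emeasure lborel (UNIV :: (real^'n) set) = 0"
        by (subst (asm) AE_iff_measurable[of UNIV]) auto
      then show False by simp
    qed
    then obtain L where L: "Linf_norm g = ereal L" "0 \<le> L" using gp by (cases "Linf_norm g") auto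
    obtain f0 where f0: "f0 \<in> borel_measurable borel" "AE x in lebesgue. f x = f0 x" by (rule borel_representative[OF f])
    obtain g0 where g0: "g0 \<in> borel_measurable borel" "AE x in lebesgue. g x = g0 x" by (rule borel_representative_vec[OF g])
    have fL: "locally_L1 f0"
      using w by (intro loc_integrable_representative[OF _ f f0]) (simp add: weak_gradient_def)
    note gL = locally_L1_weak_gradient[OF w g g0]
    have "AE x in lebesgue. norm (g0 x) \<le> L"
      using ae g0(2) by eventually_elim (simp add: L)
    then have aeL: "AE x in lborel. norm (g0 x) \<le> L" by (simp only: AE_completion_iff)
    \<comment> \<open>The bound on g holds almost everywhere; averaging against the mollifier turns
      it into a bound at every point.\<close>
    have bound: "norm (mollify_grad f0 j x) \<le> L" for j x
    proof -
      have "norm (mollify_grad f0 j x) \<le> conv (\<lambda>y. norm (g0 y)) (mol (1 / (real (Suc j))\<^sup>2)) x"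
        unfolding mollify_grad_weak[OF w f g f0 g0] by (rule norm_conv_vec_le[OF gL g0(1)])
      also have "\<dots> \<le> conv (\<lambda>_. L) (mol (1 / (real (Suc j))\<^sup>2)) x"
        by (intro conv_mono locally_L1_norm gL g0(1) locally_L1_const aeL)
      also have "\<dots> = L" by (rule conv_const) simp
      finally show ?thesis .
    qed
    show "\<forall>(n, k)\<in>Qalpha \<alpha> f. ereal ((side n) powr (-1) * avg f (dcube n k)) \<le> ereal C * Linf_norm g"
    proof safe
      fix n k assume "(n, k) \<in> Qalpha \<alpha> f"
      then have "side n powr (-1) * avg f (dcube n k) \<le> C * L"
        using C[OF fL bound, of n k]
        by (simp only: avg_representative[OF f f0] Qalpha_representative[OF f f0])
      then show "ereal ((side n) powr (-1) * avg f (dcube n k)) \<le> ereal C * Linf_norm g" by (simp add: L)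
    qed
  qed
qed

theorem theorem1p4:
  fixes \<alpha> :: real
  assumes "0 < \<alpha>" and "\<alpha> < real CARD('n)"
  shows
   "(\<forall>p::real. 1 \<le> p \<longrightarrow> (\<exists>C. \<forall>(f :: real^'n \<Rightarrow> real) g. sobolev p f g \<longrightarrow>
       (\<lambda>(n, k). ((side n) powr (real CARD('n) / p - 1) * avg f (dcube n k)) powr p)
          summable_on Qalpha \<alpha> f \<and>
       (\<Sum>\<^sub>\<infinity>(n, k)\<in>Qalpha \<alpha> f. ((side n) powr (real CARD('n) / p - 1) * avg f (dcube n k)) powr p)
          powr (1 / p) \<le> C * Lp_norm p g))
  \<and> (\<exists>C. \<forall>f :: real^'n \<Rightarrow> real. BV f \<longrightarrow>
       (\<lambda>(n, k). (side n) powr (real CARD('n) - 1) * avg f (dcube n k)) summable_on Qalpha \<alpha> f \<and>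
       (\<Sum>\<^sub>\<infinity>(n, k)\<in>Qalpha \<alpha> f. (side n) powr (real CARD('n) - 1) * avg f (dcube n k)) \<le> C * var f)
  \<and> (\<exists>C. \<forall>(f :: real^'n \<Rightarrow> real) g. sobolev_inf f g \<longrightarrow>
       (\<forall>(n, k)\<in>Qalpha \<alpha> f. ereal ((side n) powr (-1) * avg f (dcube n k)) \<le> ereal C * Linf_norm g))"
  by (intro conjI allI impI sobolev_case[OF assms(1)] bv_case[OF assms(1)] sobolev_inf_case[OF assms(1)])

end
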